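(* Let $G$ be the group of $\mathbb{C}$-automorphisms of the Weyl algebra $A=\mathbb{C}\langle x,y\rangle/(xy-yx-1)$, acting on the Calogero-Moser spaces $\mathcal{C}_n$ ($n\ge 1$) as described in the context. (i) For any $n\ge 1$, let $f:\mathcal{C}_n\to\mathcal{C}_n$ be a $G$-equivariant map. Then $f$ is the identity. (ii) For integers $n,m\ge 1$ with $n\ne m$, there is no $G$-equivariant map from $\mathcal{C}_n$ to $\mathcal{C}_m$.
   Context: $A=\mathbb{C}\langle x,y\rangle/(xy-yx-1)$ and $G$ is the group of $\mathbb{C}$-algebra automorphisms of $A$. For $n\ge 1$, the Calogero-Moser space $\mathcal{C}_n$ is the set of simultaneous conjugacy classes (under $GL_n(\mathbb{C})$) of pairs $(X,Y)$ of complex $n\times n$ matrices such that $[X,Y]+I$ has rank $1$. The notation $(X,Y)$ is used both for a pair and for its class in $\mathcal{C}_n$. For polynomials $p,q$ in one variable over $\mathbb{C}$, let $\Phi_p,\Psi_q\in G$ be given by $\Phi_p(x)=x-p(y)$, $\Phi_p(y)=y$, and $\Psi_q(x)=x$, $\Psi_q(y)=y-q(x)$. By a theorem of Dixmier, these automorphisms generate $G$. The action of $G$ on each $\mathcal{C}_n$ is the (well-defined) one determined by $$\Phi_p(X,Y)=(X+p(Y),\,Y),\qquad \Psi_q(X,Y)=(X,\,Y+q(X)).$$ A $G$-equivariant map is a map of sets commuting with the action of $G$; no continuity or algebraicity is assumed. *)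

theory Defs
  imports
    "HOL-Library.Poly_Mapping"
    "HOL-Algebra.Group_Action"
    "HOL-Algebra.QuotRing"
    "HOL-Computational_Algebra.Polynomial"
    "Jordan_Normal_Form.DL_Rank"
begin

section \<open>The free algebra on two generators\<close>

text \<open>
  The free algebra is the monoid algebra of the free monoid on two letters: the product of
  \<^typ>\<open>'a \<Rightarrow>\<^sub>0 'b\<close> is the convolution product with respect to the (additively written, not
  necessarily commutative) monoid \<^typ>\<open>'a\<close>.
\<close>

datatype gen = Gen_x | Gen_y

datatype word = Word (letters: "gen list")

instantiation word :: monoid_add
begin
definition zero_word :: word where "0 = Word []"
definition plus_word :: "word \<Rightarrow> word \<Rightarrow> word" where "v + w = Word (letters v @ letters w)"
instance
  by standard (simp_all add: zero_word_def plus_word_def)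
end

type_synonym free_alg = "word \<Rightarrow>\<^sub>0 complex"

definition free_const :: "complex \<Rightarrow> free_alg" where
  "free_const c = Poly_Mapping.single 0 c"

definition free_x :: free_alg where
  "free_x = Poly_Mapping.single (Word [Gen_x]) 1"

definition free_y :: free_alg where
  "free_y = Poly_Mapping.single (Word [Gen_y]) 1"

definition free_ring :: "free_alg ring" where
  "free_ring = \<lparr>carrier = UNIV, mult = (*), one = 1, zero = 0, add = (+)\<rparr>"


section \<open>The Weyl algebra and its automorphism group\<close>

text \<open>In HOL-Algebra, \<^const>\<open>genideal\<close> is the generated two-sided ideal.\<close>

definition weyl_ideal :: "free_alg set" where
  "weyl_ideal = genideal free_ring {free_x * free_y - free_y * free_x - 1}"

definition weyl :: "free_alg set ring" where
  "weyl = free_ring Quot weyl_ideal"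

definition weyl_proj :: "free_alg \<Rightarrow> free_alg set" where
  "weyl_proj a = weyl_ideal +>\<^bsub>free_ring\<^esub> a"

definition weyl_x :: "free_alg set" where "weyl_x = weyl_proj free_x"
definition weyl_y :: "free_alg set" where "weyl_y = weyl_proj free_y"

definition weyl_const :: "complex \<Rightarrow> free_alg set" where
  "weyl_const c = weyl_proj (free_const c)"

definition weyl_poly :: "complex poly \<Rightarrow> free_alg set \<Rightarrow> free_alg set" where
  "weyl_poly p a =
     (\<Oplus>\<^bsub>weyl\<^esub>k\<in>{..degree p}. weyl_const (coeff p k) \<otimes>\<^bsub>weyl\<^esub> a [^]\<^bsub>weyl\<^esub> k)"

text \<open>
  Elements of \<^const>\<open>Bij\<close> are extensional, so that every automorphism is represented by exactly
  one function. A ring automorphism is an automorphism of complex algebras iff it fixes the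
  image of the complex numbers. The product is composition.
\<close>

definition weyl_auts :: "(free_alg set \<Rightarrow> free_alg set) set" where
  "weyl_auts =
     {\<sigma> \<in> Bij (carrier weyl). \<sigma> \<in> Ring.ring_hom weyl weyl \<and> (\<forall>c. \<sigma> (weyl_const c) = weyl_const c)}"

definition weyl_aut_group :: "(free_alg set \<Rightarrow> free_alg set) monoid" where
  "weyl_aut_group = BijGroup (carrier weyl) \<lparr>carrier := weyl_auts\<rparr>"

definition weyl_Phi :: "complex poly \<Rightarrow> free_alg set \<Rightarrow> free_alg set" where
  "weyl_Phi p = (THE \<sigma>. \<sigma> \<in> weyl_auts \<and>
     \<sigma> weyl_x = weyl_x \<ominus>\<^bsub>weyl\<^esub> weyl_poly p weyl_y \<and> \<sigma> weyl_y = weyl_y)"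

definition weyl_Psi :: "complex poly \<Rightarrow> free_alg set \<Rightarrow> free_alg set" where
  "weyl_Psi q = (THE \<sigma>. \<sigma> \<in> weyl_auts \<and>
     \<sigma> weyl_x = weyl_x \<and> \<sigma> weyl_y = weyl_y \<ominus>\<^bsub>weyl\<^esub> weyl_poly q weyl_x)"


section \<open>Calogero-Moser spaces\<close>

definition CM_pairs :: "nat \<Rightarrow> (complex mat \<times> complex mat) set" where
  "CM_pairs n = {(X, Y). X \<in> carrier_mat n n \<and> Y \<in> carrier_mat n n \<and>
     vec_space.rank n (X * Y - Y * X + 1\<^sub>m n) = 1}"

text \<open>
  \<^term>\<open>similar_mat_wit A B P Q\<close> says that \<open>A = P * B * Q\<close> with \<open>Q\<close> the inverse of \<open>P\<close>; the
  witnesses are shared by the two components.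
\<close>

definition CM_conj :: "nat \<Rightarrow> ((complex mat \<times> complex mat) \<times> (complex mat \<times> complex mat)) set" where
  "CM_conj n = {((X, Y), (X', Y')). (X, Y) \<in> CM_pairs n \<and> (X', Y') \<in> CM_pairs n \<and>
     (\<exists>P Q. similar_mat_wit X X' P Q \<and> similar_mat_wit Y Y' P Q)}"

definition CM_space :: "nat \<Rightarrow> (complex mat \<times> complex mat) set set" where
  "CM_space n = CM_pairs n // CM_conj n"

definition CM_class :: "nat \<Rightarrow> complex mat \<Rightarrow> complex mat \<Rightarrow> (complex mat \<times> complex mat) set" where
  "CM_class n X Y = CM_conj n `` {(X, Y)}"

definition mat_poly :: "nat \<Rightarrow> complex poly \<Rightarrow> complex mat \<Rightarrow> complex mat" where
  "mat_poly n p M = mat n n (\<lambda>(i, j). \<Sum>k\<le>degree p. coeff p k * (M ^\<^sub>m k) $$ (i, j))"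


section \<open>The action and equivariant maps\<close>

text \<open>
  The action of the automorphism group on the \<open>n\<close>-th Calogero-Moser space is characterised by
  its values on the generators \<^const>\<open>weyl_Phi\<close>, \<^const>\<open>weyl_Psi\<close>. That there is such an action
  is a theorem of Berest and Wilson, that there is at most one follows from Dixmier's theorem.
  It is a left action: \<open>\<sigma> \<tau>\<close> is \<open>\<sigma> \<circ> \<tau>\<close> on the Weyl algebra, and it acts by
  \<open>\<tau>\<close> first and then \<open>\<sigma>\<close>.
\<close>

definition is_CM_action ::
  "nat \<Rightarrow> ((free_alg set \<Rightarrow> free_alg set) \<Rightarrow>
     (complex mat \<times> complex mat) set \<Rightarrow> (complex mat \<times> complex mat) set) \<Rightarrow> bool" where
  "is_CM_action n \<phi> \<longleftrightarrow>
     group_action weyl_aut_group (CM_space n) \<phi> \<and>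
     (\<forall>p X Y. (X, Y) \<in> CM_pairs n \<longrightarrow>
        \<phi> (weyl_Phi p) (CM_class n X Y) = CM_class n (X + mat_poly n p Y) Y) \<and>
     (\<forall>q X Y. (X, Y) \<in> CM_pairs n \<longrightarrow>
        \<phi> (weyl_Psi q) (CM_class n X Y) = CM_class n X (Y + mat_poly n q X))"

definition equivariant_map ::
  "('g, 'm) monoid_scheme \<Rightarrow> 'a set \<Rightarrow> ('g \<Rightarrow> 'a \<Rightarrow> 'a) \<Rightarrow> 'b set \<Rightarrow> ('g \<Rightarrow> 'b \<Rightarrow> 'b) \<Rightarrow>
     ('a \<Rightarrow> 'b) \<Rightarrow> bool" where
  "equivariant_map G E \<phi> E' \<phi>' f \<longleftrightarrow>
     f \<in> E \<rightarrow> E' \<and> (\<forall>g\<in>carrier G. \<forall>e\<in>E. f (\<phi> g e) = \<phi>' g (f e))"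


section \<open>The definitions are meaningful\<close>

lemma free_induct [case_names single add]:
  fixes f :: free_alg
  assumes "\<And>w c. P (Poly_Mapping.single w c)" "\<And>f g. P f \<Longrightarrow> P g \<Longrightarrow> P (f + g)"
  shows "P f"
proof (induction f rule: Poly_Mapping.update_induct)
  case const
  show ?case using assms(1)[of 0 0] by simp
next
  case (update f w c)
  have "Poly_Mapping.update w c f = f + Poly_Mapping.single w c"
    using update(1) by (intro poly_mapping_eqI)
      (auto simp: lookup_update lookup_add lookup_single when_def in_keys_iff)
  then show ?case using assms update by metis
qed

lemma free_const_central: "free_const c * f = f * free_const c"
  by (induction f rule: free_induct)
    (auto simp: free_const_def mult_single algebra_simps)

lemma single_conv_free_const:
  "(Poly_Mapping.single w c :: free_alg) = free_const c * Poly_Mapping.single w 1"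
  by (simp add: free_const_def mult_single)

lemma free_ring_sel [simp]:
  "carrier free_ring = UNIV" "mult free_ring = (*)" "add free_ring = (+)"
  "one free_ring = 1" "zero free_ring = 0"
  by (simp_all add: free_ring_def)

lemma ring_free_ring: "ring free_ring"
proof (rule ringI)
  show "abelian_group free_ring"
  proof (rule abelian_groupI)
    fix x show "\<exists>y\<in>carrier free_ring. y \<oplus>\<^bsub>free_ring\<^esub> x = \<zero>\<^bsub>free_ring\<^esub>"
      by (auto intro: exI[of _ "-x"])
  qed (auto simp: algebra_simps)
  show "monoid free_ring" by (rule monoidI) (auto simp: algebra_simps)
qed (auto simp: algebra_simps)

interpretation free_ring: ring free_ring by (rule ring_free_ring)

lemma free_ring_a_inv: "\<ominus>\<^bsub>free_ring\<^esub> a = - a"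
  by (rule free_ring.minus_equality) auto

lemma ideal_weyl_ideal: "ideal weyl_ideal free_ring"
  unfolding weyl_ideal_def by (rule free_ring.genideal_ideal) simp

lemma abelian_subgroup_weyl_ideal: "abelian_subgroup weyl_ideal free_ring"
  using ideal.axioms(1)[OF ideal_weyl_ideal] free_ring.abelian_group_axioms
  by (rule abelian_subgroupI3)

lemma ring_weyl: "ring weyl"
  unfolding weyl_def by (rule ideal.quotient_is_ring[OF ideal_weyl_ideal])

interpretation weyl: ring weyl by (rule ring_weyl)

lemma weyl_proj_hom: "weyl_proj \<in> Ring.ring_hom free_ring weyl"
  using ideal.rcos_ring_hom[OF ideal_weyl_ideal] by (simp add: weyl_def weyl_proj_def[abs_def])

lemma weyl_proj_carrier [simp]: "weyl_proj a \<in> carrier weyl"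
  using ring_hom_closed[OF weyl_proj_hom] by simp

lemma weyl_proj_add: "weyl_proj (a + b) = weyl_proj a \<oplus>\<^bsub>weyl\<^esub> weyl_proj b"
  using ring_hom_add[OF weyl_proj_hom] by simp

lemma weyl_proj_mult: "weyl_proj (a * b) = weyl_proj a \<otimes>\<^bsub>weyl\<^esub> weyl_proj b"
  using ring_hom_mult[OF weyl_proj_hom] by simp

lemma weyl_proj_one: "weyl_proj 1 = \<one>\<^bsub>weyl\<^esub>"
  using ring_hom_one[OF weyl_proj_hom] by simp

lemma weyl_proj_zero: "weyl_proj 0 = \<zero>\<^bsub>weyl\<^esub>"
  using ring_hom_zero[OF weyl_proj_hom ring_free_ring ring_weyl] by simp

lemma weyl_proj_diff: "weyl_proj (a - b) = weyl_proj a \<ominus>\<^bsub>weyl\<^esub> weyl_proj b"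
proof -
  have "weyl_proj a = weyl_proj (a - b) \<oplus>\<^bsub>weyl\<^esub> weyl_proj b"
    by (simp flip: weyl_proj_add)
  then show ?thesis
    by (simp add: a_minus_def weyl.a_assoc weyl.r_neg)
qed

lemma weyl_carrierE:
  assumes "C \<in> carrier weyl" obtains a where "C = weyl_proj a"
  using assms by (auto simp: weyl_def FactRing_def A_RCOSETS_def' weyl_proj_def
      a_r_coset_def r_coset_def)

lemma weyl_proj_eq_iff: "weyl_proj a = weyl_proj b \<longleftrightarrow> a - b \<in> weyl_ideal"
proof
  assume *: "weyl_proj a = weyl_proj b"
  have "a \<in> weyl_proj a"
    unfolding weyl_proj_def by (rule abelian_subgroup.a_rcos_self[OF abelian_subgroup_weyl_ideal]) simp
  with * show "a - b \<in> weyl_ideal"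
    by (auto simp: weyl_proj_def a_r_coset_def r_coset_def)
next
  assume *: "a - b \<in> weyl_ideal"
  have "weyl_proj (a - b) = \<zero>\<^bsub>weyl\<^esub>"
    using abelian_subgroup.a_rcos_const[OF abelian_subgroup_weyl_ideal, of "a - b"] * by (simp add: weyl_proj_def weyl_def FactRing_def)
  then show "weyl_proj a = weyl_proj b"
    using weyl_proj_add[of "a - b" b] by simp
qed

lemma weyl_commutation:
  "weyl_x \<otimes>\<^bsub>weyl\<^esub> weyl_y \<ominus>\<^bsub>weyl\<^esub> weyl_y \<otimes>\<^bsub>weyl\<^esub> weyl_x = \<one>\<^bsub>weyl\<^esub>"
proof -
  have "weyl_proj (free_x * free_y - free_y * free_x) = weyl_proj 1"
    unfolding weyl_proj_eq_iff weyl_ideal_def using free_ring.genideal_self' by simp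
  then show ?thesis
    by (simp add: weyl_proj_diff weyl_proj_mult weyl_proj_one weyl_x_def weyl_y_def)
qed

lemma group_weyl_aut_group: "group weyl_aut_group"
proof -
  have closed: "\<sigma> C \<in> carrier weyl" if "\<sigma> \<in> weyl_auts" "C \<in> carrier weyl" for \<sigma> C
    using that by (auto simp: weyl_auts_def Ring.ring_hom_def)
  have const: "weyl_const c \<in> carrier weyl" for c by (simp add: weyl_const_def)
  have "subgroup weyl_auts (BijGroup (carrier weyl))"
  proof (rule group.subgroupI[OF group_BijGroup])
    show "weyl_auts \<subseteq> carrier (BijGroup (carrier weyl))"
      by (auto simp: weyl_auts_def BijGroup_def)
    have "(\<lambda>x\<in>carrier weyl. x) \<in> weyl_auts"
      using const by (auto simp: weyl_auts_def id_Bij intro!: ring_hom_memI)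
    then show "weyl_auts \<noteq> {}" by blast
    show "\<sigma> \<otimes>\<^bsub>BijGroup (carrier weyl)\<^esub> \<tau> \<in> weyl_auts"
      if "\<sigma> \<in> weyl_auts" "\<tau> \<in> weyl_auts" for \<sigma> \<tau>
    proof -
      from that have B: "\<sigma> \<in> Bij (carrier weyl)" "\<tau> \<in> Bij (carrier weyl)"
        and H: "\<sigma> \<in> Ring.ring_hom weyl weyl" "\<tau> \<in> Ring.ring_hom weyl weyl"
        by (auto simp: weyl_auts_def)
      have "compose (carrier weyl) \<sigma> \<tau> \<in> Ring.ring_hom weyl weyl"
        using that
        by (intro ring_hom_memI)
          (simp_all add: compose_def closed H[THEN ring_hom_add] H[THEN ring_hom_mult]
            H[THEN ring_hom_one])
      then have "compose (carrier weyl) \<sigma> \<tau> \<in> weyl_auts"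
        using that const B by (simp add: weyl_auts_def compose_Bij compose_eq)
      then show ?thesis using that by (auto simp: BijGroup_def weyl_auts_def)
    qed
    show "inv\<^bsub>BijGroup (carrier weyl)\<^esub> \<sigma> \<in> weyl_auts" if "\<sigma> \<in> weyl_auts" for \<sigma>
    proof -
      from that have B: "\<sigma> \<in> Bij (carrier weyl)" and H: "\<sigma> \<in> Ring.ring_hom weyl weyl"
        and K: "\<And>c. \<sigma> (weyl_const c) = weyl_const c"
        by (auto simp: weyl_auts_def)
      have inj: "inj_on \<sigma> (carrier weyl)" using B by (auto simp: Bij_def bij_betw_def)
      let ?i = "inv_into (carrier weyl) \<sigma>"
      have mem: "\<And>C. C \<in> carrier weyl \<Longrightarrow> ?i C \<in> carrier weyl"
        by (rule Bij_inv_into_mem[OF B])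
      have "(\<lambda>x\<in>carrier weyl. ?i x) \<in> Ring.ring_hom weyl weyl"
      proof (rule ring_hom_memI)
        fix C D assume CD: "C \<in> carrier weyl" "D \<in> carrier weyl"
        show "(\<lambda>x\<in>carrier weyl. ?i x) C \<in> carrier weyl" using mem CD by simp
        show "(\<lambda>x\<in>carrier weyl. ?i x) (C \<otimes>\<^bsub>weyl\<^esub> D) =
            (\<lambda>x\<in>carrier weyl. ?i x) C \<otimes>\<^bsub>weyl\<^esub> (\<lambda>x\<in>carrier weyl. ?i x) D"
          using Bij_inv_into_lemma[of "carrier weyl" \<sigma> "(\<otimes>\<^bsub>weyl\<^esub>)"] B CD H
          by (simp add: ring_hom_mult)
        show "(\<lambda>x\<in>carrier weyl. ?i x) (C \<oplus>\<^bsub>weyl\<^esub> D) =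
            (\<lambda>x\<in>carrier weyl. ?i x) C \<oplus>\<^bsub>weyl\<^esub> (\<lambda>x\<in>carrier weyl. ?i x) D"
          using Bij_inv_into_lemma[of "carrier weyl" \<sigma> "(\<oplus>\<^bsub>weyl\<^esub>)"] B CD H
          by (simp add: ring_hom_add)
      next
        show "(\<lambda>x\<in>carrier weyl. ?i x) \<one>\<^bsub>weyl\<^esub> = \<one>\<^bsub>weyl\<^esub>"
          using inv_into_f_f[OF inj, of "\<one>\<^bsub>weyl\<^esub>"] ring_hom_one[OF H] by simp
      qed
      moreover have "?i (weyl_const c) = weyl_const c" for c
        using inv_into_f_f[OF inj const, of c] K by simp
      ultimately show ?thesis
        using B const by (simp add: inv_BijGroup weyl_auts_def restrict_inv_into_Bij)
    qed
  qed
  then show ?thesis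
    unfolding weyl_aut_group_def by (rule group.subgroup_imp_group[OF group_BijGroup])
qed

lemma weyl_auts_eqI:
  assumes "\<sigma> \<in> weyl_auts" "\<tau> \<in> weyl_auts" "\<sigma> weyl_x = \<tau> weyl_x" "\<sigma> weyl_y = \<tau> weyl_y"
  shows "\<sigma> = \<tau>"
proof -
  have H: "\<sigma> \<in> Ring.ring_hom weyl weyl" "\<tau> \<in> Ring.ring_hom weyl weyl"
    and E: "\<sigma> \<in> extensional (carrier weyl)" "\<tau> \<in> extensional (carrier weyl)"
    and K: "\<And>c. \<sigma> (weyl_const c) = \<tau> (weyl_const c)"
    using assms by (auto simp: weyl_auts_def Bij_def)
  have word: "\<sigma> (weyl_proj (Poly_Mapping.single (Word gs) 1)) =
      \<tau> (weyl_proj (Poly_Mapping.single (Word gs) 1))" for gs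
  proof (induction gs)
    case Nil
    have "Poly_Mapping.single (Word []) 1 = (1 :: free_alg)"
      by (metis single_one zero_word_def)
    then show ?case using ring_hom_one[OF H(1)] ring_hom_one[OF H(2)] by (simp add: weyl_proj_one)
  next
    case (Cons g gs)
    have *: "(Poly_Mapping.single (Word (g # gs)) 1 :: free_alg) =
        Poly_Mapping.single (Word [g]) 1 * Poly_Mapping.single (Word gs) 1"
      by (simp add: mult_single plus_word_def)
    have "\<sigma> (weyl_proj (Poly_Mapping.single (Word [g]) 1)) =
        \<tau> (weyl_proj (Poly_Mapping.single (Word [g]) 1))"
      using assms(3,4) by (cases g) (auto simp: weyl_x_def weyl_y_def free_x_def free_y_def)
    then show ?case
      unfolding * using Cons
      by (simp add: weyl_proj_mult ring_hom_mult[OF H(1)] ring_hom_mult[OF H(2)])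
  qed
  have "\<sigma> (weyl_proj f) = \<tau> (weyl_proj f)" for f
  proof (induction f rule: free_induct)
    case (single w c)
    show ?case
      unfolding single_conv_free_const[of w c] using word[of "letters w"] K[of c]
      by (simp add: weyl_proj_mult ring_hom_mult[OF H(1)] ring_hom_mult[OF H(2)] weyl_const_def)
  next
    case (add f g)
    then show ?case
      by (simp add: weyl_proj_add ring_hom_add[OF H(1)] ring_hom_add[OF H(2)])
  qed
  then show ?thesis
    using E by (intro extensionalityI) (auto elim: weyl_carrierE)
qed

definition word_subst :: "free_alg \<Rightarrow> free_alg \<Rightarrow> word \<Rightarrow> free_alg" where
  "word_subst a b w = prod_list (map (\<lambda>g. case g of Gen_x \<Rightarrow> a | Gen_y \<Rightarrow> b) (letters w))"

definition free_subst :: "free_alg \<Rightarrow> free_alg \<Rightarrow> free_alg \<Rightarrow> free_alg" where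
  "free_subst a b f =
     (\<Sum>w\<in>Poly_Mapping.keys f. free_const (Poly_Mapping.lookup f w) * word_subst a b w)"

lemma free_subst_add: "free_subst a b (f + g) = free_subst a b f + free_subst a b g"
  unfolding free_subst_def
  by (rule setsum_keys_plus_distrib)
    (auto simp: free_const_def single_add algebra_simps)

lemma free_subst_diff: "free_subst a b (f - g) = free_subst a b f - free_subst a b g"
  using free_subst_add[of a b "f - g" g] by simp

lemma free_subst_single:
  "free_subst a b (Poly_Mapping.single w c) = free_const c * word_subst a b w"
  by (cases "c = 0") (simp_all add: free_subst_def free_const_def)

lemma free_subst_mult: "free_subst a b (f * g) = free_subst a b f * free_subst a b g"
proof (induction f rule: free_induct)
  case (single v c)
  show ?case
  proof (induction g rule: free_induct)
    case (single w d)
    have "free_const (c * d) * (word_subst a b v * word_subst a b w) =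
        free_const c * (free_const d * word_subst a b v) * word_subst a b w"
      by (simp add: free_const_def mult_single flip: mult.assoc)
    also have "\<dots> = free_const c * word_subst a b v * (free_const d * word_subst a b w)"
      using free_const_central[of d "word_subst a b v"] by (simp add: mult.assoc)
    finally show ?case
      by (simp add: mult_single free_subst_single word_subst_def plus_word_def)
  qed (auto simp: distrib_left free_subst_add)
qed (auto simp: distrib_right free_subst_add)

lemma free_subst_const: "free_subst a b (free_const c) = free_const c"
  by (simp add: free_const_def free_subst_single word_subst_def zero_word_def)

lemma free_subst_one: "free_subst a b 1 = 1"
  using free_subst_const[of a b 1] by (simp add: free_const_def)

lemma free_subst_x: "free_subst a b free_x = a" and free_subst_y: "free_subst a b free_y = b"
  by (simp_all add: free_x_def free_y_def free_subst_single word_subst_def free_const_def)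

definition free_poly :: "complex poly \<Rightarrow> free_alg \<Rightarrow> free_alg" where
  "free_poly p a = (\<Sum>k\<le>degree p. free_const (coeff p k) * a ^ k)"

lemma free_subst_free_poly: "free_subst a b (free_poly p f) = free_poly p (free_subst a b f)"
proof -
  have pow: "free_subst a b (f ^ k) = free_subst a b f ^ k" for k
    by (induction k) (simp_all add: free_subst_one free_subst_mult)
  have "free_subst a b (sum F S) = (\<Sum>k\<in>S. free_subst a b (F k))" if "finite S" for F and S :: "nat set"
    using that by induction (simp_all add: free_subst_add free_subst_def[of _ _ 0])
  then show ?thesis
    by (simp add: free_poly_def free_subst_mult free_subst_const pow)
qed

lemma free_poly_commute: "free_poly p a * a = a * free_poly p a"
proof -
  have "free_const c * a ^ k * a = a * (free_const c * a ^ k)" for c k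
  proof -
    have "a * (free_const c * a ^ k) = a * free_const c * a ^ k" by (simp add: mult.assoc)
    also have "a * free_const c = free_const c * a" by (rule free_const_central[symmetric])
    finally show ?thesis by (simp add: mult.assoc power_commutes)
  qed
  then show ?thesis
    by (simp add: free_poly_def sum_distrib_left sum_distrib_right)
qed

lemma free_poly_uminus: "free_poly (- p) a = - free_poly p a"
proof -
  have "free_const (- c) * b = - (free_const c * b)" for c b
    by (simp add: free_const_def single_uminus)
  then show ?thesis by (simp add: free_poly_def sum_negf)
qed

lemma weyl_poly_proj: "weyl_poly p (weyl_proj a) = weyl_proj (free_poly p a)"
proof -
  have pow: "weyl_proj (a ^ k) = weyl_proj a [^]\<^bsub>weyl\<^esub> k" for k
  proof (induction k)
    case (Suc k)
    then show ?case by (simp only: power_Suc2 weyl_proj_mult weyl.nat_pow_Suc)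
  qed (simp add: weyl_proj_one)
  have sum: "weyl_proj (sum F S) = (\<Oplus>\<^bsub>weyl\<^esub>k\<in>S. weyl_proj (F k))"
    if "finite S" for F and S :: "nat set"
    using that by induction (simp_all add: weyl_proj_zero weyl_proj_add)
  show ?thesis
    unfolding weyl_poly_def free_poly_def
    by (simp add: sum weyl_proj_mult pow weyl_const_def)
qed

lemma free_subst_weyl_ideal:
  assumes r: "free_subst a b (free_x * free_y - free_y * free_x - 1) \<in> weyl_ideal"
  assumes f: "f \<in> weyl_ideal"
  shows "free_subst a b f \<in> weyl_ideal"
proof -
  let ?J = "{f. free_subst a b f \<in> weyl_ideal}"
  have zero: "free_subst a b 0 = 0" by (simp add: free_subst_def)
  have "ideal ?J free_ring"
  proof (rule idealI[OF ring_free_ring])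
    show "subgroup ?J (add_monoid free_ring)"
    proof (rule group.subgroupI)
      show "group (add_monoid free_ring)" by (rule free_ring.a_group)
      have "0 \<in> ?J"
        using zero additive_subgroup.zero_closed[OF ideal.axioms(1)[OF ideal_weyl_ideal]] by simp
      then show "?J \<noteq> {}" by blast
      fix f assume f: "f \<in> ?J"
      have "free_subst a b (- f) = - free_subst a b f"
        using free_subst_diff[of a b 0 f] zero by simp
      then show "inv\<^bsub>add_monoid free_ring\<^esub> f \<in> ?J"
        using f additive_subgroup.a_inv_closed[OF ideal.axioms(1)[OF ideal_weyl_ideal]] free_ring_a_inv unfolding a_inv_def by auto
      fix g assume "g \<in> ?J"
      then show "f \<otimes>\<^bsub>add_monoid free_ring\<^esub> g \<in> ?J"
        using f additive_subgroup.a_closed[OF ideal.axioms(1)[OF ideal_weyl_ideal]] by (auto simp: free_subst_add)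
    qed simp
  next
    fix f g assume "f \<in> ?J"
    then show "g \<otimes>\<^bsub>free_ring\<^esub> f \<in> ?J" "f \<otimes>\<^bsub>free_ring\<^esub> g \<in> ?J"
      using ideal.I_l_closed[OF ideal_weyl_ideal] ideal.I_r_closed[OF ideal_weyl_ideal] by (auto simp: free_subst_mult)
  qed
  then have "weyl_ideal \<subseteq> ?J"
    using free_ring.genideal_minimal[of ?J] r by (simp add: weyl_ideal_def)
  then show ?thesis using f by blast
qed

definition weyl_subst :: "free_alg \<Rightarrow> free_alg \<Rightarrow> free_alg set \<Rightarrow> free_alg set" where
  "weyl_subst a b = (\<lambda>C\<in>carrier weyl. weyl_proj (free_subst a b (SOME f. C = weyl_proj f)))"

lemma weyl_subst_proj:
  assumes r: "a * b - b * a = free_x * free_y - free_y * free_x"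
  shows "weyl_subst a b (weyl_proj f) = weyl_proj (free_subst a b f)"
proof -
  define g where "g = (SOME g. weyl_proj f = weyl_proj g)"
  have "weyl_proj f = weyl_proj g" unfolding g_def by (rule someI) (rule refl)
  then have fg: "f - g \<in> weyl_ideal" by (simp add: weyl_proj_eq_iff)
  have "free_subst a b (free_x * free_y - free_y * free_x - 1) \<in> weyl_ideal"
    using free_ring.genideal_self'[of "free_x * free_y - free_y * free_x - 1"] r
    by (simp add: free_subst_diff free_subst_mult free_subst_x free_subst_y free_subst_one
        weyl_ideal_def)
  then have "free_subst a b (f - g) \<in> weyl_ideal"
    by (rule free_subst_weyl_ideal[OF _ fg])
  then have "weyl_proj (free_subst a b f) = weyl_proj (free_subst a b g)"
    by (simp only: weyl_proj_eq_iff free_subst_diff)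
  then show ?thesis
    by (simp add: weyl_subst_def flip: g_def)
qed

lemma free_alg_endo_eqI:
  assumes "\<And>f g. h (f + g) = h f + h g" "\<And>f g. h (f * g) = h f * h g"
    and "\<And>c. h (free_const c) = free_const c" "h free_x = free_x" "h free_y = free_y"
  shows "h f = (f :: free_alg)"
proof (induction f rule: free_induct)
  case (single w c)
  have "h (Poly_Mapping.single (Word gs) 1) = Poly_Mapping.single (Word gs) 1" for gs
  proof (induction gs)
    case Nil
    then show ?case using assms(3)[of 1] by (simp add: free_const_def zero_word_def)
  next
    case (Cons g gs)
    have *: "(Poly_Mapping.single (Word (g # gs)) 1 :: free_alg) =
        Poly_Mapping.single (Word [g]) 1 * Poly_Mapping.single (Word gs) 1"
      by (simp add: mult_single plus_word_def)
    have "h (Poly_Mapping.single (Word [g]) 1) = Poly_Mapping.single (Word [g]) 1"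
      using assms(4,5) by (cases g) (auto simp: free_x_def free_y_def)
    then show ?case unfolding * using Cons assms(2) by simp
  qed
  from this[of "letters w"] show ?case
    unfolding single_conv_free_const[of w c] by (simp add: assms)
qed (simp add: assms)

lemma weyl_subst_aut:
  assumes r: "a * b - b * a = free_x * free_y - free_y * free_x"
    and r': "a' * b' - b' * a' = free_x * free_y - free_y * free_x"
    and inv: "free_subst a b a' = free_x" "free_subst a b b' = free_y"
      "free_subst a' b' a = free_x" "free_subst a' b' b = free_y"
  shows "weyl_subst a b \<in> weyl_auts"
proof -
  note P = weyl_subst_proj[OF r] and P' = weyl_subst_proj[OF r']
  have I: "free_subst a b (free_subst a' b' f) = f" "free_subst a' b' (free_subst a b f) = f" for f
    by (rule free_alg_endo_eqI;
        simp add: free_subst_add free_subst_mult free_subst_const free_subst_x free_subst_y inv)+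
  have "bij_betw (weyl_subst a b) (carrier weyl) (carrier weyl)"
    by (rule bij_betw_byWitness[where f' = "weyl_subst a' b'"])
      (auto elim!: weyl_carrierE simp: P P' I)
  moreover have "weyl_subst a b \<in> extensional (carrier weyl)"
    by (simp add: weyl_subst_def)
  moreover have "weyl_subst a b \<in> Ring.ring_hom weyl weyl"
  proof (rule ring_hom_memI)
    fix C D assume "C \<in> carrier weyl" "D \<in> carrier weyl"
    then obtain f g where [simp]: "C = weyl_proj f" "D = weyl_proj g" by (meson weyl_carrierE)
    show "weyl_subst a b C \<in> carrier weyl" by (simp add: P)
    show "weyl_subst a b (C \<otimes>\<^bsub>weyl\<^esub> D) = weyl_subst a b C \<otimes>\<^bsub>weyl\<^esub> weyl_subst a b D"
      by (simp add: P free_subst_mult flip: weyl_proj_mult)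
    show "weyl_subst a b (C \<oplus>\<^bsub>weyl\<^esub> D) = weyl_subst a b C \<oplus>\<^bsub>weyl\<^esub> weyl_subst a b D"
      by (simp add: P free_subst_add flip: weyl_proj_add)
  next
    show "weyl_subst a b \<one>\<^bsub>weyl\<^esub> = \<one>\<^bsub>weyl\<^esub>"
      by (simp add: P free_subst_one flip: weyl_proj_one)
  qed
  ultimately show ?thesis
    by (simp add: weyl_auts_def Bij_def weyl_const_def P free_subst_const)
qed

lemma weyl_Phi:
  shows "weyl_Phi p \<in> carrier weyl_aut_group"
    and "weyl_Phi p weyl_x = weyl_x \<ominus>\<^bsub>weyl\<^esub> weyl_poly p weyl_y"
    and "weyl_Phi p weyl_y = weyl_y"
proof -
  have r: "(free_x - free_poly p free_y) * free_y - free_y * (free_x - free_poly p free_y) =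
      free_x * free_y - free_y * free_x" for p
    by (simp add: algebra_simps free_poly_commute)
  have "weyl_subst (free_x - free_poly p free_y) free_y \<in> weyl_auts"
    by (rule weyl_subst_aut[OF r r, of p "- p"])
      (simp_all add: free_subst_add free_subst_diff free_subst_x free_subst_y free_subst_free_poly free_poly_uminus)
  moreover have
    "weyl_subst (free_x - free_poly p free_y) free_y weyl_x = weyl_x \<ominus>\<^bsub>weyl\<^esub> weyl_poly p weyl_y"
    "weyl_subst (free_x - free_poly p free_y) free_y weyl_y = weyl_y"
    by (simp_all add: weyl_x_def weyl_y_def weyl_poly_proj weyl_subst_proj[OF r] free_subst_x
        free_subst_y weyl_proj_diff)
  ultimately have "\<exists>!\<sigma>. \<sigma> \<in> weyl_auts \<and>
     \<sigma> weyl_x = weyl_x \<ominus>\<^bsub>weyl\<^esub> weyl_poly p weyl_y \<and> \<sigma> weyl_y = weyl_y"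
    by (metis (no_types, lifting) weyl_auts_eqI)
  from theI'[OF this] have "weyl_Phi p \<in> weyl_auts \<and> weyl_Phi p weyl_x = weyl_x \<ominus>\<^bsub>weyl\<^esub> weyl_poly p weyl_y \<and> weyl_Phi p weyl_y = weyl_y"
    unfolding weyl_Phi_def .
  then show "weyl_Phi p \<in> carrier weyl_aut_group" "weyl_Phi p weyl_x = weyl_x \<ominus>\<^bsub>weyl\<^esub> weyl_poly p weyl_y" "weyl_Phi p weyl_y = weyl_y"
    unfolding weyl_aut_group_def by simp_all
qed

lemma weyl_Psi:
  shows "weyl_Psi q \<in> carrier weyl_aut_group"
    and "weyl_Psi q weyl_x = weyl_x"
    and "weyl_Psi q weyl_y = weyl_y \<ominus>\<^bsub>weyl\<^esub> weyl_poly q weyl_x"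
proof -
  have r: "free_x * (free_y - free_poly q free_x) - (free_y - free_poly q free_x) * free_x =
      free_x * free_y - free_y * free_x" for q
    by (simp add: algebra_simps free_poly_commute)
  have "weyl_subst free_x (free_y - free_poly q free_x) \<in> weyl_auts"
    by (rule weyl_subst_aut[OF r r, of q "- q"])
      (simp_all add: free_subst_add free_subst_diff free_subst_x free_subst_y free_subst_free_poly free_poly_uminus)
  moreover have
    "weyl_subst free_x (free_y - free_poly q free_x) weyl_x = weyl_x"
    "weyl_subst free_x (free_y - free_poly q free_x) weyl_y = weyl_y \<ominus>\<^bsub>weyl\<^esub> weyl_poly q weyl_x"
    by (simp_all add: weyl_x_def weyl_y_def weyl_poly_proj weyl_subst_proj[OF r] free_subst_x
        free_subst_y weyl_proj_diff)
  ultimately have "\<exists>!\<sigma>. \<sigma> \<in> weyl_auts \<and>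
     \<sigma> weyl_x = weyl_x \<and> \<sigma> weyl_y = weyl_y \<ominus>\<^bsub>weyl\<^esub> weyl_poly q weyl_x"
    by (metis (no_types, lifting) weyl_auts_eqI)
  from theI'[OF this] have "weyl_Psi q \<in> weyl_auts \<and> weyl_Psi q weyl_x = weyl_x \<and> weyl_Psi q weyl_y = weyl_y \<ominus>\<^bsub>weyl\<^esub> weyl_poly q weyl_x"
    unfolding weyl_Psi_def .
  then show "weyl_Psi q \<in> carrier weyl_aut_group" "weyl_Psi q weyl_x = weyl_x" "weyl_Psi q weyl_y = weyl_y \<ominus>\<^bsub>weyl\<^esub> weyl_poly q weyl_x"
    unfolding weyl_aut_group_def by simp_all
qed

lemma equiv_CM_conj: "equiv (CM_pairs n) (CM_conj n)"
proof (rule equivI)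
  show "CM_conj n \<subseteq> CM_pairs n \<times> CM_pairs n" by (auto simp: CM_conj_def)
  show "refl_on (CM_pairs n) (CM_conj n)"
  proof (rule refl_onI)
    fix Z assume Z: "Z \<in> CM_pairs n"
    obtain X Y where XY: "Z = (X, Y)" by (cases Z)
    have "similar_mat_wit X X (1\<^sub>m n) (1\<^sub>m n)" "similar_mat_wit Y Y (1\<^sub>m n) (1\<^sub>m n)"
      using Z XY by (auto simp: CM_pairs_def intro!: similar_mat_wit_refl)
    with Z XY show "(Z, Z) \<in> CM_conj n" by (auto simp: CM_conj_def)
  qed
  show "sym (CM_conj n)"
    unfolding CM_conj_def sym_def by clarify (meson similar_mat_wit_sym)
  show "trans (CM_conj n)"
    unfolding CM_conj_def trans_def by clarify (meson similar_mat_wit_trans)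
qed

end

theory Submission
  imports Defs "Jordan_Normal_Form.Schur_Decomposition" "Jordan_Normal_Form.Spectral_Radius"
begin

text \<open>
  Let \<open>f\<close> be equivariant and let \<open>(X', Y')\<close> represent the image of the class of \<open>(X, Y)\<close>.
  The stabiliser of a class is contained in the stabiliser of its image. If \<open>p(X) = 0\<close>, the
  automorphism \<open>\<Psi>\<^sub>p\<close> fixes the class of \<open>(X, Y)\<close>, so \<open>(X', Y' + p(X'))\<close> is conjugate to
  \<open>(X', Y')\<close> and \<open>p(X')\<close> has trace zero. Letting \<open>p\<close> run through the multiples of the
  characteristic polynomial of \<open>X\<close>, this says that every eigenvalue of \<open>X'\<close> is an eigenvalue of
  \<open>X\<close>; in the same way every eigenvalue of \<open>Y'\<close> is one of \<open>Y\<close> (\<open>related_spectrum\<close>). By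
  equivariance this holds at every point of the orbit, and these inclusions already determine \<open>f\<close>.

  Suppose first that \<open>X\<close> and \<open>X'\<close> have simple spectra, so that \<open>m \<le> n\<close>. In a suitable basis
  \<open>X\<close> is diagonal with entries \<open>x\<^sub>i\<close>, and \<open>Y\<close> has off-diagonal entries \<open>1 / (x\<^sub>i - x\<^sub>j)\<close> and free
  diagonal entries \<open>y\<^sub>i\<close> (\<open>normal_form\<close>). The \<open>\<Psi>\<^sub>q\<close> move the \<open>y\<^sub>i\<close> to arbitrary values and
  shift the diagonal of \<open>Y'\<close> along with them. So \<open>Y'\<close> is the analogous matrix for a subset of the
  \<open>x\<^sub>i\<close>, with diagonal \<open>y\<^sub>i + \<delta>\<^sub>i\<close> for a constant vector \<open>\<delta>\<close>, and whenever \<open>Y'\<close> is singular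
  so is \<open>Y\<close>. Sending all but one or two of the \<open>y\<^sub>i\<close> to infinity shows that this is only possible
  for \<open>m = n\<close> and \<open>\<delta> = 0\<close> (\<open>singular_cm_matrices_determine\<close>).

  The general case is reduced to this one by automorphisms that increase the number of distinct
  eigenvalues. If \<open>X\<close> has a multiple eigenvalue, then \<open>X + t Y\<^sup>d\<close> has more distinct eigenvalues
  than \<open>X\<close> for some \<open>d\<close> and all small \<open>t \<noteq> 0\<close> (\<open>shear_splits_eigenvalues\<close>), while the number
  of distinct eigenvalues of \<open>X' + t Y'\<^sup>d\<close> is at least that of \<open>X'\<close>; and likewise with the two
  points exchanged. To see the splitting, write \<open>[X, Y] + 1 = v w\<^sup>T\<close>. To first order in \<open>t\<close> one
  needs \<open>tr (N Y\<^sup>d) \<noteq> 0\<close>, where \<open>N\<close> is the highest nonzero power of the nilpotent part of \<open>X\<close> at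
  the multiple eigenvalue. The commutation relation forces \<open>N\<close> to have rank one
  (\<open>top_nilpotent_part_rank_one\<close>), so \<open>N = u \<xi>\<^sup>T\<close> with right and left eigenvectors \<open>u\<close> and \<open>\<xi>\<close>
  of \<open>X\<close>, and \<open>tr (N Y\<^sup>d) = \<xi>\<^sup>T Y\<^sup>d u\<close>. Evaluating \<open>\<xi>\<^sup>T [X, Y\<^bsup>j+1\<^esup>] u = 0\<close> by the
  relation gives \<open>(j + 1) \<xi>\<^sup>T Y\<^sup>j u = (\<Sum>i\<le>j. (\<xi>\<^sup>T Y\<^sup>i v) (w\<^sup>T Y\<^bsup>j-i\<^esup> u))\<close>. The product of
  the nonzero power series with coefficients \<open>\<xi>\<^sup>T Y\<^sup>i v\<close> and \<open>w\<^sup>T Y\<^sup>i u\<close> is nonzero, so some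
  \<open>\<xi>\<^sup>T Y\<^sup>d u\<close> is nonzero as well (\<open>eigenpair_escape\<close>).
\<close>

section \<open>Polynomials in a matrix\<close>

definition mtrace :: "complex mat \<Rightarrow> complex" where
  "mtrace A = (\<Sum>i<dim_row A. A $$ (i, i))"

lemma mat_poly_carrier [simp]: "mat_poly n p M \<in> carrier_mat n n"
  by (simp add: mat_poly_def)

lemma mat_poly_dim [simp]: "dim_row (mat_poly n p M) = n" "dim_col (mat_poly n p M) = n"
  by (simp_all add: mat_poly_def)

lemma mat_poly_vec_carrier [simp]: "mat_poly n p M *\<^sub>v z \<in> carrier_vec n"
  by (simp add: mult_mat_vec_def)

lemma pow_mat_Suc_left:
  fixes M :: "complex mat"
  assumes "M \<in> carrier_mat n n"
  shows "M ^\<^sub>m Suc k = M * M ^\<^sub>m k"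
proof (induction k)
  case (Suc k)
  have "M ^\<^sub>m Suc (Suc k) = (M * M ^\<^sub>m k) * M" using Suc by simp
  also have "\<dots> = M * (M ^\<^sub>m k * M)"
    by (rule assoc_mult_mat[of _ n n _ n _ n]) (use assms in auto)
  finally show ?case by simp
qed (use assms in auto)

lemma mat_poly_index:
  assumes "degree p \<le> N" "i < n" "j < n"
  shows "mat_poly n p M $$ (i, j) = (\<Sum>k\<le>N. coeff p k * (M ^\<^sub>m k) $$ (i, j))"
proof -
  have "(\<Sum>k\<le>degree p. coeff p k * (M ^\<^sub>m k) $$ (i, j)) = (\<Sum>k\<le>N. coeff p k * (M ^\<^sub>m k) $$ (i, j))"
    by (rule sum.mono_neutral_left) (use assms in \<open>auto simp: coeff_eq_0\<close>)
  then show ?thesis using assms by (simp add: mat_poly_def)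
qed

lemma mat_poly_add: "mat_poly n (p + q) M = mat_poly n p M + mat_poly n q M"
proof (rule eq_matI)
  fix i j assume "i < dim_row (mat_poly n p M + mat_poly n q M)" "j < dim_col (mat_poly n p M + mat_poly n q M)"
  then have ij: "i < n" "j < n" by auto
  define N where "N = max (degree p) (degree q)"
  have N: "degree p \<le> N" "degree q \<le> N" "degree (p + q) \<le> N"
    by (auto simp: N_def degree_add_le)
  show "mat_poly n (p + q) M $$ (i, j) = (mat_poly n p M + mat_poly n q M) $$ (i, j)"
    using ij by (simp add: mat_poly_index[OF N(1) ij] mat_poly_index[OF N(2) ij]
        mat_poly_index[OF N(3) ij] sum.distrib algebra_simps)
qed auto

lemma mat_poly_smult: "mat_poly n (smult c p) M = c \<cdot>\<^sub>m mat_poly n p M"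
proof (rule eq_matI)
  fix i j assume "i < dim_row (c \<cdot>\<^sub>m mat_poly n p M)" "j < dim_col (c \<cdot>\<^sub>m mat_poly n p M)"
  then have ij: "i < n" "j < n" by auto
  have N: "degree p \<le> degree p" "degree (smult c p) \<le> degree p" by auto
  show "mat_poly n (smult c p) M $$ (i, j) = (c \<cdot>\<^sub>m mat_poly n p M) $$ (i, j)"
    using ij by (simp add: mat_poly_index[OF N(1) ij] mat_poly_index[OF N(2) ij]
        sum_distrib_left algebra_simps)
qed auto

lemma mat_poly_0 [simp]: "mat_poly n 0 M = 0\<^sub>m n n"
  by (rule eq_matI) (auto simp: mat_poly_def)

lemma mat_poly_pCons:
  assumes M: "M \<in> carrier_mat n n"
  shows "mat_poly n (pCons a p) M = a \<cdot>\<^sub>m 1\<^sub>m n + M * mat_poly n p M"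
proof (rule eq_matI)
  fix i j assume "i < dim_row (a \<cdot>\<^sub>m 1\<^sub>m n + M * mat_poly n p M)" "j < dim_col (a \<cdot>\<^sub>m 1\<^sub>m n + M * mat_poly n p M)"
  then have ij: "i < n" "j < n" using M by auto
  have N: "degree p \<le> degree p" "degree (pCons a p) \<le> Suc (degree p)"
    by (auto simp: degree_pCons_le)
  have pow: "(M ^\<^sub>m Suc k) $$ (i, j) = (\<Sum>l<n. M $$ (i, l) * (M ^\<^sub>m k) $$ (l, j))" for k
    unfolding pow_mat_Suc_left[OF M] using M ij
    by (auto simp: scalar_prod_def atLeast0LessThan intro!: sum.cong)
  have "mat_poly n (pCons a p) M $$ (i, j) =
      (\<Sum>k\<le>Suc (degree p). coeff (pCons a p) k * (M ^\<^sub>m k) $$ (i, j))"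
    by (rule mat_poly_index[OF N(2) ij])
  also have "\<dots> = a * (M ^\<^sub>m 0) $$ (i, j) + (\<Sum>k\<le>degree p. coeff p k * (M ^\<^sub>m Suc k) $$ (i, j))"
    by (subst sum.atMost_Suc_shift) simp
  also have "(\<Sum>k\<le>degree p. coeff p k * (M ^\<^sub>m Suc k) $$ (i, j)) =
      (\<Sum>l<n. M $$ (i, l) * mat_poly n p M $$ (l, j))"
    unfolding pow sum_distrib_left
    by (subst sum.swap) (use ij in \<open>auto simp: mat_poly_def sum_distrib_left algebra_simps intro!: sum.cong\<close>)
  also have "\<dots> = (M * mat_poly n p M) $$ (i, j)"
    using M ij by (auto simp: scalar_prod_def atLeast0LessThan intro!: sum.cong)
  finally show "mat_poly n (pCons a p) M $$ (i, j) = (a \<cdot>\<^sub>m 1\<^sub>m n + M * mat_poly n p M) $$ (i, j)"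
    using M ij by simp
qed (use M in auto)

lemma mat_poly_mult:
  assumes M: "M \<in> carrier_mat n n"
  shows "mat_poly n (p * q) M = mat_poly n p M * mat_poly n q M"
proof (induction p)
  case 0
  then show ?case by (simp add: left_mult_zero_mat[of _ n n])
next
  case (pCons a p)
  have "mat_poly n (pCons a p * q) M = a \<cdot>\<^sub>m mat_poly n q M + M * (mat_poly n p M * mat_poly n q M)"
    using M pCons.IH
    by (simp add: mult_pCons_left mat_poly_add mat_poly_smult mat_poly_pCons smult_zero_mat
      left_add_zero_mat[of _ n n]) (intro eq_matI; auto)
  also have "M * (mat_poly n p M * mat_poly n q M) = (M * mat_poly n p M) * mat_poly n q M"
    by (rule assoc_mult_mat[symmetric, of _ n n _ n _ n]) (use M in auto)
  also have "a \<cdot>\<^sub>m mat_poly n q M = (a \<cdot>\<^sub>m 1\<^sub>m n) * mat_poly n q M"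
    by (simp add: mult_smult_assoc_mat[of _ n n _ n] left_mult_one_mat[of _ n n])
  finally show ?case
    using M by (simp add: mat_poly_pCons add_mult_distrib_mat[of _ n n _ _ n])
qed

lemma mat_poly_const: "M \<in> carrier_mat n n \<Longrightarrow> mat_poly n [:a:] M = a \<cdot>\<^sub>m 1\<^sub>m n"
  by (subst mat_poly_pCons) (auto simp: right_mult_zero_mat[of _ n n])

lemma mat_poly_1 [simp]: "M \<in> carrier_mat n n \<Longrightarrow> mat_poly n 1 M = 1\<^sub>m n"
  using mat_poly_const[of M n 1] by (simp flip: one_pCons) (intro eq_matI; auto)

lemma mat_poly_X: "M \<in> carrier_mat n n \<Longrightarrow> mat_poly n [:0, 1:] M = M"
  by (subst mat_poly_pCons) (auto simp: mat_poly_const intro!: eq_matI)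

lemma mat_poly_commute:
  assumes "M \<in> carrier_mat n n"
  shows "mat_poly n p M * M = M * mat_poly n p M"
  using mat_poly_mult[OF assms, of p "[:0, 1:]"] mat_poly_mult[OF assms, of "[:0, 1:]" p] mat_poly_X[OF assms]
  by (metis mult.commute)

lemma mat_poly_monom:
  assumes "M \<in> carrier_mat n n"
  shows "mat_poly n (monom c k) M = c \<cdot>\<^sub>m M ^\<^sub>m k"
proof (rule eq_matI)
  fix i j assume "i < dim_row (c \<cdot>\<^sub>m M ^\<^sub>m k)" "j < dim_col (c \<cdot>\<^sub>m M ^\<^sub>m k)"
  then have ij: "i < n" "j < n" using assms by (auto split: if_splits)
  have "mat_poly n (monom c k) M $$ (i, j) = (\<Sum>l\<le>k. (if k = l then c else 0) * (M ^\<^sub>m l) $$ (i, j))"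
    by (subst mat_poly_index[OF degree_monom_le ij]) simp
  also have "\<dots> = (\<Sum>l\<le>k. (if l = k then c * (M ^\<^sub>m l) $$ (i, j) else 0))"
    by (rule sum.cong) auto
  also have "\<dots> = c * (M ^\<^sub>m k) $$ (i, j)" by simp
  finally show "mat_poly n (monom c k) M $$ (i, j) = (c \<cdot>\<^sub>m M ^\<^sub>m k) $$ (i, j)"
    using ij assms by simp
qed (use assms in auto)

lemma mat_poly_mult_vec:
  assumes "M \<in> carrier_mat n n" "z \<in> carrier_vec n"
  shows "mat_poly n (p * q) M *\<^sub>v z = mat_poly n p M *\<^sub>v (mat_poly n q M *\<^sub>v z)"
  unfolding mat_poly_mult[OF assms(1)] by (rule assoc_mult_mat_vec) (use assms in auto)

lemma mtrace_add: "A \<in> carrier_mat n n \<Longrightarrow> B \<in> carrier_mat n n \<Longrightarrow> mtrace (A + B) = mtrace A + mtrace B"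
  by (simp add: mtrace_def sum.distrib)

lemma mtrace_smult: "A \<in> carrier_mat n n \<Longrightarrow> mtrace (c \<cdot>\<^sub>m A) = c * mtrace A"
  by (simp add: mtrace_def sum_distrib_left)

lemma mtrace_mult_comm:
  assumes "A \<in> carrier_mat n n" "B \<in> carrier_mat n n"
  shows "mtrace (A * B) = mtrace (B * A)"
proof -
  have "mtrace (A * B) = (\<Sum>i<n. \<Sum>j<n. A $$ (i, j) * B $$ (j, i))"
    using assms by (auto simp: mtrace_def scalar_prod_def atLeast0LessThan intro!: sum.cong)
  also have "\<dots> = (\<Sum>j<n. \<Sum>i<n. B $$ (j, i) * A $$ (i, j))"
    by (subst sum.swap) (simp add: mult.commute)
  also have "\<dots> = mtrace (B * A)"
    using assms by (auto simp: mtrace_def scalar_prod_def atLeast0LessThan intro!: sum.cong)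
  finally show ?thesis .
qed

lemma similar_mat_wit_mat_poly:
  assumes sim: "similar_mat_wit A B P Q" and A: "A \<in> carrier_mat n n"
  shows "mat_poly n f A = P * mat_poly n f B * Q"
proof -
  note D = similar_mat_witD2[OF A sim]
  have BQ: "Q * A = B * Q"
  proof -
    have "Q * A = Q * (P * (B * Q))" using D by (simp add: assoc_mult_mat[of _ n n _ n _ n])
    also have "\<dots> = (Q * P) * (B * Q)" by (rule assoc_mult_mat[symmetric, of _ n n _ n _ n]) (use D in auto)
    finally show ?thesis using D by simp
  qed
  have 1: "Q * mat_poly n f A = mat_poly n f B * Q"
  proof (induction f)
    case 0 then show ?case using D by (simp add: right_mult_zero_mat[of _ n n] left_mult_zero_mat[of _ n n])
  next
    case (pCons a f)
    have "Q * (a \<cdot>\<^sub>m 1\<^sub>m n + A * mat_poly n f A) = a \<cdot>\<^sub>m Q + Q * (A * mat_poly n f A)"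
      using A D(6,7) by (simp add: mult_add_distrib_mat[of _ n n _ n] mult_smult_distrib[of _ n n _ n])
    also have "Q * (A * mat_poly n f A) = (Q * A) * mat_poly n f A"
      by (rule assoc_mult_mat[symmetric, of _ n n _ n _ n]) (use D in auto)
    also have "\<dots> = B * (Q * mat_poly n f A)"
      unfolding BQ by (rule assoc_mult_mat[of _ n n _ n _ n]) (use D in auto)
    also have "\<dots> = (B * mat_poly n f B) * Q"
      unfolding pCons.IH by (rule assoc_mult_mat[symmetric, of _ n n _ n _ n]) (use D in auto)
    also have "a \<cdot>\<^sub>m Q + (B * mat_poly n f B) * Q = (a \<cdot>\<^sub>m 1\<^sub>m n + B * mat_poly n f B) * Q"
      using D by (simp add: add_mult_distrib_mat[of _ n n _ _ n] mult_smult_assoc_mat[of _ n n _ n])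
    finally show ?case using D by (simp add: mat_poly_pCons)
  qed
  have "mat_poly n f A = (P * Q) * mat_poly n f A" using D by simp
  also have "\<dots> = P * (Q * mat_poly n f A)"
    by (rule assoc_mult_mat[of _ n n _ n _ n]) (use D in auto)
  also have "\<dots> = P * mat_poly n f B * Q"
    unfolding 1 by (rule assoc_mult_mat[symmetric, of _ n n _ n _ n]) (use D in auto)
  finally show ?thesis .
qed

lemma similar_mat_wit_mtrace:
  assumes sim: "similar_mat_wit A B P Q" and A: "A \<in> carrier_mat n n"
  shows "mtrace A = mtrace B"
proof -
  note D = similar_mat_witD2[OF A sim]
  have "mtrace A = mtrace (P * (B * Q))" using D by (simp add: assoc_mult_mat[of _ n n _ n _ n])
  also have "\<dots> = mtrace (B * Q * P)" by (rule mtrace_mult_comm[of _ n]) (use D in auto)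
  also have "B * Q * P = B * (Q * P)" by (rule assoc_mult_mat[of _ n n _ n _ n]) (use D in auto)
  finally show ?thesis using D by simp
qed


section \<open>Eigenvalues with multiplicity\<close>

text \<open>
  The sequence lists the eigenvalues with multiplicity. The last two clauses, the Cayley-Hamilton
  identity and the trace formula, are the form in which multiplicities enter all later arguments.
\<close>

definition eigenvalue_seq :: "nat \<Rightarrow> complex mat \<Rightarrow> (nat \<Rightarrow> complex) \<Rightarrow> bool" where
  "eigenvalue_seq n X \<mu> \<longleftrightarrow> X \<in> carrier_mat n n \<and> spectrum X = \<mu> ` {..<n} \<and>
     mat_poly n (\<Prod>i<n. [:- \<mu> i, 1:]) X = 0\<^sub>m n n \<and>
     (\<forall>f. mtrace (mat_poly n f X) = (\<Sum>i<n. poly f (\<mu> i)))"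

lemma upper_triangular_mat_poly:
  assumes T: "T \<in> carrier_mat n n" "upper_triangular T"
  shows "upper_triangular (mat_poly n f T) \<and> (\<forall>i<n. mat_poly n f T $$ (i, i) = poly f (T $$ (i, i)))"
proof (induction f)
  case 0
  then show ?case by (auto simp: upper_triangular_def)
next
  case (pCons a f)
  have prod: "(T * mat_poly n f T) $$ (i, j) = (\<Sum>l\<in>{i..j}. T $$ (i, l) * mat_poly n f T $$ (l, j))"
    if "i < n" "j < n" for i j
  proof -
    have "(T * mat_poly n f T) $$ (i, j) = (\<Sum>l<n. T $$ (i, l) * mat_poly n f T $$ (l, j))"
      using T(1) that by (auto simp: scalar_prod_def atLeast0LessThan intro!: sum.cong)
    also have "\<dots> = (\<Sum>l\<in>{i..j}. T $$ (i, l) * mat_poly n f T $$ (l, j))"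
    proof (rule sum.mono_neutral_right)
      show "\<forall>l\<in>{..<n} - {i..j}. T $$ (i, l) * mat_poly n f T $$ (l, j) = 0"
        using upper_triangularD[OF T(2)] upper_triangularD[of "mat_poly n f T"] pCons.IH that T(1)
        by (force simp: not_le)
    qed (use that in auto)
    finally show ?thesis .
  qed
  show ?case unfolding mat_poly_pCons[OF T(1)] using pCons.IH T(1)
    by (auto simp: upper_triangular_def prod simp del: index_mult_mat(1))
qed

text \<open>
  Both clauses are read off from an upper triangular form \<open>T\<close> with diagonal \<open>\<mu>\<close>: the diagonal
  of \<open>f(T)\<close> is \<open>f(\<mu>)\<close>, and the factors \<open>T - \<mu>\<^sub>j\<close> shorten, one after the other, the initial
  segment on which a vector is supported.
\<close>

lemma eigenvalue_seq_exists:
  assumes X: "X \<in> carrier_mat n n"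
  obtains \<mu> where "eigenvalue_seq n X \<mu>"
proof -
  obtain es where es: "char_poly X = (\<Prod>e\<leftarrow>es. [:- e, 1:])" "length es = n"
    using char_poly_factorized[OF X] by auto
  obtain T P Q where "schur_decomposition X es = (T, P, Q)"
    by (cases "schur_decomposition X es") auto
  from schur_decomposition[OF X es(1) this]
  have sim: "similar_mat_wit X T P Q" and up: "upper_triangular T" and dg: "diag_mat T = es" by auto
  note D = similar_mat_witD2[OF X sim]
  have T: "T \<in> carrier_mat n n" using D by auto
  define \<mu> where "\<mu> i = es ! i" for i
  have diag: "T $$ (i, i) = \<mu> i" if "i < n" for i
    using that T arg_cong[OF dg, of "\<lambda>l. l ! i"] by (simp add: diag_mat_def \<mu>_def)
  have cp: "char_poly X = (\<Prod>i<n. [:- \<mu> i, 1:])"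
    unfolding es \<mu>_def using es(2)
    by (simp add: prod.list_conv_set_nth atLeast0LessThan)
  have "spectrum X = \<mu> ` {..<n}"
    unfolding spectrum_root_char_poly[OF X] cp by (auto simp: poly_prod)
  moreover have "mat_poly n (\<Prod>i<n. [:- \<mu> i, 1:]) X = 0\<^sub>m n n"
  proof -
    have kill: "mat_poly n (\<Prod>i<j. [:- \<mu> i, 1:]) T *\<^sub>v z = 0\<^sub>v n"
      if "j \<le> n" "z \<in> carrier_vec n" "\<forall>i<n. j \<le> i \<longrightarrow> z $ i = 0" for j z
      using that
    proof (induction j arbitrary: z)
      case 0
      then have "z = 0\<^sub>v n" by (intro eq_vecI) auto
      then show ?case by (simp add: mult_mat_vec_def) (intro eq_vecI; auto simp: scalar_prod_def)
    next
      case (Suc j)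
      let ?z = "mat_poly n [:- \<mu> j, 1:] T *\<^sub>v z"
      have "mat_poly n (\<Prod>i<Suc j. [:- \<mu> i, 1:]) T *\<^sub>v z = mat_poly n (\<Prod>i<j. [:- \<mu> i, 1:]) T *\<^sub>v ?z"
        using T Suc.prems by (simp only: prod.lessThan_Suc mat_poly_mult_vec)
      also have "\<dots> = 0\<^sub>v n"
      proof (rule Suc.IH)
        note ut = upper_triangular_mat_poly[OF T up, of "[:- \<mu> j, 1:]"]
        show "\<forall>i<n. j \<le> i \<longrightarrow> ?z $ i = 0"
        proof (intro allI impI)
          fix i assume i: "i < n" "j \<le> i"
          have "?z $ i = (\<Sum>l<n. mat_poly n [:- \<mu> j, 1:] T $$ (i, l) * z $ l)"
            using i Suc.prems by (auto simp: scalar_prod_def atLeast0LessThan intro!: sum.cong)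
          also have "\<dots> = 0"
          proof (rule sum.neutral, intro ballI)
            fix l assume l: "l \<in> {..<n}"
            consider "l < i" | "l = i" "i = j" | "Suc j \<le> l" using i by linarith
            then show "mat_poly n [:- \<mu> j, 1:] T $$ (i, l) * z $ l = 0"
              using ut i l Suc.prems diag[of i]
              by cases (auto simp: upper_triangular_def)
          qed
          finally show "?z $ i = 0" .
        qed
      qed (use Suc.prems in auto)
      finally show ?case .
    qed
    have "mat_poly n (\<Prod>i<n. [:- \<mu> i, 1:]) T = 0\<^sub>m n n"
    proof (rule eq_matI)
      fix i j assume ij: "i < dim_row (0\<^sub>m n n :: complex mat)" "j < dim_col (0\<^sub>m n n :: complex mat)"
      have "mat_poly n (\<Prod>i<n. [:- \<mu> i, 1:]) T *\<^sub>v unit_vec n j = 0\<^sub>v n"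
        using ij by (intro kill) auto
      then have "(mat_poly n (\<Prod>i<n. [:- \<mu> i, 1:]) T *\<^sub>v unit_vec n j) $ i = 0" using ij by simp
      then show "mat_poly n (\<Prod>i<n. [:- \<mu> i, 1:]) T $$ (i, j) = 0\<^sub>m n n $$ (i, j)" using ij by simp
    qed auto
    then show ?thesis
      unfolding similar_mat_wit_mat_poly[OF sim X] using D
      by (simp add: right_mult_zero_mat[of _ n n] left_mult_zero_mat[of _ n n])
  qed
  moreover have "mtrace (mat_poly n f X) = (\<Sum>i<n. poly f (\<mu> i))" for f
  proof -
    have "similar_mat_wit (mat_poly n f X) (mat_poly n f T) P Q"
      using D similar_mat_wit_mat_poly[OF sim X, of f] by (intro similar_mat_witI[of _ _ n]) auto
    then have "mtrace (mat_poly n f X) = mtrace (mat_poly n f T)"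
      by (rule similar_mat_wit_mtrace[of _ _ _ _ n]) simp
    then show ?thesis
      using upper_triangular_mat_poly[OF T up, of f] diag by (simp add: mtrace_def)
  qed
  ultimately show ?thesis using that[of \<mu>] X by (auto simp: eigenvalue_seq_def)
qed

section \<open>Vectors, pairings and rank one matrices\<close>

lemma mult_mat_vec_closed:
  "A \<in> carrier_mat n n \<Longrightarrow> A *\<^sub>v z \<in> carrier_vec n"
  by (simp add: mult_mat_vec_def carrier_vecI)

lemma smult_one_mult_vec:
  fixes z :: "complex vec"
  shows "z \<in> carrier_vec n \<Longrightarrow> (a \<cdot>\<^sub>m 1\<^sub>m n) *\<^sub>v z = a \<cdot>\<^sub>v z"
  by (intro eq_vecI) auto

lemma zero_mat_mult_vec:
  fixes z :: "complex vec"
  shows "z \<in> carrier_vec n \<Longrightarrow> 0\<^sub>m n n *\<^sub>v z = 0\<^sub>v n"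
  by (intro eq_vecI) auto

lemma mult_mat_zero_vec: "A \<in> carrier_mat n n \<Longrightarrow> A *\<^sub>v 0\<^sub>v n = (0\<^sub>v n :: complex vec)"
  by (intro eq_vecI) auto

lemma vec_eq_by_pairing:
  fixes a b :: "complex vec"
  assumes "a \<in> carrier_vec n" "b \<in> carrier_vec n" "\<And>y. y \<in> carrier_vec n \<Longrightarrow> y \<bullet> a = y \<bullet> b"
  shows "a = b"
proof (rule eq_vecI)
  fix i assume "i < dim_vec b"
  then have "i < n" using assms(2) by simp
  then show "a $ i = b $ i" using assms(3)[of "unit_vec n i"] assms(1,2) by simp
qed (use assms in auto)

lemma pairing_transpose:
  fixes A :: "complex mat"
  assumes "A \<in> carrier_mat n n" "z \<in> carrier_vec n" "y \<in> carrier_vec n"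
  shows "(transpose_mat A *\<^sub>v y) \<bullet> z = y \<bullet> (A *\<^sub>v z)"
  by (rule transpose_vec_mult_scalar) (use assms in auto)

lemma linear_factor_mult_vec:
  assumes X: "X \<in> carrier_mat n n" and z: "z \<in> carrier_vec n"
  shows "mat_poly n [:- c, 1:] X *\<^sub>v z = X *\<^sub>v z - c \<cdot>\<^sub>v z"
proof (rule vec_eq_by_pairing[of _ n])
  fix y :: "complex vec" assume "y \<in> carrier_vec n"
  have "mat_poly n [:- c, 1:] X = (- c) \<cdot>\<^sub>m 1\<^sub>m n + X"
    using X by (simp add: mat_poly_pCons right_mult_zero_mat[of _ n n]) (intro eq_matI; auto)
  then show "y \<bullet> (mat_poly n [:- c, 1:] X *\<^sub>v z) = y \<bullet> (X *\<^sub>v z - c \<cdot>\<^sub>v z)"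
    using assms \<open>y \<in> _\<close>
    by (simp add: add_mult_distrib_mat_vec[of _ n n] scalar_prod_add_distrib[of _ n] smult_one_mult_vec
        scalar_prod_minus_distrib[of _ n])
qed (use assms in \<open>auto intro!: minus_carrier_vec mult_mat_vec_closed\<close>)

lemma mtrace_rank_one:
  assumes A: "A \<in> carrier_mat n n" and u: "u \<in> carrier_vec n" and w: "w \<in> carrier_vec n"
    and act: "\<And>z. z \<in> carrier_vec n \<Longrightarrow> A *\<^sub>v z = (w \<bullet> z) \<cdot>\<^sub>v u"
  shows "mtrace A = w \<bullet> u"
proof -
  have "A $$ (i, i) = w $ i * u $ i" if i: "i < n" for i
  proof -
    have "A $$ (i, i) = (A *\<^sub>v unit_vec n i) $ i" using A i by simp
    also have "\<dots> = w $ i * u $ i" using act[of "unit_vec n i"] w u i by simp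
    finally show ?thesis .
  qed
  then show ?thesis using A u by (auto simp: mtrace_def scalar_prod_def atLeast0LessThan)
qed

text \<open>
  Every column is a multiple of the single column in a maximal linearly independent set of columns.
\<close>

lemma rank_one_factorisation:
  assumes A: "(A :: complex mat) \<in> carrier_mat n n" and rk: "vec_space.rank n A = 1"
  obtains v w where "v \<in> carrier_vec n" "w \<in> carrier_vec n"
    "\<And>z. z \<in> carrier_vec n \<Longrightarrow> A *\<^sub>v z = (w \<bullet> z) \<cdot>\<^sub>v v"
proof -
  interpret vec_space "TYPE(complex)" n .
  have cols: "set (cols A) \<subseteq> carrier_vec n" using cols_dim A by blast
  obtain S where S: "maximal S (\<lambda>T. T \<subseteq> set (cols A) \<and> lin_indpt T)"
    using maximal_exists_superset[of "set (cols A)" "\<lambda>T. T \<subseteq> set (cols A) \<and> lin_indpt T" "{}"]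
    by (auto simp: lin_dep_def)
  have "card S = 1" using rank_card_indpt[OF A S] rk by simp
  then obtain b where b: "S = {b}" by (rule card_1_singletonE)
  have bc: "b \<in> set (cols A)" and ind: "lin_indpt {b}" using S b by (auto simp: maximal_def)
  have bv: "b \<in> carrier_vec n" using bc cols by auto
  have "\<exists>a. c = a \<cdot>\<^sub>v b" if c: "c \<in> set (cols A)" for c
  proof (cases "c = b")
    case True then show ?thesis using bv by (intro exI[of _ 1]) auto
  next
    case False
    have dep: "lin_dep ({b} \<union> {c})"
    proof (rule ccontr)
      assume "lin_indpt ({b} \<union> {c})"
      moreover have "\<forall>B. {b} \<subseteq> B \<and> (B \<subseteq> set (cols A) \<and> lin_indpt B) \<longrightarrow> B = {b}"
        using S unfolding maximal_def b by (rule conjunct2)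
      ultimately have "{b} \<union> {c} = {b}" using c bc by (auto dest: spec[of _ "{b} \<union> {c}"])
      then show False using False by auto
    qed
    have "c \<in> span {b}"
      using lin_dep_iff_in_span[of "{b}" c] bv ind c cols False dep by auto
    then obtain f where "c = lincomb f {b}"
      using finite_span[of "{b}"] bv by auto
    then have "c = f b \<cdot>\<^sub>v b" using bv by (simp add: lincomb_def)
    then show ?thesis by blast
  qed
  then have "\<forall>j<n. \<exists>a. col A j = a \<cdot>\<^sub>v b" using A by (auto simp: cols_def)
  then obtain a where a: "\<And>j. j < n \<Longrightarrow> col A j = a j \<cdot>\<^sub>v b" by metis
  have ent: "A $$ (i, j) = a j * b $ i" if "i < n" "j < n" for i j
    using arg_cong[OF a[OF that(2)], of "\<lambda>c. c $ i"] A bv that by simp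
  show ?thesis
  proof (rule that[of b "vec n a"])
    fix z :: "complex vec" assume z: "z \<in> carrier_vec n"
    show "A *\<^sub>v z = (vec n a \<bullet> z) \<cdot>\<^sub>v b"
    proof (rule eq_vecI)
      fix i assume "i < dim_vec ((vec n a \<bullet> z) \<cdot>\<^sub>v b)"
      then have i: "i < n" using bv by simp
      have "(A *\<^sub>v z) $ i = (\<Sum>j<n. A $$ (i, j) * z $ j)"
        using A z i by (auto simp: scalar_prod_def atLeast0LessThan)
      also have "\<dots> = (\<Sum>j<n. a j * z $ j) * b $ i"
        using i by (simp add: ent sum_distrib_left sum_distrib_right algebra_simps)
      finally show "(A *\<^sub>v z) $ i = ((vec n a \<bullet> z) \<cdot>\<^sub>v b) $ i"
        using i bv z by (simp add: scalar_prod_def atLeast0LessThan)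
    qed (use A bv in auto)
  qed (use bv in auto)
qed


section \<open>Consequences of the Calogero-Moser relation\<close>

text \<open>
  The relation \<open>[X, Y] = v w\<^sup>T - 1\<close>, tested against all vectors \<open>y\<close>. In this scalar form it can
  be summed and telescoped with ordinary arithmetic of complex numbers.
\<close>

locale calogero_moser =
  fixes n :: nat and X Y :: "complex mat" and v w :: "complex vec"
  assumes X: "X \<in> carrier_mat n n" and Y: "Y \<in> carrier_mat n n"
    and v: "v \<in> carrier_vec n" and w: "w \<in> carrier_vec n"
    and relation: "\<And>y z. y \<in> carrier_vec n \<Longrightarrow> z \<in> carrier_vec n \<Longrightarrow>
      y \<bullet> (X *\<^sub>v (Y *\<^sub>v z)) = y \<bullet> (Y *\<^sub>v (X *\<^sub>v z)) - y \<bullet> z + (w \<bullet> z) * (y \<bullet> v)"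
begin

lemma Y_pow_closed [simp]: "Y ^\<^sub>m j *\<^sub>v z \<in> carrier_vec n"
  using Y by (simp add: mult_mat_vec_closed)

lemma X_closed [simp]: "X *\<^sub>v z \<in> carrier_vec n" and Y_closed [simp]: "Y *\<^sub>v z \<in> carrier_vec n"
  using X Y by (simp_all add: mult_mat_vec_closed)

lemma Y_pow_Suc:
  assumes "z \<in> carrier_vec n"
  shows "Y ^\<^sub>m Suc j *\<^sub>v z = Y *\<^sub>v (Y ^\<^sub>m j *\<^sub>v z)" "Y ^\<^sub>m Suc j *\<^sub>v z = Y ^\<^sub>m j *\<^sub>v (Y *\<^sub>v z)"
proof -
  show "Y ^\<^sub>m Suc j *\<^sub>v z = Y *\<^sub>v (Y ^\<^sub>m j *\<^sub>v z)"
    unfolding pow_mat_Suc_left[OF Y] by (rule assoc_mult_mat_vec) (use Y assms in auto)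
  show "Y ^\<^sub>m Suc j *\<^sub>v z = Y ^\<^sub>m j *\<^sub>v (Y *\<^sub>v z)"
    unfolding pow_mat.simps by (rule assoc_mult_mat_vec) (use Y assms in auto)
qed

lemma relation_under:
  assumes A: "A \<in> carrier_mat n n" and y: "y \<in> carrier_vec n" and z: "z \<in> carrier_vec n"
  shows "y \<bullet> (A *\<^sub>v (X *\<^sub>v (Y *\<^sub>v z))) =
    y \<bullet> (A *\<^sub>v (Y *\<^sub>v (X *\<^sub>v z))) - y \<bullet> (A *\<^sub>v z) + (w \<bullet> z) * (y \<bullet> (A *\<^sub>v v))"
proof -
  have "transpose_mat A *\<^sub>v y \<in> carrier_vec n" using A by (simp add: mult_mat_vec_closed)
  from relation[OF this z] show ?thesis
    using A y z v by (simp add: pairing_transpose)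
qed

lemma relation_under_shifted:
  fixes c :: complex
  defines "l \<equiv> [:- c, 1:]"
  assumes A: "A \<in> carrier_mat n n" and y: "y \<in> carrier_vec n" and z: "z \<in> carrier_vec n"
  shows "y \<bullet> (A *\<^sub>v (mat_poly n l X *\<^sub>v (Y *\<^sub>v z))) =
    y \<bullet> (A *\<^sub>v (Y *\<^sub>v (mat_poly n l X *\<^sub>v z))) - y \<bullet> (A *\<^sub>v z) + (w \<bullet> z) * (y \<bullet> (A *\<^sub>v v))"
proof -
  note l = linear_factor_mult_vec[OF X, of _ c, folded l_def]
  show ?thesis
    using relation_under[OF A y z] A Y y z mult_mat_vec_closed[OF A]
    by (simp add: l mult_minus_distrib_mat_vec[of _ n n] scalar_prod_minus_distrib[of _ n]
        mult_mat_vec[of _ n n])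
qed

text \<open>
  If \<open>w\<close> vanished on all \<open>Y\<^sup>j u\<close>, then on the span of these vectors \<open>X\<close> would act as
  \<open>c - d/dY\<close>, that is, \<open>X g(Y) u = c g(Y) u - g'(Y) u\<close>. For \<open>g\<close> of least degree with
  \<open>g(Y) u = 0\<close> this gives \<open>g'(Y) u = 0\<close>, hence \<open>g' = 0\<close> and \<open>u = 0\<close>.
\<close>

lemma functional_escapes_kernel:
  assumes u: "u \<in> carrier_vec n" "u \<noteq> 0\<^sub>v n" and eig: "X *\<^sub>v u = c \<cdot>\<^sub>v u"
  shows "\<exists>j. w \<bullet> (Y ^\<^sub>m j *\<^sub>v u) \<noteq> 0"
proof (rule ccontr)
  assume "\<not> ?thesis"
  then have zero: "w \<bullet> (Y ^\<^sub>m j *\<^sub>v u) = 0" for j by blast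
  have pc: "mat_poly n (pCons a g) Y *\<^sub>v u = a \<cdot>\<^sub>v u + Y *\<^sub>v (mat_poly n g Y *\<^sub>v u)" for a g
    using Y u by (simp add: mat_poly_pCons add_mult_distrib_mat_vec[of _ n n] smult_one_mult_vec
      assoc_mult_mat_vec[of _ n n _ n])
  have zero_poly: "w \<bullet> (Y ^\<^sub>m j *\<^sub>v (mat_poly n g Y *\<^sub>v u)) = 0" for j g
  proof (induction g arbitrary: j)
    case 0 then show ?case using Y w u(1) by (simp add: mult_mat_vec_def[of "0\<^sub>m n n"]) (simp add: scalar_prod_def)
  next
    case (pCons a g)
    have "w \<bullet> (Y ^\<^sub>m j *\<^sub>v (mat_poly n (pCons a g) Y *\<^sub>v u)) =
      a * (w \<bullet> (Y ^\<^sub>m j *\<^sub>v u)) + w \<bullet> (Y ^\<^sub>m Suc j *\<^sub>v (mat_poly n g Y *\<^sub>v u))"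
      unfolding pc Y_pow_Suc(2)[OF mat_poly_vec_carrier] using Y w u
      by (simp add: mult_add_distrib_mat_vec[of _ n n] scalar_prod_add_distrib[of _ n] mult_mat_vec[of _ n n])
    then show ?case using zero[of j] pCons.IH[of "Suc j"] by (simp del: pow_mat.simps)
  qed
  have der: "y \<bullet> (X *\<^sub>v (mat_poly n g Y *\<^sub>v u)) =
      c * (y \<bullet> (mat_poly n g Y *\<^sub>v u)) - y \<bullet> (mat_poly n (pderiv g) Y *\<^sub>v u)"
    if "y \<in> carrier_vec n" for y g
    using that
  proof (induction g arbitrary: y)
    case 0 then show ?case using X u(1) by (simp add: zero_mat_mult_vec mult_mat_zero_vec[of _ n])
  next
    case (pCons a g)
    let ?g = "mat_poly n g Y *\<^sub>v u" and ?d = "mat_poly n (pderiv g) Y *\<^sub>v u"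
    have yt: "transpose_mat Y *\<^sub>v y \<in> carrier_vec n" using Y by (simp add: mult_mat_vec_closed)
    have "y \<bullet> (X *\<^sub>v (mat_poly n (pCons a g) Y *\<^sub>v u)) = a * (c * (y \<bullet> u)) + y \<bullet> (X *\<^sub>v (Y *\<^sub>v ?g))"
      unfolding pc using X Y u pCons.prems eig
      by (simp add: mult_add_distrib_mat_vec[of _ n n] scalar_prod_add_distrib[of _ n] mult_mat_vec[of _ n n])
    also have "y \<bullet> (X *\<^sub>v (Y *\<^sub>v ?g)) = y \<bullet> (Y *\<^sub>v (X *\<^sub>v ?g)) - y \<bullet> ?g"
      using relation[OF pCons.prems, of ?g] zero_poly[of 0 g] Y by simp
    also have "y \<bullet> (Y *\<^sub>v (X *\<^sub>v ?g)) = c * (y \<bullet> (Y *\<^sub>v ?g)) - y \<bullet> (Y *\<^sub>v ?d)"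
      using pCons.IH[OF yt] Y pCons.prems by (simp add: pairing_transpose)
    also have "a * (c * (y \<bullet> u)) + (c * (y \<bullet> (Y *\<^sub>v ?g)) - y \<bullet> (Y *\<^sub>v ?d) - y \<bullet> ?g) =
      c * (y \<bullet> (mat_poly n (pCons a g) Y *\<^sub>v u)) - y \<bullet> (mat_poly n (pderiv (pCons a g)) Y *\<^sub>v u)"
      using pc[of 0 "pderiv g"] pCons.prems u Y
      by (simp add: pc pderiv_pCons mat_poly_add add_mult_distrib_mat_vec[of _ n n]
          scalar_prod_add_distrib[of _ n] algebra_simps)
    finally show ?case .
  qed
  define S where "S g \<longleftrightarrow> g \<noteq> 0 \<and> mat_poly n g Y *\<^sub>v u = 0\<^sub>v n" for g
  obtain \<mu> where "eigenvalue_seq n Y \<mu>" using eigenvalue_seq_exists[OF Y] .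
  then have "S (\<Prod>i<n. [:- \<mu> i, 1:])"
    using u by (auto simp: S_def eigenvalue_seq_def)
  then obtain g where g: "S g" and least: "\<And>h. S h \<Longrightarrow> degree g \<le> degree h"
    using ex_has_least_nat[of S _ degree] by blast
  have "mat_poly n (pderiv g) Y *\<^sub>v u = 0\<^sub>v n"
  proof (rule vec_eq_by_pairing[of _ n])
    fix y :: "complex vec" assume "y \<in> carrier_vec n"
    moreover have "X *\<^sub>v 0\<^sub>v n = 0\<^sub>v n" using X by (intro eq_vecI) auto
    ultimately show "y \<bullet> (mat_poly n (pderiv g) Y *\<^sub>v u) = y \<bullet> 0\<^sub>v n"
      using der[of y g] g by (simp add: S_def)
  qed auto
  then have "pderiv g = 0" using least[of "pderiv g"] degree_pderiv[of g]
    by (cases "degree g = 0") (auto simp: S_def pderiv_eq_0_iff)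
  then obtain b where "g = [:b:]" using degree_eq_zeroE by (metis pderiv_eq_0_iff)
  then have "b \<noteq> 0" "b \<cdot>\<^sub>v u = 0\<^sub>v n"
    using g Y u by (auto simp: S_def mat_poly_const smult_one_mult_vec)
  have "u = 0\<^sub>v n"
  proof (rule eq_vecI)
    fix i assume "i < dim_vec (0\<^sub>v n :: complex vec)"
    then show "u $ i = 0\<^sub>v n $ i"
      using arg_cong[OF \<open>b \<cdot>\<^sub>v u = 0\<^sub>v n\<close>, of "\<lambda>x. x $ i"] u \<open>b \<noteq> 0\<close> by simp
  qed (use u in auto)
  then show False using u by simp
qed

text \<open>
  Transposition reverses products; the sign of \<open>X\<close> compensates for this.
\<close>

lemma dual: "calogero_moser n (- transpose_mat X) (transpose_mat Y) w v"
proof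
  fix y z :: "complex vec" assume y: "y \<in> carrier_vec n" and z: "z \<in> carrier_vec n"
  have T: "(transpose_mat A *\<^sub>v z) \<bullet> y = z \<bullet> (A *\<^sub>v y)" "y \<bullet> (transpose_mat A *\<^sub>v z) = z \<bullet> (A *\<^sub>v y)"
    if "A \<in> carrier_mat n n" "y \<in> carrier_vec n" "z \<in> carrier_vec n" for A and y z :: "complex vec"
  proof -
    show *: "(transpose_mat A *\<^sub>v z) \<bullet> y = z \<bullet> (A *\<^sub>v y)" by (rule pairing_transpose) (use that in auto)
    show "y \<bullet> (transpose_mat A *\<^sub>v z) = z \<bullet> (A *\<^sub>v y)"
      unfolding *[symmetric] by (rule comm_scalar_prod[of _ n]) (use that in \<open>auto simp: mult_mat_vec_closed\<close>)
  qed
  have c: "transpose_mat X *\<^sub>v z \<in> carrier_vec n" "transpose_mat Y *\<^sub>v z \<in> carrier_vec n" for z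
    using X Y by (auto simp: mult_mat_vec_closed)
  have m: "(- transpose_mat X) *\<^sub>v z = - (transpose_mat X *\<^sub>v z)" if "z \<in> carrier_vec n" for z
    using X that by (simp add: uminus_mult_mat_vec)
  have m2: "transpose_mat Y *\<^sub>v (- z) = - (transpose_mat Y *\<^sub>v z)" if "z \<in> carrier_vec n" for z :: "complex vec"
    using Y that by (intro eq_vecI) (auto simp: scalar_prod_uminus_right)
  have 1: "y \<bullet> (transpose_mat X *\<^sub>v (transpose_mat Y *\<^sub>v z)) = z \<bullet> (Y *\<^sub>v (X *\<^sub>v y))"
    using T[OF X y c(2)] T[OF Y X_closed z] c by simp
  have 2: "y \<bullet> (transpose_mat Y *\<^sub>v (transpose_mat X *\<^sub>v z)) = z \<bullet> (X *\<^sub>v (Y *\<^sub>v y))"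
    using T[OF Y y c(1)] T[OF X Y_closed z] c by simp
  have neg: "a \<bullet> (- b) = - (a \<bullet> b)" if "a \<in> carrier_vec n" "b \<in> carrier_vec n" for a b :: "complex vec"
    using that by (intro scalar_prod_uminus_right) auto
  show "y \<bullet> (- transpose_mat X *\<^sub>v (transpose_mat Y *\<^sub>v z)) =
    y \<bullet> (transpose_mat Y *\<^sub>v (- transpose_mat X *\<^sub>v z)) - y \<bullet> z + (v \<bullet> z) * (y \<bullet> w)"
    using relation[OF z y] 1 2 c y z v w comm_scalar_prod[OF y z] comm_scalar_prod[OF v z] comm_scalar_prod[OF w y]
    by (simp add: m m2 neg)
qed (use X Y v w in auto)

end

context calogero_moser
begin

lemma covector_escapes_cokernel:
  assumes \<xi>: "\<xi> \<in> carrier_vec n" "\<xi> \<noteq> 0\<^sub>v n" and eig: "transpose_mat X *\<^sub>v \<xi> = c \<cdot>\<^sub>v \<xi>"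
  shows "\<exists>j. \<xi> \<bullet> (Y ^\<^sub>m j *\<^sub>v v) \<noteq> 0"
proof -
  interpret dual: calogero_moser n "- transpose_mat X" "transpose_mat Y" w v by (rule dual)
  have "- transpose_mat X *\<^sub>v \<xi> = - (transpose_mat X *\<^sub>v \<xi>)"
    using X \<xi> by (simp add: uminus_mult_mat_vec)
  then have "- transpose_mat X *\<^sub>v \<xi> = (- c) \<cdot>\<^sub>v \<xi>" using eig \<xi> by simp (intro eq_vecI; auto)
  then obtain j where j: "v \<bullet> (transpose_mat Y ^\<^sub>m j *\<^sub>v \<xi>) \<noteq> 0"
    using dual.functional_escapes_kernel[OF \<xi>] by blast
  have "v \<bullet> (transpose_mat Y ^\<^sub>m j *\<^sub>v \<xi>) = \<xi> \<bullet> (Y ^\<^sub>m j *\<^sub>v v)"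
    using \<xi>(1)
  proof (induction j arbitrary: \<xi>)
    case 0
    then show ?case using Y v comm_scalar_prod[of v n \<xi>] by simp
  next
    case (Suc j)
    have c: "transpose_mat Y *\<^sub>v \<xi> \<in> carrier_vec n" by simp
    have "v \<bullet> (transpose_mat Y ^\<^sub>m Suc j *\<^sub>v \<xi>) = (transpose_mat Y *\<^sub>v \<xi>) \<bullet> (Y ^\<^sub>m j *\<^sub>v v)"
      unfolding dual.Y_pow_Suc(2)[OF Suc.prems] by (rule Suc.IH[OF c])
    also have "\<dots> = \<xi> \<bullet> (Y *\<^sub>v (Y ^\<^sub>m j *\<^sub>v v))"
      by (rule pairing_transpose) (use Y Suc.prems in auto)
    finally show ?case unfolding Y_pow_Suc(1)[OF v] .
  qed
  then show ?thesis using j by auto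
qed

text \<open>
  Telescoping \<open>\<xi>\<^sup>T Y\<^sup>i X Y\<^bsup>j+1-i\<^esup> u\<close> over \<open>i\<close> computes \<open>0 = \<xi>\<^sup>T [X, Y\<^bsup>j+1\<^esup>] u\<close>. For
  \<open>j = a + b\<close>, where \<open>a\<close> and \<open>b\<close> are least with \<open>\<xi>\<^sup>T Y\<^sup>a v \<noteq> 0\<close> and \<open>w\<^sup>T Y\<^sup>b u \<noteq> 0\<close>, exactly
  one rank one term survives, and it is nonzero.
\<close>

lemma eigenpair_escape:
  assumes u: "u \<in> carrier_vec n" "u \<noteq> 0\<^sub>v n" "X *\<^sub>v u = c \<cdot>\<^sub>v u"
    and \<xi>: "\<xi> \<in> carrier_vec n" "\<xi> \<noteq> 0\<^sub>v n" "transpose_mat X *\<^sub>v \<xi> = c \<cdot>\<^sub>v \<xi>"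
  shows "\<exists>d. \<xi> \<bullet> (Y ^\<^sub>m d *\<^sub>v u) \<noteq> 0"
proof -
  define P where "P i \<longleftrightarrow> \<xi> \<bullet> (Y ^\<^sub>m i *\<^sub>v v) \<noteq> 0" for i
  define Q where "Q i \<longleftrightarrow> w \<bullet> (Y ^\<^sub>m i *\<^sub>v u) \<noteq> 0" for i
  define a where "a = (LEAST i. P i)"
  define b where "b = (LEAST i. Q i)"
  have a: "P a" "\<And>i. i < a \<Longrightarrow> \<not> P i"
    unfolding a_def using covector_escapes_cokernel[OF \<xi>] LeastI_ex[of P] not_less_Least[of _ P]
    unfolding P_def by blast+
  have b: "Q b" "\<And>i. i < b \<Longrightarrow> \<not> Q i"
    unfolding b_def using functional_escapes_kernel[OF u] LeastI_ex[of Q] not_less_Least[of _ Q]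
    unfolding Q_def by blast+
  define e where "e i = \<xi> \<bullet> (Y ^\<^sub>m i *\<^sub>v (X *\<^sub>v (Y ^\<^sub>m (a + b + 1 - i) *\<^sub>v u)))" for i
  have pow_add: "Y ^\<^sub>m i *\<^sub>v (Y ^\<^sub>m j *\<^sub>v z) = Y ^\<^sub>m (i + j) *\<^sub>v z" if "z \<in> carrier_vec n" for i j z
  proof (induction i)
    case (Suc i)
    then show ?case using that unfolding add_Suc Y_pow_Suc(1)[OF Y_pow_closed] Y_pow_Suc(1)[OF that] by simp
  qed (use Y that in auto)
  have step: "e i - e (Suc i) =
      - (\<xi> \<bullet> (Y ^\<^sub>m (a + b) *\<^sub>v u)) + (w \<bullet> (Y ^\<^sub>m (a + b - i) *\<^sub>v u)) * (\<xi> \<bullet> (Y ^\<^sub>m i *\<^sub>v v))"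
    if "i \<le> a + b" for i
  proof -
    have s: "a + b + 1 - i = Suc (a + b - i)" "a + b + 1 - Suc i = a + b - i" "i + (a + b - i) = a + b"
      using that by auto
    show ?thesis unfolding e_def s Y_pow_Suc(1)[OF u(1)] Y_pow_Suc(2)[OF X_closed]
      using relation_under[of "Y ^\<^sub>m i" \<xi> "Y ^\<^sub>m (a + b - i) *\<^sub>v u"] Y \<xi>(1) pow_add[OF u(1), of i "a + b - i"] s
      by simp
  qed
  have summand: "(w \<bullet> (Y ^\<^sub>m (a + b - i) *\<^sub>v u)) * (\<xi> \<bullet> (Y ^\<^sub>m i *\<^sub>v v)) =
      (if i = a then (w \<bullet> (Y ^\<^sub>m b *\<^sub>v u)) * (\<xi> \<bullet> (Y ^\<^sub>m a *\<^sub>v v)) else 0)"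
    if "i \<le> a + b" for i
    using a(2)[of i] b(2)[of "a + b - i"] that unfolding P_def Q_def
    by (cases i a rule: linorder_cases) auto
  have "e 0 - e (Suc (a + b)) = (\<Sum>i\<le>a + b. e i - e (Suc i))" by (simp only: sum_telescope)
  also have "\<dots> = (\<Sum>i\<le>a + b. - (\<xi> \<bullet> (Y ^\<^sub>m (a + b) *\<^sub>v u)) +
      (if i = a then (w \<bullet> (Y ^\<^sub>m b *\<^sub>v u)) * (\<xi> \<bullet> (Y ^\<^sub>m a *\<^sub>v v)) else 0))"
    using step summand by (intro sum.cong) auto
  also have "\<dots> = - of_nat (Suc (a + b)) * (\<xi> \<bullet> (Y ^\<^sub>m (a + b) *\<^sub>v u)) +
      (w \<bullet> (Y ^\<^sub>m b *\<^sub>v u)) * (\<xi> \<bullet> (Y ^\<^sub>m a *\<^sub>v v))"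
    by (simp add: sum_subtractf) (simp add: algebra_simps)
  finally have sum: "e 0 - e (Suc (a + b)) = \<dots>" .
  have "e 0 = c * (\<xi> \<bullet> (Y ^\<^sub>m (a + b + 1) *\<^sub>v u))"
    unfolding e_def using X Y \<xi> by (simp flip: pairing_transpose del: pow_mat.simps(2))
  moreover have "e (Suc (a + b)) = c * (\<xi> \<bullet> (Y ^\<^sub>m (a + b + 1) *\<^sub>v u))"
    unfolding e_def using Y \<xi> u by (simp add: mult_mat_vec[of _ n n] del: pow_mat.simps(2))
  ultimately have "of_nat (Suc (a + b)) * (\<xi> \<bullet> (Y ^\<^sub>m (a + b) *\<^sub>v u)) =
      (w \<bullet> (Y ^\<^sub>m b *\<^sub>v u)) * (\<xi> \<bullet> (Y ^\<^sub>m a *\<^sub>v v))"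
    using sum by (simp add: algebra_simps)
  moreover have "\<dots> \<noteq> 0" using a(1) b(1) by (simp add: P_def Q_def)
  ultimately show ?thesis by (metis mult_zero_right)
qed

text \<open>
  This is \<open>h(X) [(X - c)\<^sup>k, Y] h(X) = 0\<close> expanded by the relation; the left hand side vanishes
  because \<open>(X - c)\<^sup>k h(X) = 0\<close>.
\<close>

lemma commutator_telescope:
  fixes c :: complex and h :: "complex poly"
  defines "l \<equiv> [:- c, 1:]"
  assumes kill: "mat_poly n (l ^ k * h) X = 0\<^sub>m n n"
    and k: "k \<ge> 1" and y: "y \<in> carrier_vec n" and z: "z \<in> carrier_vec n"
  shows "of_nat k * (y \<bullet> (mat_poly n (l ^ (k - 1) * h * h) X *\<^sub>v z)) =
    (\<Sum>i<k. (w \<bullet> (mat_poly n (l ^ (k - 1 - i) * h) X *\<^sub>v z)) * (y \<bullet> (mat_poly n (l ^ i * h) X *\<^sub>v v)))"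
proof -
  define e where "e i = y \<bullet> (mat_poly n (l ^ i * h) X *\<^sub>v (Y *\<^sub>v (mat_poly n (l ^ (k - i) * h) X *\<^sub>v z)))" for i
  note mv = mat_poly_mult_vec[OF X]
  have step: "e i - e (Suc i) = y \<bullet> (mat_poly n (l ^ (k - 1) * h * h) X *\<^sub>v z) -
      (w \<bullet> (mat_poly n (l ^ (k - 1 - i) * h) X *\<^sub>v z)) * (y \<bullet> (mat_poly n (l ^ i * h) X *\<^sub>v v))"
    if i: "i < k" for i
  proof -
    have "l ^ (k - i) * h = l * (l ^ (k - 1 - i) * h)"
      using i by (metis Suc_diff_Suc diff_Suc_eq_diff_pred mult.assoc power_Suc)
    then have 1: "mat_poly n (l ^ (k - i) * h) X *\<^sub>v z =
        mat_poly n l X *\<^sub>v (mat_poly n (l ^ (k - 1 - i) * h) X *\<^sub>v z)"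
      using z by (simp only: mv)
    have "l ^ Suc i * h = (l ^ i * h) * l" by (simp add: algebra_simps)
    then have 2: "mat_poly n (l ^ Suc i * h) X *\<^sub>v z' = mat_poly n (l ^ i * h) X *\<^sub>v (mat_poly n l X *\<^sub>v z')"
      if "z' \<in> carrier_vec n" for z' using that by (simp only: mv)
    have "l ^ (k - 1) = l ^ i * l ^ (k - 1 - i)" using i by (simp flip: power_add)
    then have "l ^ (k - 1) * h * h = (l ^ i * h) * (l ^ (k - 1 - i) * h)" by (simp add: algebra_simps)
    then have 3: "mat_poly n (l ^ (k - 1) * h * h) X *\<^sub>v z =
        mat_poly n (l ^ i * h) X *\<^sub>v (mat_poly n (l ^ (k - 1 - i) * h) X *\<^sub>v z)"
      using z by (simp only: mv)
    have s: "k - Suc i = k - 1 - i" using i by simp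
    show ?thesis
      unfolding e_def s 1 2[OF Y_closed] 3
      using relation_under_shifted[of "mat_poly n (l ^ i * h) X" y "mat_poly n (l ^ (k - 1 - i) * h) X *\<^sub>v z" c] y
      unfolding l_def by simp
  qed
  have z0: "0\<^sub>m n n *\<^sub>v z' = 0\<^sub>v n" if "z' \<in> carrier_vec n" for z' :: "complex vec"
    by (rule zero_mat_mult_vec) (rule that)
  have "e 0 = 0" unfolding e_def
    using kill X Y y z z0[OF z] by (simp add: mult_mat_zero_vec[of _ n])
  moreover have "e k = 0" unfolding e_def
    using kill y z0[OF Y_closed] by simp
  moreover have "(\<Sum>i<k. e i - e (Suc i)) = e 0 - e k" by (rule sum_lessThan_telescope')
  ultimately have "(\<Sum>i<k. e i - e (Suc i)) = 0" by simp
  then show ?thesis by (simp add: step sum_subtractf)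
qed

text \<open>
  Put \<open>V\<^sub>i = (X - c)\<^sup>i h(X) v\<close> and \<open>W\<^sub>i = w\<^sup>T (X - c)\<^sup>i h(X)\<close>. The telescoped commutator reads
  \<open>k N = (\<Sum>i<k. V\<^sub>i W\<^bsub>k-1-i\<^esub>)\<close>. Let \<open>V\<^sub>a\<close> and \<open>W\<^sub>m\<close> be the last ones that are nonzero. If more
  than one summand survived, multiplication by a suitable power of \<open>X - c\<close> would kill \<open>N\<close> and all
  summands except \<open>V\<^sub>a W\<^sub>m\<close>, which is absurd. So \<open>a + m = k - 1\<close> and \<open>k N = V\<^sub>a W\<^sub>m\<close>.
\<close>

lemma top_nilpotent_part_rank_one:
  fixes c :: complex and h :: "complex poly"
  defines "l \<equiv> [:- c, 1:]"
  assumes kill: "mat_poly n (l ^ k * h) X = 0\<^sub>m n n"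
    and nz: "mat_poly n (l ^ (k - 1) * h * h) X \<noteq> 0\<^sub>m n n" and k: "k \<ge> 1"
  obtains u \<xi> where "u \<in> carrier_vec n" "u \<noteq> 0\<^sub>v n" "X *\<^sub>v u = c \<cdot>\<^sub>v u"
    "\<xi> \<in> carrier_vec n" "\<xi> \<noteq> 0\<^sub>v n" "transpose_mat X *\<^sub>v \<xi> = c \<cdot>\<^sub>v \<xi>"
    "\<And>z. z \<in> carrier_vec n \<Longrightarrow> mat_poly n (l ^ (k - 1) * h * h) X *\<^sub>v z = (\<xi> \<bullet> z) \<cdot>\<^sub>v u"
proof -
  note mv = mat_poly_mult_vec[OF X]
  define V where "V i = mat_poly n (l ^ i * h) X *\<^sub>v v" for i
  define W where "W i z = w \<bullet> (mat_poly n (l ^ i * h) X *\<^sub>v z)" for i z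
  let ?N = "mat_poly n (l ^ (k - 1) * h * h) X"
  have Vc [simp]: "V i \<in> carrier_vec n" for i by (simp add: V_def)
  have main: "of_nat k * (y \<bullet> (?N *\<^sub>v z)) = (\<Sum>i<k. W (k - 1 - i) z * (y \<bullet> V i))"
    if "y \<in> carrier_vec n" "z \<in> carrier_vec n" for y z
    unfolding V_def W_def using commutator_telescope[of c k h y z, folded l_def, OF kill k that] .
  have kill': "mat_poly n (l ^ i * h * g) X *\<^sub>v z = 0\<^sub>v n" if "i \<ge> k" "z \<in> carrier_vec n" for i z g
  proof -
    have "l ^ i = l ^ (i - k) * l ^ k" using that(1) by (simp flip: power_add)
    then have "l ^ i * h * g = (l ^ (i - k) * g) * (l ^ k * h)" by (simp add: algebra_simps)
    then have "mat_poly n (l ^ i * h * g) X *\<^sub>v z =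
        mat_poly n (l ^ (i - k) * g) X *\<^sub>v (mat_poly n (l ^ k * h) X *\<^sub>v z)"
      using that(2) by (simp only: mv)
    then show ?thesis using kill that by (simp add: zero_mat_mult_vec mult_mat_zero_vec)
  qed
  have V_shift: "mat_poly n (l ^ p) X *\<^sub>v V i = V (p + i)" for p i
    unfolding V_def by (subst mv[symmetric]) (use v in \<open>simp_all add: power_add mult.assoc\<close>)
  have W_shift: "W i (mat_poly n (l ^ p) X *\<^sub>v z) = W (i + p) z" if "z \<in> carrier_vec n" for p i z
    unfolding W_def by (subst mv[symmetric]) (use that in \<open>simp_all add: power_add algebra_simps\<close>)
  define a' where "a' = (LEAST i. V i = 0\<^sub>v n)"
  define l' where "l' = (LEAST i. \<forall>z\<in>carrier_vec n. W i z = 0)"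
  have Vk: "V k = 0\<^sub>v n" using kill'[of k v 1] v by (simp add: V_def)
  have Wk: "\<forall>z\<in>carrier_vec n. W k z = 0" using kill'[of k _ 1] w by (simp add: W_def)
  have a'0: "V a' = 0\<^sub>v n" unfolding a'_def by (rule LeastI[of "\<lambda>i. V i = 0\<^sub>v n"]) (rule Vk)
  have l'0: "\<forall>z\<in>carrier_vec n. W l' z = 0" unfolding l'_def
    by (rule LeastI[of "\<lambda>i. \<forall>z\<in>carrier_vec n. W i z = 0"]) (rule Wk)
  have Vz: "V i = 0\<^sub>v n" if "i \<ge> a'" for i
    using V_shift[of "i - a'" a'] a'0 that by (simp add: mult_mat_zero_vec)
  have Wz: "W i z = 0" if "i \<ge> l'" "z \<in> carrier_vec n" for i z
    using W_shift[of z l' "i - l'"] l'0 that by simp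
  have a'k: "a' \<le> k" unfolding a'_def by (rule Least_le) (rule Vk)
  have l'k: "l' \<le> k" unfolding l'_def by (rule Least_le) (rule Wk)
  obtain y0 z0 where yz0: "y0 \<in> carrier_vec n" "z0 \<in> carrier_vec n" "y0 \<bullet> (?N *\<^sub>v z0) \<noteq> 0"
  proof -
    obtain i j where ij: "i < n" "j < n" "?N $$ (i, j) \<noteq> 0"
    proof -
      have "\<exists>i<n. \<exists>j<n. ?N $$ (i, j) \<noteq> 0"
      proof (rule ccontr)
        assume "\<not> ?thesis"
        then have "?N = 0\<^sub>m n n" by (intro eq_matI) auto
        then show False using nz by simp
      qed
      then show ?thesis using that by blast
    qed
    have "unit_vec n i \<bullet> (?N *\<^sub>v unit_vec n j) = ?N $$ (i, j)" using ij by simp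
    then show ?thesis using that[of "unit_vec n i" "unit_vec n j"] ij by simp
  qed
  have "(\<Sum>i<k. W (k - 1 - i) z0 * (y0 \<bullet> V i)) \<noteq> 0" using main[OF yz0(1,2)] yz0(3) k by auto
  then obtain i where "i \<in> {..<k}" "W (k - 1 - i) z0 * (y0 \<bullet> V i) \<noteq> 0"
    by (rule sum.not_neutral_contains_not_neutral)
  then have i: "i < k" "W (k - 1 - i) z0 \<noteq> 0" "y0 \<bullet> V i \<noteq> 0" by auto
  have "i < a'" using Vz[of i] i(3) yz0(1) by (cases "i < a'") auto
  moreover have "k - 1 - i < l'" using Wz[of "k - 1 - i" z0] i(2) yz0(2) by (cases "k - 1 - i < l'") auto
  ultimately have ge: "a' + l' \<ge> k + 1" "a' \<ge> 1" "l' \<ge> 1" using i(1) by auto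
  define a where "a = a' - 1"
  define m where "m = l' - 1"
  have Va: "V a \<noteq> 0\<^sub>v n" using not_less_Least[of a "\<lambda>i. V i = 0\<^sub>v n"] ge by (auto simp: a_def a'_def)
  have Wm: "\<exists>z\<in>carrier_vec n. W m z \<noteq> 0"
    using not_less_Least[of m "\<lambda>i. \<forall>z\<in>carrier_vec n. W i z = 0"] ge by (auto simp: m_def l'_def)
  have am: "a + m \<ge> k - 1" "a < k" "m < k" using ge a'k l'k by (auto simp: a_def m_def)
  have eq: "a + m = k - 1"
  proof (rule ccontr)
    assume "a + m \<noteq> k - 1"
    \<comment> \<open>The power of \<open>X - c\<close> that moves the first surviving summand to \<open>V a\<close> and all later ones to zero.\<close>
    define p where "p = a + m - (k - 1)"
    have p: "p \<ge> 1" "k - 1 - m + p = a" using \<open>a + m \<noteq> k - 1\<close> am by (auto simp: p_def)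
    obtain z where z: "z \<in> carrier_vec n" "W m z \<noteq> 0" using Wm by blast
    have "V a = 0\<^sub>v n"
    proof (rule vec_eq_by_pairing[of _ n])
      fix y :: "complex vec" assume y: "y \<in> carrier_vec n"
      let ?y = "transpose_mat (mat_poly n (l ^ p) X) *\<^sub>v y"
      have yc: "?y \<in> carrier_vec n" by (rule mult_mat_vec_closed) simp
      have tr: "?y \<bullet> z' = y \<bullet> (mat_poly n (l ^ p) X *\<^sub>v z')" if "z' \<in> carrier_vec n" for z'
        by (rule pairing_transpose) (use that y in auto)
      have "mat_poly n (l ^ p) X *\<^sub>v (?N *\<^sub>v z) = mat_poly n (l ^ (p + (k - 1)) * h * h) X *\<^sub>v z"
        by (subst mv[symmetric]) (use z in \<open>simp_all add: power_add mult.assoc\<close>)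
      then have "mat_poly n (l ^ p) X *\<^sub>v (?N *\<^sub>v z) = 0\<^sub>v n" using kill'[of "p + (k - 1)" z h] z p by simp
      then have "?y \<bullet> (?N *\<^sub>v z) = 0" using y by (subst tr) auto
      then have "0 = (\<Sum>i<k. W (k - 1 - i) z * (y \<bullet> V (p + i)))"
        using main[OF yc z(1)] by (simp add: tr V_shift)
      also have "\<dots> = (\<Sum>i<k. if i = k - 1 - m then W m z * (y \<bullet> V a) else 0)"
      proof (rule sum.cong)
        fix i assume i: "i \<in> {..<k}"
        consider "i < k - 1 - m" | "i = k - 1 - m" | "i > k - 1 - m" by linarith
        then show "W (k - 1 - i) z * (y \<bullet> V (p + i)) =
            (if i = k - 1 - m then W m z * (y \<bullet> V a) else 0)"
        proof cases
          case 1
          then show ?thesis using Wz[of "k - 1 - i" z] z(1) by (auto simp: m_def)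
        next
          case 2
          then have "k - 1 - i = m" "p + i = a" using p am by auto
          then show ?thesis using 2 by simp
        next
          case 3
          then have "p + i \<ge> a'" using p by (simp add: a_def)
          then show ?thesis using 3 Vz y by simp
        qed
      qed simp
      also have "\<dots> = W m z * (y \<bullet> V a)" using am k by simp
      finally show "y \<bullet> V a = y \<bullet> 0\<^sub>v n" using z y by simp
    qed auto
    then show False using Va by simp
  qed
  have key: "of_nat k * (y \<bullet> (?N *\<^sub>v z)) = W m z * (y \<bullet> V a)"
    if y: "y \<in> carrier_vec n" and z: "z \<in> carrier_vec n" for y z
  proof -
    have "(\<Sum>i<k. W (k - 1 - i) z * (y \<bullet> V i)) = (\<Sum>i<k. if i = a then W m z * (y \<bullet> V a) else 0)"
    proof (rule sum.cong)
      fix i assume i: "i \<in> {..<k}"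
      consider "i < a" | "i = a" | "i > a" by linarith
      then show "W (k - 1 - i) z * (y \<bullet> V i) = (if i = a then W m z * (y \<bullet> V a) else 0)"
      proof cases
        case 1
        then have "k - 1 - i \<ge> l'" using eq ge by (simp add: m_def)
        then show ?thesis using 1 Wz z by auto
      next
        case 2
        then have "k - 1 - i = m" using eq by simp
        then show ?thesis using 2 by simp
      next
        case 3
        then have "i \<ge> a'" by (simp add: a_def)
        then show ?thesis using 3 Vz y by simp
      qed
    qed simp
    also have "\<dots> = W m z * (y \<bullet> V a)" using am by simp
    finally show ?thesis using main[OF y z] by simp
  qed
  define \<xi> where "\<xi> = (1 / of_nat k) \<cdot>\<^sub>v (transpose_mat (mat_poly n (l ^ m * h) X) *\<^sub>v w)"
  have \<xi>c: "\<xi> \<in> carrier_vec n" unfolding \<xi>_def by (simp add: mult_mat_vec_closed)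
  have \<xi>: "\<xi> \<bullet> z = W m z / of_nat k" if "z \<in> carrier_vec n" for z
  proof -
    have "\<xi> \<bullet> z = (1 / of_nat k) * ((transpose_mat (mat_poly n (l ^ m * h) X) *\<^sub>v w) \<bullet> z)"
      unfolding \<xi>_def by (rule smult_scalar_prod_distrib[of _ n]) (use that in \<open>auto simp: mult_mat_vec_closed\<close>)
    then show ?thesis using that w by (simp add: pairing_transpose[of _ n] W_def)
  qed
  have lX: "mat_poly n l X *\<^sub>v z = X *\<^sub>v z - c \<cdot>\<^sub>v z" if "z \<in> carrier_vec n" for z
    unfolding l_def by (rule linear_factor_mult_vec[OF X that])
  show ?thesis
  proof (rule that[of "V a" \<xi>])
    have "mat_poly n l X *\<^sub>v V a = 0\<^sub>v n"
      using V_shift[of 1 a] Vz[of "Suc a"] by (simp add: a_def)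
    then have z: "X *\<^sub>v V a - c \<cdot>\<^sub>v V a = 0\<^sub>v n" using lX by simp
    show "X *\<^sub>v V a = c \<cdot>\<^sub>v V a"
    proof (rule eq_vecI)
      fix i assume "i < dim_vec (c \<cdot>\<^sub>v V a)"
      then have "i < n" using Vc[of a] by (simp add: carrier_vecD)
      then show "(X *\<^sub>v V a) $ i = (c \<cdot>\<^sub>v V a) $ i"
        using arg_cong[OF z, of "\<lambda>x. x $ i"] Vc[of a] X by (simp add: carrier_vecD del: Vc)
    qed (use Vc[of a] X in \<open>simp add: carrier_vecD del: Vc\<close>)
    show "transpose_mat X *\<^sub>v \<xi> = c \<cdot>\<^sub>v \<xi>"
    proof (rule vec_eq_by_pairing[of _ n])
      fix y :: "complex vec" assume y: "y \<in> carrier_vec n"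
      have yc: "X *\<^sub>v y \<in> carrier_vec n" by simp
      have "y \<bullet> (transpose_mat X *\<^sub>v \<xi>) = \<xi> \<bullet> (X *\<^sub>v y)"
        using pairing_transpose[OF X y \<xi>c] comm_scalar_prod[OF y, of "transpose_mat X *\<^sub>v \<xi>"] X
        by (simp add: mult_mat_vec_closed)
      also have "\<dots> = (W m (mat_poly n l X *\<^sub>v y) + c * W m y) / of_nat k"
        unfolding \<xi>[OF yc] lX[OF y] W_def using y w X
        by (simp add: mult_minus_distrib_mat_vec[of _ n n] scalar_prod_minus_distrib[of _ n] mult_mat_vec[of _ n n])
      also have "W m (mat_poly n l X *\<^sub>v y) = 0"
        using W_shift[OF y, of m 1] Wz[of "Suc m" y] y by (simp add: m_def)
      finally show "y \<bullet> (transpose_mat X *\<^sub>v \<xi>) = y \<bullet> (c \<cdot>\<^sub>v \<xi>)"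
        using \<xi>[OF y] \<xi>c y comm_scalar_prod[OF y \<xi>c] by simp
    qed (use \<xi>c X in \<open>auto simp: mult_mat_vec_closed\<close>)
    show "\<xi> \<noteq> 0\<^sub>v n"
      using Wm \<xi> k by auto
    show "?N *\<^sub>v z = (\<xi> \<bullet> z) \<cdot>\<^sub>v V a" if z: "z \<in> carrier_vec n" for z
    proof (rule vec_eq_by_pairing[of _ n])
      fix y :: "complex vec" assume y: "y \<in> carrier_vec n"
      have "W m z = of_nat k * (\<xi> \<bullet> z)" using \<xi>[OF z] k by simp
      then have "of_nat k * (y \<bullet> (?N *\<^sub>v z)) = of_nat k * ((\<xi> \<bullet> z) * (y \<bullet> V a))"
        unfolding key[OF y z] by simp
      then have "y \<bullet> (?N *\<^sub>v z) = (\<xi> \<bullet> z) * (y \<bullet> V a)"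
        using k by (simp only: mult_cancel_left) simp
      then show "y \<bullet> (?N *\<^sub>v z) = y \<bullet> ((\<xi> \<bullet> z) \<cdot>\<^sub>v V a)"
        using y by (simp add: scalar_prod_smult_distrib[of _ n])
    qed auto
  qed (use Va \<xi>c in auto)
qed

text \<open>
  The left hand side is the trace of \<open>f(X) v w\<^sup>T = f(X) ([X, Y] + 1)\<close>, and the trace of
  \<open>f(X) [X, Y]\<close> is zero.
\<close>

lemma functional_of_poly:
  assumes \<mu>: "eigenvalue_seq n X \<mu>"
  shows "w \<bullet> (mat_poly n f X *\<^sub>v v) = (\<Sum>i<n. poly f (\<mu> i))"
proof -
  let ?F = "mat_poly n f X"
  have "mtrace (?F * (X * Y) + ?F) = mtrace (?F * (Y * X)) + w \<bullet> (?F *\<^sub>v v)"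
  proof -
    let ?R = "?F * (X * Y) + ?F - ?F * (Y * X)"
    have "mtrace ?R = w \<bullet> (?F *\<^sub>v v)"
    proof (rule mtrace_rank_one[of _ n])
      fix z :: "complex vec" assume z: "z \<in> carrier_vec n"
      show "?R *\<^sub>v z = (w \<bullet> z) \<cdot>\<^sub>v (?F *\<^sub>v v)"
      proof (rule vec_eq_by_pairing[of _ n])
        fix y :: "complex vec" assume y: "y \<in> carrier_vec n"
        have "?R *\<^sub>v z = ?F *\<^sub>v (X *\<^sub>v (Y *\<^sub>v z)) + ?F *\<^sub>v z - ?F *\<^sub>v (Y *\<^sub>v (X *\<^sub>v z))"
          by (subst minus_mult_distrib_mat_vec[of _ n n], (use X Y z in auto)[3],
            subst add_mult_distrib_mat_vec[of _ n n], (use X Y z in auto)[3])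
            (use X Y z in \<open>simp add: assoc_mult_mat_vec[of _ n n _ n]\<close>)
        then show "y \<bullet> (?R *\<^sub>v z) = y \<bullet> ((w \<bullet> z) \<cdot>\<^sub>v (?F *\<^sub>v v))"
          using relation_under[OF mat_poly_carrier y z, of f X] y
          by (simp add: scalar_prod_minus_distrib[of _ n] scalar_prod_add_distrib[of _ n])
      qed (use X Y in \<open>auto intro!: mult_mat_vec_closed\<close>)
    qed (use X Y w in \<open>auto intro!: minus_carrier_mat\<close>)
    moreover have "mtrace ?R = mtrace (?F * (X * Y) + ?F) - mtrace (?F * (Y * X))"
      using X Y by (simp add: mtrace_def sum_subtractf del: index_mult_mat(1))
    ultimately show ?thesis by (metis add.commute diff_add_cancel)
  qed
  moreover have "mtrace (?F * (X * Y) + ?F) = mtrace (?F * (X * Y)) + mtrace ?F"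
    by (rule mtrace_add[of _ n]) (use X Y in auto)
  moreover have "mtrace (?F * (Y * X)) = mtrace (?F * (X * Y))"
  proof -
    have "mtrace (?F * (Y * X)) = mtrace (?F * Y * X)" using X Y by (simp add: assoc_mult_mat[of _ n n _ n _ n])
    also have "\<dots> = mtrace (X * (?F * Y))" by (rule mtrace_mult_comm[of _ n]) (use X Y in auto)
    also have "X * (?F * Y) = (X * ?F) * Y" using X Y by (simp add: assoc_mult_mat[of _ n n _ n _ n])
    also have "X * ?F = ?F * X"
      by (rule mat_poly_commute[OF X, symmetric])
    also have "?F * X * Y = ?F * (X * Y)" using X Y by (simp add: assoc_mult_mat[of _ n n _ n _ n])
    finally show ?thesis .
  qed
  ultimately have "w \<bullet> (?F *\<^sub>v v) = mtrace ?F" by simp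
  then show ?thesis using \<mu> by (simp add: eigenvalue_seq_def)
qed

end

text \<open>
  Let \<open>c\<close> be an eigenvalue of multiplicity \<open>M \<ge> 2\<close>, write the characteristic polynomial as
  \<open>l\<^sup>M h\<close> with \<open>l = x - c\<close>, and let \<open>k\<close> be least with \<open>l\<^sup>k h\<close> annihilating \<open>X\<close>. For \<open>k = 1\<close>,
  the matrix \<open>h(X)\<^sup>2\<close> would have rank one, so the trace of its square would be the square of its
  trace and \<open>M = M\<^sup>2\<close>. Hence \<open>k \<ge> 2\<close>, and the annihilating polynomial \<open>l\<^sup>k h\<^sup>2\<close> splits into two
  factors that both vanish on the spectrum, while its derivative at \<open>X\<close> is \<open>k\<close> times the rank
  one matrix \<open>l\<^bsup>k-1\<^esup> h\<^sup>2\<close>.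
\<close>

lemma (in calogero_moser) repeated_eigenvalue_witness:
  assumes \<mu>: "eigenvalue_seq n X \<mu>" and rep: "\<not> inj_on \<mu> {..<n}"
  obtains g h d where "\<And>i. i < n \<Longrightarrow> poly g (\<mu> i) = 0" "\<And>i. i < n \<Longrightarrow> poly h (\<mu> i) = 0"
    "mtrace (mat_poly n (pderiv (g * h)) X * Y ^\<^sub>m d) \<noteq> 0"
proof -
  obtain i0 j0 where ij: "i0 < n" "j0 < n" "i0 \<noteq> j0" "\<mu> i0 = \<mu> j0"
    using rep by (auto simp: inj_on_def)
  define c where "c = \<mu> i0"
  define l where "l = [:- c, 1:]"
  define I where "I = {i. i < n \<and> \<mu> i = c}"
  define M where "M = card I"
  define h where "h = (\<Prod>i\<in>{..<n} - I. [:- \<mu> i, 1:])"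
  have I: "I \<subseteq> {..<n}" "finite I" by (auto simp: I_def)
  have "card {i0, j0} \<le> M" unfolding M_def by (rule card_mono) (use I ij in \<open>auto simp: I_def c_def\<close>)
  then have M: "M \<ge> 2" using ij by simp
  have hc: "poly h c \<noteq> 0" by (auto simp: h_def I_def poly_prod)
  have h0: "poly h (\<mu> i) = 0" if "i < n" "\<mu> i \<noteq> c" for i
    using that by (auto simp: h_def I_def poly_prod)
  have "(\<Prod>i<n. [:- \<mu> i, 1:]) = (\<Prod>i\<in>I. [:- \<mu> i, 1:]) * h"
    unfolding h_def using prod.subset_diff[OF I(1), of "\<lambda>i. [:- \<mu> i, 1:]"] by (simp add: mult.commute)
  also have "(\<Prod>i\<in>I. [:- \<mu> i, 1:]) = l ^ M"
    unfolding M_def prod_constant[symmetric] by (rule prod.cong) (auto simp: I_def l_def)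
  finally have killM: "mat_poly n (l ^ M * h) X = 0\<^sub>m n n"
    using \<mu> by (simp add: eigenvalue_seq_def)
  have trace: "mtrace (mat_poly n (h ^ m) X) = of_nat M * poly h c ^ m" if "m \<ge> 1" for m
  proof -
    have "(\<Sum>i<n. poly (h ^ m) (\<mu> i)) = (\<Sum>i\<in>I. poly (h ^ m) (\<mu> i))"
      by (rule sum.mono_neutral_right) (use I h0 that in \<open>auto simp: I_def poly_power\<close>)
    also have "\<dots> = of_nat M * poly h c ^ m" by (simp add: M_def I_def poly_power)
    finally show ?thesis using \<mu> by (simp add: eigenvalue_seq_def)
  qed
  define P where "P k \<longleftrightarrow> mat_poly n (l ^ k * h) X = 0\<^sub>m n n" for k
  define k where "k = (LEAST k. P k)"
  have Pk: "P k" unfolding k_def by (rule LeastI[of P M]) (simp add: P_def killM)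
  have "k \<noteq> 0"
  proof
    assume "k = 0"
    then have "mtrace (mat_poly n (h ^ 1) X) = 0" using Pk by (simp add: P_def mtrace_def)
    then show False using trace[of 1] M hc by simp
  qed
  then have k1: "k \<ge> 1" by simp
  have nz: "mat_poly n (l ^ (k - 1) * h * h) X \<noteq> 0\<^sub>m n n"
  proof
    assume z: "mat_poly n (l ^ (k - 1) * h * h) X = 0\<^sub>m n n"
    \<comment> \<open>Modulo \<open>l\<close> the factor \<open>h\<close> is a nonzero constant, so the extra \<open>h\<close> does not lower the exponent \<open>k\<close>.\<close>
    have "l dvd h - [:poly h c:]" unfolding l_def poly_eq_0_iff_dvd[symmetric] by simp
    then obtain s where s: "h - [:poly h c:] = l * s" by (elim dvdE)
    then have "h = [:poly h c:] + l * s" by (simp add: algebra_simps)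
    then have "l ^ (k - 1) * h * h = l ^ (k - 1) * h * ([:poly h c:] + l * s)" by simp
    also have "\<dots> = smult (poly h c) (l ^ (k - 1) * h) + s * (l * l ^ (k - 1) * h)"
      by (simp add: algebra_simps)
    also have "l * l ^ (k - 1) = l ^ k" using k1 by (simp flip: power_Suc)
    finally have "0\<^sub>m n n = mat_poly n (smult (poly h c) (l ^ (k - 1) * h) + s * (l ^ k * h)) X"
      using z by simp
    also have "\<dots> = poly h c \<cdot>\<^sub>m mat_poly n (l ^ (k - 1) * h) X"
      using Pk unfolding P_def by (simp add: mat_poly_add mat_poly_smult mat_poly_mult[OF X, of s]
          right_mult_zero_mat[of _ n n])
    finally have e: "0\<^sub>m n n = poly h c \<cdot>\<^sub>m mat_poly n (l ^ (k - 1) * h) X" .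
    have "mat_poly n (l ^ (k - 1) * h) X = 0\<^sub>m n n"
    proof (rule eq_matI)
      fix i j assume "i < dim_row (0\<^sub>m n n :: complex mat)" "j < dim_col (0\<^sub>m n n :: complex mat)"
      then show "mat_poly n (l ^ (k - 1) * h) X $$ (i, j) = 0\<^sub>m n n $$ (i, j)"
        using arg_cong[OF e, of "\<lambda>A. A $$ (i, j)"] hc by simp
    qed auto
    then have "P (k - 1)" by (simp add: P_def)
    moreover have "k - 1 < k" using k1 by simp
    ultimately show False unfolding k_def using not_less_Least by blast
  qed
  obtain u \<xi> where u: "u \<in> carrier_vec n" "u \<noteq> 0\<^sub>v n" "X *\<^sub>v u = c \<cdot>\<^sub>v u"
    and \<xi>: "\<xi> \<in> carrier_vec n" "\<xi> \<noteq> 0\<^sub>v n" "transpose_mat X *\<^sub>v \<xi> = c \<cdot>\<^sub>v \<xi>"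
    and act: "\<And>z. z \<in> carrier_vec n \<Longrightarrow> mat_poly n (l ^ (k - 1) * h * h) X *\<^sub>v z = (\<xi> \<bullet> z) \<cdot>\<^sub>v u"
    using top_nilpotent_part_rank_one[of c k h, folded l_def] Pk nz k1 unfolding P_def by blast
  have "k \<noteq> 1"
  proof
    assume "k = 1"
    then have a: "mat_poly n (h ^ 2) X *\<^sub>v z = (\<xi> \<bullet> z) \<cdot>\<^sub>v u" if "z \<in> carrier_vec n" for z
      using act[OF that] by (simp add: power2_eq_square)
    have 1: "mtrace (mat_poly n (h ^ 2) X) = \<xi> \<bullet> u"
      by (rule mtrace_rank_one[of _ n]) (use u \<xi> a in auto)
    have "mtrace (mat_poly n (h ^ 4) X) = \<xi> \<bullet> ((\<xi> \<bullet> u) \<cdot>\<^sub>v u)"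
    proof (rule mtrace_rank_one[of _ n])
      fix z :: "complex vec" assume z: "z \<in> carrier_vec n"
      have "h ^ 4 = h ^ 2 * h ^ 2" by (simp flip: power_add)
      then show "mat_poly n (h ^ 4) X *\<^sub>v z = (\<xi> \<bullet> z) \<cdot>\<^sub>v ((\<xi> \<bullet> u) \<cdot>\<^sub>v u)"
        using z u by (simp only: mat_poly_mult_vec[OF X]) (simp add: a mult_mat_vec[of _ n n])
    qed (use u \<xi> in auto)
    then have "mtrace (mat_poly n (h ^ 4) X) = (\<xi> \<bullet> u) * (\<xi> \<bullet> u)"
      using u \<xi> by simp
    then have "of_nat M * poly h c ^ 4 = (of_nat M * poly h c ^ 2) * (of_nat M * poly h c ^ 2)"
      using trace[of 2] trace[of 4] 1 by simp
    then have "of_nat M * poly h c ^ 4 = of_nat M * of_nat M * poly h c ^ 4"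
      by (simp add: algebra_simps flip: power_add)
    then show False using hc M by simp
  qed
  then have k2: "k \<ge> 2" using k1 by simp
  obtain d where d: "\<xi> \<bullet> (Y ^\<^sub>m d *\<^sub>v u) \<noteq> 0" using eigenpair_escape[OF u \<xi>] by blast
  let ?N = "mat_poly n (l ^ (k - 1) * h * h) X"
  let ?D = "mat_poly n (pderiv (l * h * (l ^ (k - 1) * h))) X"
  obtain k0 where k0: "k = Suc k0" using k1 by (cases k) auto
  have pl: "pderiv l = 1" by (simp add: l_def pderiv_pCons)
  have "l * h * (l ^ (k - 1) * h) = l ^ Suc k0 * (h * h)" by (simp add: k0)
  then have "pderiv (l * h * (l ^ (k - 1) * h)) =
      l ^ Suc k0 * (h * pderiv h + h * pderiv h) + h * h * smult (of_nat (Suc k0)) (l ^ k0)"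
    by (simp only: pderiv_mult pderiv_power_Suc pl mult_1_right)
  also have "\<dots> = smult (of_nat k) (l ^ (k - 1) * h * h) + (2 * pderiv h) * (l ^ k * h)"
    unfolding k0 by (simp only: diff_Suc_1 mult_smult_right mult_2 distrib_left distrib_right ac_simps)
  finally have "pderiv (l * h * (l ^ (k - 1) * h)) =
      smult (of_nat k) (l ^ (k - 1) * h * h) + (2 * pderiv h) * (l ^ k * h)" .
  then have "?D = of_nat k \<cdot>\<^sub>m ?N + mat_poly n (2 * pderiv h) X * mat_poly n (l ^ k * h) X"
    by (simp only: mat_poly_add mat_poly_smult mat_poly_mult[OF X, of "2 * pderiv h"])
  then have D: "?D = of_nat k \<cdot>\<^sub>m ?N"
    using Pk unfolding P_def by (simp add: right_mult_zero_mat[of _ n n])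
  have Yd: "Y ^\<^sub>m d \<in> carrier_mat n n" using Y by simp
  have "mtrace (?N * Y ^\<^sub>m d) = (transpose_mat (Y ^\<^sub>m d) *\<^sub>v \<xi>) \<bullet> u"
  proof (rule mtrace_rank_one[of _ n])
    fix z :: "complex vec" assume z: "z \<in> carrier_vec n"
    have "(?N * Y ^\<^sub>m d) *\<^sub>v z = ?N *\<^sub>v (Y ^\<^sub>m d *\<^sub>v z)"
      by (rule assoc_mult_mat_vec) (use Yd z in auto)
    also have "\<dots> = (\<xi> \<bullet> (Y ^\<^sub>m d *\<^sub>v z)) \<cdot>\<^sub>v u" by (rule act) simp
    also have "\<xi> \<bullet> (Y ^\<^sub>m d *\<^sub>v z) = (transpose_mat (Y ^\<^sub>m d) *\<^sub>v \<xi>) \<bullet> z"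
      by (rule pairing_transpose[symmetric]) (use Yd z \<xi> in auto)
    finally show "(?N * Y ^\<^sub>m d) *\<^sub>v z = ((transpose_mat (Y ^\<^sub>m d) *\<^sub>v \<xi>) \<bullet> z) \<cdot>\<^sub>v u" .
  qed (use Yd u in \<open>auto intro!: mult_mat_vec_closed mult_carrier_mat[of _ n n]\<close>)
  also have "\<dots> = \<xi> \<bullet> (Y ^\<^sub>m d *\<^sub>v u)" by (rule pairing_transpose) (use Yd u \<xi> in auto)
  finally have "mtrace (?D * Y ^\<^sub>m d) = of_nat k * (\<xi> \<bullet> (Y ^\<^sub>m d *\<^sub>v u))"
    unfolding D using Yd by (simp add: mult_smult_assoc_mat[of _ n n _ n] mtrace_smult[of _ n] mult_carrier_mat[of _ n n])
  then have "mtrace (?D * Y ^\<^sub>m d) \<noteq> 0" using d k1 by simp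
  moreover have "poly (l * h) (\<mu> i) = 0" if "i < n" for i
    using h0[OF that] by (cases "\<mu> i = c") (auto simp: l_def)
  moreover have "poly (l ^ (k - 1) * h) (\<mu> i) = 0" if "i < n" for i
    using h0[OF that] k2 by (cases "\<mu> i = c") (auto simp: l_def poly_power zero_power)
  ultimately show ?thesis using that[of "l * h" "l ^ (k - 1) * h" d] by blast
qed


section \<open>Splitting eigenvalues along a line of matrices\<close>

lemma mtrace_mat_poly_times:
  assumes X: "X \<in> carrier_mat n n" and B: "B \<in> carrier_mat n n" and N: "degree f \<le> N"
  shows "mtrace (mat_poly n f X * B) = (\<Sum>k\<le>N. coeff f k * mtrace (X ^\<^sub>m k * B))"
proof -
  have "mtrace (mat_poly n f X * B) = (\<Sum>i<n. \<Sum>j<n. (\<Sum>k\<le>N. coeff f k * (X ^\<^sub>m k) $$ (i, j)) * B $$ (j, i))"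
    using B by (auto simp: mtrace_def scalar_prod_def atLeast0LessThan mat_poly_index[OF N] intro!: sum.cong)
  also have "\<dots> = (\<Sum>k\<le>N. \<Sum>i<n. \<Sum>j<n. coeff f k * ((X ^\<^sub>m k) $$ (i, j) * B $$ (j, i)))"
    by (simp only: sum_distrib_right sum.swap[of _ "{..N}"] mult.assoc)
  also have "\<dots> = (\<Sum>k\<le>N. coeff f k * mtrace (X ^\<^sub>m k * B))"
  proof (rule sum.cong[OF refl])
    fix k
    have "mtrace (X ^\<^sub>m k * B) = (\<Sum>i<n. \<Sum>j<n. (X ^\<^sub>m k) $$ (i, j) * B $$ (j, i))"
      using X B by (auto simp: mtrace_def scalar_prod_def atLeast0LessThan intro!: sum.cong)
    then show "(\<Sum>i<n. \<Sum>j<n. coeff f k * ((X ^\<^sub>m k) $$ (i, j) * B $$ (j, i))) = coeff f k * mtrace (X ^\<^sub>m k * B)"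
      by (simp add: sum_distrib_left)
  qed
  finally show ?thesis .
qed

lemma mtrace_mat_poly:
  assumes X: "X \<in> carrier_mat n n"
  shows "mtrace (mat_poly n f X) = (\<Sum>k\<le>degree f. coeff f k * mtrace (X ^\<^sub>m k))"
  using mtrace_mat_poly_times[OF X one_carrier_mat order_refl, of f] X
  by (simp add: right_mult_one_mat[of _ n n])

text \<open>
  The derivative of \<open>(X + t B)\<^sup>k\<close> at zero is the noncommutative sum of all
  \<open>X\<^sup>i B X\<^bsup>k-1-i\<^esup>\<close>. Under the trace it behaves as if \<open>X\<close> and \<open>B\<close> commuted; the factor
  \<open>X\<^sup>m\<close> makes this provable by induction on \<open>k\<close>.
\<close>

lemma matrix_power_derivative:
  assumes X: "X \<in> carrier_mat n n" and B: "B \<in> carrier_mat n n"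
  shows "\<exists>D\<in>carrier_mat n n.
    (\<forall>i<n. \<forall>j<n. ((\<lambda>t. ((X + t \<cdot>\<^sub>m B) ^\<^sub>m k) $$ (i, j)) has_field_derivative D $$ (i, j)) (at 0)) \<and>
    (\<forall>m. mtrace (D * X ^\<^sub>m m) = of_nat k * mtrace (X ^\<^sub>m (k - 1 + m) * B))"
proof (induction k)
  case 0
  show ?case
    using X B by (intro bexI[of _ "0\<^sub>m n n"]) (auto simp: mtrace_def left_mult_zero_mat[of _ n n])
next
  case (Suc k)
  then obtain D where D: "D \<in> carrier_mat n n"
    and der: "\<And>i j. i < n \<Longrightarrow> j < n \<Longrightarrow> ((\<lambda>t. ((X + t \<cdot>\<^sub>m B) ^\<^sub>m k) $$ (i, j)) has_field_derivative D $$ (i, j)) (at 0)"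
    and tr: "\<And>m. mtrace (D * X ^\<^sub>m m) = of_nat k * mtrace (X ^\<^sub>m (k - 1 + m) * B)"
    by blast
  have Xt: "X + t \<cdot>\<^sub>m B \<in> carrier_mat n n" for t using X B by simp
  have X0: "X + 0 \<cdot>\<^sub>m B = X" using X B by (intro eq_matI) auto
  have Xk: "X ^\<^sub>m i \<in> carrier_mat n n" for i using X by simp
  have padd: "X ^\<^sub>m i * X ^\<^sub>m j = X ^\<^sub>m (i + j)" for i j
  proof (induction j)
    case (Suc j)
    have "X ^\<^sub>m i * X ^\<^sub>m Suc j = (X ^\<^sub>m i * X ^\<^sub>m j) * X"
      unfolding pow_mat.simps by (rule assoc_mult_mat[symmetric, of _ n n _ n _ n]) (use X in auto)
    then show ?case using Suc by simp
  qed (use X Xk in \<open>simp add: right_mult_one_mat[of _ n n]\<close>)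
  let ?D = "D * X + X ^\<^sub>m k * B"
  show ?case
  proof (intro bexI[of _ ?D] conjI allI impI)
    fix i j assume ij: "i < n" "j < n"
    have e: "((X + t \<cdot>\<^sub>m B) ^\<^sub>m Suc k) $$ (i, j) =
        (\<Sum>l<n. ((X + t \<cdot>\<^sub>m B) ^\<^sub>m k) $$ (i, l) * (X $$ (l, j) + t * B $$ (l, j)))" for t
      using Xt[of t] pow_carrier_mat[OF Xt[of t], of k] X B ij
      by (auto simp: scalar_prod_def atLeast0LessThan intro!: sum.cong)
    have "((\<lambda>t. ((X + t \<cdot>\<^sub>m B) ^\<^sub>m k) $$ (i, l) * (X $$ (l, j) + t * B $$ (l, j))) has_field_derivative
        D $$ (i, l) * X $$ (l, j) + (X ^\<^sub>m k) $$ (i, l) * B $$ (l, j)) (at 0)" if "l < n" for l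
      by (rule DERIV_cong, rule DERIV_mult, rule der[OF ij(1) that], (rule derivative_intros)+)
        (simp add: X0 algebra_simps)
    then have "((\<lambda>t. \<Sum>l<n. ((X + t \<cdot>\<^sub>m B) ^\<^sub>m k) $$ (i, l) * (X $$ (l, j) + t * B $$ (l, j))) has_field_derivative
        (\<Sum>l<n. D $$ (i, l) * X $$ (l, j) + (X ^\<^sub>m k) $$ (i, l) * B $$ (l, j))) (at 0)"
      by (intro DERIV_sum) auto
    also have "(\<Sum>l<n. D $$ (i, l) * X $$ (l, j) + (X ^\<^sub>m k) $$ (i, l) * B $$ (l, j)) = ?D $$ (i, j)"
      using D X B Xk[of k] ij by (auto simp: scalar_prod_def atLeast0LessThan sum.distrib)
    finally show "((\<lambda>t. ((X + t \<cdot>\<^sub>m B) ^\<^sub>m Suc k) $$ (i, j)) has_field_derivative ?D $$ (i, j)) (at 0)"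
      unfolding e .
  next
    fix m
    have "mtrace (?D * X ^\<^sub>m m) = mtrace (D * X * X ^\<^sub>m m) + mtrace (X ^\<^sub>m k * B * X ^\<^sub>m m)"
      using D X B Xk by (subst add_mult_distrib_mat[of _ n n _ _ n]) (auto intro!: mtrace_add[of _ n] mult_carrier_mat[of _ n n])
    also have "D * X * X ^\<^sub>m m = D * X ^\<^sub>m Suc m"
      unfolding pow_mat_Suc_left[OF X] by (rule assoc_mult_mat[of _ n n _ n _ n]) (use D X in auto)
    also have "mtrace (X ^\<^sub>m k * B * X ^\<^sub>m m) = mtrace (X ^\<^sub>m m * (X ^\<^sub>m k * B))"
      by (rule mtrace_mult_comm[of _ n]) (use X B Xk in \<open>auto intro!: mult_carrier_mat[of _ n n]\<close>)
    also have "X ^\<^sub>m m * (X ^\<^sub>m k * B) = X ^\<^sub>m (m + k) * B"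
      unfolding padd[symmetric] by (rule assoc_mult_mat[symmetric, of _ n n _ n _ n]) (use X B Xk in auto)
    also have "mtrace (D * X ^\<^sub>m Suc m) = of_nat k * mtrace (X ^\<^sub>m (m + k) * B)"
      unfolding tr by (cases k) (auto simp: add.commute)
    finally show "mtrace (?D * X ^\<^sub>m m) = of_nat (Suc k) * mtrace (X ^\<^sub>m (Suc k - 1 + m) * B)"
      by (simp add: algebra_simps)
  qed (use D X B Xk in \<open>auto intro!: add_carrier_mat mult_carrier_mat[of _ n n]\<close>)
qed

lemma trace_polynomial_derivative:
  assumes X: "X \<in> carrier_mat n n" and B: "B \<in> carrier_mat n n"
  shows "((\<lambda>t. mtrace (mat_poly n f (X + t \<cdot>\<^sub>m B))) has_field_derivative
    mtrace (mat_poly n (pderiv f) X * B)) (at 0)"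
proof -
  have Xt: "X + t \<cdot>\<^sub>m B \<in> carrier_mat n n" for t using X B by simp
  have tr: "((\<lambda>t. mtrace ((X + t \<cdot>\<^sub>m B) ^\<^sub>m k)) has_field_derivative of_nat k * mtrace (X ^\<^sub>m (k - 1) * B)) (at 0)" for k
  proof -
    obtain D where D: "D \<in> carrier_mat n n"
      and der: "\<And>i j. i < n \<Longrightarrow> j < n \<Longrightarrow> ((\<lambda>t. ((X + t \<cdot>\<^sub>m B) ^\<^sub>m k) $$ (i, j)) has_field_derivative D $$ (i, j)) (at 0)"
      and tr: "\<And>m. mtrace (D * X ^\<^sub>m m) = of_nat k * mtrace (X ^\<^sub>m (k - 1 + m) * B)"
      using matrix_power_derivative[OF X B, of k] by blast
    have e: "mtrace ((X + t \<cdot>\<^sub>m B) ^\<^sub>m k) = (\<Sum>i<n. ((X + t \<cdot>\<^sub>m B) ^\<^sub>m k) $$ (i, i))" for t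
      by (simp only: mtrace_def carrier_matD(1)[OF pow_carrier_mat[OF Xt[of t], of k]])
    have "mtrace D = of_nat k * mtrace (X ^\<^sub>m (k - 1) * B)"
      using tr[of 0] D X by (simp add: right_mult_one_mat[of _ n n])
    then have "(\<Sum>i<n. D $$ (i, i)) = of_nat k * mtrace (X ^\<^sub>m (k - 1) * B)" using D by (simp add: mtrace_def)
    moreover have "((\<lambda>t. \<Sum>i<n. ((X + t \<cdot>\<^sub>m B) ^\<^sub>m k) $$ (i, i)) has_field_derivative (\<Sum>i<n. D $$ (i, i))) (at 0)"
      by (intro DERIV_sum der) auto
    ultimately show ?thesis unfolding e by simp
  qed
  have "mtrace (mat_poly n (pderiv f) X * B) = (\<Sum>k\<le>degree f. coeff (pderiv f) k * mtrace (X ^\<^sub>m k * B))"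
    by (rule mtrace_mat_poly_times[OF X B]) (simp add: degree_pderiv)
  also have "\<dots> = (\<Sum>k\<le>degree f. coeff f (Suc k) * (of_nat (Suc k) * mtrace (X ^\<^sub>m (Suc k - 1) * B)))"
    by (simp add: coeff_pderiv algebra_simps)
  also have "\<dots> = (\<Sum>k\<le>Suc (degree f). coeff f k * (of_nat k * mtrace (X ^\<^sub>m (k - 1) * B)))"
    by (subst sum.atMost_Suc_shift) simp
  also have "\<dots> = (\<Sum>k\<le>degree f. coeff f k * (of_nat k * mtrace (X ^\<^sub>m (k - 1) * B)))"
    by (simp add: coeff_eq_0)
  finally have eq: "mtrace (mat_poly n (pderiv f) X * B) = \<dots>" .
  show ?thesis unfolding mtrace_mat_poly[OF Xt] eq by (intro DERIV_sum DERIV_cmult tr)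
qed

lemma tendsto_det:
  fixes A :: "'b \<Rightarrow> complex mat"
  assumes A: "\<And>t. A t \<in> carrier_mat n n" and B: "B \<in> carrier_mat n n"
    and lim: "\<And>i j. i < n \<Longrightarrow> j < n \<Longrightarrow> ((\<lambda>t. A t $$ (i, j)) \<longlongrightarrow> B $$ (i, j)) F"
  shows "((\<lambda>t. det (A t)) \<longlongrightarrow> det B) F"
  unfolding det_def'[OF A] det_def'[OF B]
proof (intro tendsto_sum tendsto_mult tendsto_const tendsto_prod)
  fix p i assume "p \<in> {p. p permutes {0..<n}}" "i \<in> {0..<n}"
  then show "((\<lambda>t. A t $$ (i, p i)) \<longlongrightarrow> B $$ (i, p i)) F"
    using permutes_in_image[of p "{0..<n}" i] by (intro lim) auto
qed

text \<open>
  The matrix of the bilinear form \<open>(g, h) \<mapsto> (\<Sum>a<n. (g h)(\<mu>\<^sub>a))\<close> factors through the values of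
  the polynomials at the distinct \<open>\<mu>\<^sub>a\<close>, which bounds its rank. Padding the two factors with zeros
  to square matrices turns the rank bound into a vanishing determinant.
\<close>

lemma gram_det_zero:
  fixes \<mu> :: "nat \<Rightarrow> complex" and g h :: "nat \<Rightarrow> complex poly"
  assumes "card (\<mu> ` {..<n}) < N"
  shows "det (mat N N (\<lambda>(i, j). \<Sum>a<n. poly (g i * h j) (\<mu> a))) = 0"
proof -
  define S where "S = \<mu> ` {..<n}"
  define r where "r = card S"
  have "finite S" by (simp add: S_def)
  then obtain e where e: "bij_betw e {..<r} S"
    using ex_bij_betw_nat_finite[of S] by (auto simp: r_def atLeast0LessThan)
  define A where "A = mat N N (\<lambda>(i, b). if b < r then of_nat (card {a. a < n \<and> \<mu> a = e b}) * poly (g i) (e b) else 0)"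
  define B where "B = mat N N (\<lambda>(b, j). if b < r then poly (h j) (e b) else 0)"
  have r: "r < N" using assms by (simp add: r_def S_def)
  have AB: "A \<in> carrier_mat N N" "B \<in> carrier_mat N N" by (simp_all add: A_def B_def)
  have "mat N N (\<lambda>(i, j). \<Sum>a<n. poly (g i * h j) (\<mu> a)) = A * B"
  proof (rule eq_matI)
    fix i j assume "i < dim_row (A * B)" "j < dim_col (A * B)"
    then have ij: "i < N" "j < N" using AB by auto
    have "(\<Sum>a<n. poly (g i * h j) (\<mu> a)) = (\<Sum>s\<in>S. \<Sum>a | a \<in> {..<n} \<and> \<mu> a = s. poly (g i * h j) (\<mu> a))"
      unfolding S_def by (rule sum.image_gen) simp
    also have "\<dots> = (\<Sum>s\<in>S. of_nat (card {a. a < n \<and> \<mu> a = s}) * poly (g i * h j) s)"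
      by (intro sum.cong) auto
    also have "\<dots> = (\<Sum>b<r. of_nat (card {a. a < n \<and> \<mu> a = e b}) * poly (g i * h j) (e b))"
      by (rule sum.reindex_bij_betw[OF e, symmetric])
    also have "\<dots> = (\<Sum>b<N. A $$ (i, b) * B $$ (b, j))"
      by (rule sum.mono_neutral_cong_left) (use r ij in \<open>auto simp: A_def B_def\<close>)
    also have "\<dots> = (A * B) $$ (i, j)" using AB ij by (simp add: scalar_prod_def atLeast0LessThan)
    finally show "mat N N (\<lambda>(i, j). \<Sum>a<n. poly (g i * h j) (\<mu> a)) $$ (i, j) = (A * B) $$ (i, j)" using ij by simp
  qed (use AB in auto)
  moreover have "det A = 0"
  proof -
    have "A *\<^sub>v unit_vec N r = 0\<^sub>v N"
      using r by (intro eq_vecI) (auto simp: A_def)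
    then show ?thesis
      using det_0_iff_vec_prod_zero_field[OF AB(1)] r
      by (metis unit_vec_carrier unit_vec_nonzero)
  qed
  ultimately show ?thesis using det_mult[OF AB] by simp
qed

lemma interpolation_exists:
  fixes F :: "complex \<Rightarrow> complex"
  assumes "finite S"
  obtains p where "\<And>s. s \<in> S \<Longrightarrow> poly p s = F s"
proof -
  have "\<exists>p. \<forall>s\<in>S. poly p s = F s"
    using assms
  proof (induction S)
    case (insert a S)
    then obtain p where p: "\<forall>s\<in>S. poly p s = F s" by blast
    let ?q = "\<Prod>s\<in>S. [:- s, 1:]"
    have q: "poly ?q a \<noteq> 0" "\<And>s. s \<in> S \<Longrightarrow> poly ?q s = 0" using insert by (auto simp: poly_prod)
    show ?case
      by (rule exI[of _ "p + smult ((F a - poly p a) / poly ?q a) ?q"]) (use p q in auto)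
  qed simp
  then show ?thesis using that by blast
qed

lemma card_spectrum_ge:
  assumes M: "M \<in> carrier_mat n n"
    and det: "det (mat N N (\<lambda>(i, j). mtrace (mat_poly n (g i * h j) M))) \<noteq> 0"
  shows "N \<le> card (spectrum M)"
proof (rule ccontr)
  assume "\<not> N \<le> card (spectrum M)"
  obtain \<mu> where \<mu>: "eigenvalue_seq n M \<mu>" using eigenvalue_seq_exists[OF M] .
  then have "card (\<mu> ` {..<n}) < N"
    using \<open>\<not> N \<le> _\<close> by (simp add: eigenvalue_seq_def)
  from gram_det_zero[OF this, of g h] show False
    using det \<mu> by (simp add: eigenvalue_seq_def)
qed

text \<open>
  The \<open>l i\<close> are indicator polynomials of the points of the spectrum, so they are orthogonal for the
  trace form and the diagonal values are the multiplicities.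
\<close>

lemma spectrum_indicators:
  assumes X: "X \<in> carrier_mat n n"
  obtains l where "\<And>i j. i < card (spectrum X) \<Longrightarrow> j < card (spectrum X) \<Longrightarrow>
    mtrace (mat_poly n (l i * l j) X) = 0 \<longleftrightarrow> i \<noteq> j"
proof -
  let ?r = "card (spectrum X)"
  obtain \<mu> where \<mu>: "eigenvalue_seq n X \<mu>" using eigenvalue_seq_exists[OF X] .
  have fin: "finite (spectrum X)" by (rule card_finite_spectrum(1)[OF X])
  obtain e where e: "bij_betw e {..<?r} (spectrum X)"
    using ex_bij_betw_nat_finite[OF fin] by (auto simp: atLeast0LessThan)
  have "\<exists>p. \<forall>s\<in>spectrum X. poly p s = (if s = e i then 1 else 0)" for i
    using interpolation_exists[OF fin, of "\<lambda>s. if s = e i then 1 else 0"] by metis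
  then obtain l where l: "\<And>i s. s \<in> spectrum X \<Longrightarrow> poly (l i) s = (if s = e i then 1 else 0)" by metis
  have "mtrace (mat_poly n (l i * l j) X) = 0 \<longleftrightarrow> i \<noteq> j" if ij: "i < ?r" "j < ?r" for i j
  proof -
    have sp: "\<mu> a \<in> spectrum X" if "a < n" for a using \<mu> that by (auto simp: eigenvalue_seq_def)
    have ne: "e i \<noteq> e j" if "i \<noteq> j" using e ij that by (auto simp: bij_betw_def inj_on_def)
    have tr: "mtrace (mat_poly n (l i * l j) X) = (\<Sum>a<n. poly (l i) (\<mu> a) * poly (l j) (\<mu> a))"
      using \<mu> by (simp add: eigenvalue_seq_def)
    show ?thesis
    proof (cases "i = j")
      case True
      have "(\<Sum>a<n. poly (l i) (\<mu> a) * poly (l i) (\<mu> a)) = (\<Sum>a<n. if \<mu> a = e i then 1 else 0)"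
        by (intro sum.cong) (auto simp: l sp)
      also have "\<dots> = of_nat (card {a. a < n \<and> \<mu> a = e i})"
        by (simp add: sum.If_cases Int_def)
      finally have s: "(\<Sum>a<n. poly (l i) (\<mu> a) * poly (l i) (\<mu> a)) = of_nat (card {a. a < n \<and> \<mu> a = e i})" .
      have "e i \<in> spectrum X" using e ij by (auto simp: bij_betw_def)
      then have "{a. a < n \<and> \<mu> a = e i} \<noteq> {}" using \<mu> by (auto simp: eigenvalue_seq_def)
      then show ?thesis using True tr s by simp
    next
      case False
      then show ?thesis unfolding tr using ne by (auto simp: l sp intro!: sum.neutral)
    qed
  qed
  then show ?thesis using that by blast
qed

lemma det_upper_triangular_nonzero:
  fixes A :: "complex mat"
  assumes "A \<in> carrier_mat n n" "\<And>i j. i < n \<Longrightarrow> j < i \<Longrightarrow> A $$ (i, j) = 0"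
    "\<And>i. i < n \<Longrightarrow> A $$ (i, i) \<noteq> 0"
  shows "det A \<noteq> 0"
proof -
  have "upper_triangular A" using assms by (auto simp: upper_triangular_def)
  then show ?thesis
    using upper_triangular_imp_det_eq_0_iff[of A n] assms by (auto simp: diag_mat_def)
qed

lemma trace_polynomial_tendsto:
  assumes X: "X \<in> carrier_mat n n" and B: "B \<in> carrier_mat n n"
  shows "((\<lambda>t. mtrace (mat_poly n f (X + t \<cdot>\<^sub>m B))) \<longlongrightarrow> mtrace (mat_poly n f X)) (at 0)"
proof -
  have "X + 0 \<cdot>\<^sub>m B = X" using X B by (intro eq_matI) auto
  then show ?thesis
    using DERIV_isCont[OF trace_polynomial_derivative[OF X B, of f]] by (simp add: isCont_def)
qed

text \<open>
  The Gram determinant of the indicator polynomials is nonzero at \<open>t = 0\<close> and continuous in \<open>t\<close>.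
\<close>

lemma card_spectrum_persists:
  fixes X B :: "complex mat"
  assumes X: "X \<in> carrier_mat n n" and B: "B \<in> carrier_mat n n"
  shows "\<forall>\<^sub>F t in at 0. card (spectrum X) \<le> card (spectrum (X + t \<cdot>\<^sub>m B))"
proof -
  let ?r = "card (spectrum X)"
  obtain l where l: "\<And>i j. i < ?r \<Longrightarrow> j < ?r \<Longrightarrow> mtrace (mat_poly n (l i * l j) X) = 0 \<longleftrightarrow> i \<noteq> j"
    using spectrum_indicators[OF X] by blast
  define G where "G M = mat ?r ?r (\<lambda>(i, j). mtrace (mat_poly n (l i * l j) M))" for M
  have "((\<lambda>t. det (G (X + t \<cdot>\<^sub>m B))) \<longlongrightarrow> det (G X)) (at 0)"
    by (rule tendsto_det[of _ ?r]) (auto simp: G_def intro: trace_polynomial_tendsto[OF X B])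
  moreover have "det (G X) \<noteq> 0"
    by (rule det_upper_triangular_nonzero[of _ ?r]) (auto simp: G_def l)
  ultimately have "\<forall>\<^sub>F t in at 0. det (G (X + t \<cdot>\<^sub>m B)) \<noteq> 0"
    by (rule tendsto_imp_eventually_ne)
  then show ?thesis
    by (rule eventually_mono) (use card_spectrum_ge[of _ n ?r l l] X B in \<open>simp add: G_def\<close>)
qed

text \<open>
  Border the Gram matrix of the indicator polynomials by one row for \<open>g\<close> and one column for \<open>h\<close>.
  Both vanish at \<open>t = 0\<close> since \<open>g\<close> and \<open>h\<close> vanish on the spectrum. Dividing the row by \<open>t\<close>,
  the limit is an upper triangular matrix whose new corner is the derivative of \<open>tr (g h)\<close>, the
  nonzero trace in the hypothesis.
\<close>

lemma card_spectrum_increases: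
  fixes X B :: "complex mat"
  assumes X: "X \<in> carrier_mat n n" and B: "B \<in> carrier_mat n n"
    and g: "\<And>s. s \<in> spectrum X \<Longrightarrow> poly g s = 0" and h: "\<And>s. s \<in> spectrum X \<Longrightarrow> poly h s = 0"
    and nz: "mtrace (mat_poly n (pderiv (g * h)) X * B) \<noteq> 0"
  shows "\<forall>\<^sub>F t in at 0. card (spectrum X) < card (spectrum (X + t \<cdot>\<^sub>m B))"
proof -
  let ?r = "card (spectrum X)"
  obtain l where l: "\<And>i j. i < ?r \<Longrightarrow> j < ?r \<Longrightarrow> mtrace (mat_poly n (l i * l j) X) = 0 \<longleftrightarrow> i \<noteq> j"
    using spectrum_indicators[OF X] by blast
  obtain \<mu> where \<mu>: "eigenvalue_seq n X \<mu>" using eigenvalue_seq_exists[OF X] .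
  have vanish: "mtrace (mat_poly n (p * q) X) = 0" if "\<And>s. s \<in> spectrum X \<Longrightarrow> poly p s * poly q s = 0" for p q
    using \<mu> that by (auto simp: eigenvalue_seq_def intro!: sum.neutral)
  define gg where "gg t i = (case i of 0 \<Rightarrow> smult (1 / t) g | Suc i \<Rightarrow> l i)" for t :: complex and i
  define hh where "hh j = (case j of 0 \<Rightarrow> h | Suc j \<Rightarrow> l j)" for j
  define G where "G t = mat (Suc ?r) (Suc ?r) (\<lambda>(i, j). mtrace (mat_poly n (gg t i * hh j) (X + t \<cdot>\<^sub>m B)))" for t
  define K where "K = mat (Suc ?r) (Suc ?r) (\<lambda>(i, j). case i of
      0 \<Rightarrow> mtrace (mat_poly n (pderiv (g * hh j)) X * B) | Suc i \<Rightarrow> mtrace (mat_poly n (l i * hh j) X))"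
  have X0: "X + 0 \<cdot>\<^sub>m B = X" using X B by (intro eq_matI) auto
  have "((\<lambda>t. det (G t)) \<longlongrightarrow> det K) (at 0)"
  proof (rule tendsto_det[of _ "Suc ?r"])
    fix i j assume ij: "i < Suc ?r" "j < Suc ?r"
    show "((\<lambda>t. G t $$ (i, j)) \<longlongrightarrow> K $$ (i, j)) (at 0)"
    proof (cases i)
      case 0
      have "mtrace (mat_poly n (g * hh j) X) = 0" by (rule vanish) (simp add: g)
      moreover have "mtrace (mat_poly n (smult (1 / t) g * hh j) M) = mtrace (mat_poly n (g * hh j) M) / t" for t M
        by (simp add: mat_poly_smult mtrace_smult[of _ n])
      ultimately show ?thesis
        using trace_polynomial_derivative[OF X B, of "g * hh j"] 0 ij X0
        by (simp add: G_def K_def gg_def has_field_derivative_iff)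
    next
      case (Suc i')
      then show ?thesis using trace_polynomial_tendsto[OF X B, of "l i' * hh j"] ij
        by (simp add: G_def K_def gg_def)
    qed
  qed (auto simp: G_def K_def)
  moreover have "det K \<noteq> 0"
  proof (rule det_upper_triangular_nonzero[of _ "Suc ?r"])
    show "K \<in> carrier_mat (Suc ?r) (Suc ?r)" by (simp add: K_def)
    show "K $$ (i, j) = 0" if "i < Suc ?r" "j < i" for i j
      using that by (cases i; cases j) (auto simp: K_def hh_def l h intro!: vanish)
    show "K $$ (i, i) \<noteq> 0" if "i < Suc ?r" for i
      using that nz by (cases i) (auto simp: K_def hh_def l)
  qed
  ultimately have "\<forall>\<^sub>F t in at 0. det (G t) \<noteq> 0" by (rule tendsto_imp_eventually_ne)
  then show ?thesis
  proof (rule eventually_mono)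
    fix t assume "det (G t) \<noteq> 0"
    then have "Suc ?r \<le> card (spectrum (X + t \<cdot>\<^sub>m B))"
      using X B unfolding G_def by (intro card_spectrum_ge[of _ n "Suc ?r" "gg t" hh]) auto
    then show "?r < card (spectrum (X + t \<cdot>\<^sub>m B))" by simp
  qed
qed

lemma (in calogero_moser) shear_splits_eigenvalues:
  assumes "card (spectrum X) \<noteq> n"
  shows "\<exists>d. \<forall>\<^sub>F t in at 0. card (spectrum X) < card (spectrum (X + t \<cdot>\<^sub>m Y ^\<^sub>m d))"
proof -
  obtain \<mu> where \<mu>: "eigenvalue_seq n X \<mu>" using eigenvalue_seq_exists[OF X] .
  then have sp: "spectrum X = \<mu> ` {..<n}" by (simp add: eigenvalue_seq_def)
  then have "\<not> inj_on \<mu> {..<n}" using assms by (auto dest: card_image)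
  then obtain g h d where "\<And>i. i < n \<Longrightarrow> poly g (\<mu> i) = 0" "\<And>i. i < n \<Longrightarrow> poly h (\<mu> i) = 0"
    "mtrace (mat_poly n (pderiv (g * h)) X * Y ^\<^sub>m d) \<noteq> 0"
    using repeated_eigenvalue_witness[OF \<mu>] by blast
  then show ?thesis
    using card_spectrum_increases[OF X pow_carrier_mat[OF Y], of g h d] sp by auto
qed


section \<open>Normal form for simple spectrum\<close>

text \<open>
  The general second component of a Calogero-Moser pair whose first component is diagonal with
  distinct entries \<open>x\<close>. The diagonal \<open>y\<close> is unconstrained: it does not enter the commutator.
\<close>

definition cm_matrix :: "nat \<Rightarrow> (nat \<Rightarrow> complex) \<Rightarrow> (nat \<Rightarrow> complex) \<Rightarrow> complex mat" where
  "cm_matrix n x y = mat n n (\<lambda>(i, j). if i = j then y i else 1 / (x i - x j))"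

text \<open>
  With \<open>E\<^sub>i\<close> the spectral projections of \<open>X\<close>, take \<open>E\<^sub>i v\<close> as the columns of \<open>P\<close> and
  \<open>w\<^sup>T E\<^sub>i\<close> as the rows of \<open>Q\<close>. All the entries of \<open>Q f(X) P\<close> are then given by
  \<open>w\<^sup>T g(X) v = tr g(X)\<close>; in particular \<open>Q P = 1\<close>. In this basis \<open>v\<close> and \<open>w\<close> have all
  coordinates one, so the relation becomes \<open>(x\<^sub>i - x\<^sub>j) Y\<^sub>i\<^sub>j = 1\<close> off the diagonal.
\<close>

lemma (in calogero_moser) normal_form:
  assumes x: "eigenvalue_seq n X x" and inj: "inj_on x {..<n}"
  obtains P Q y where "P \<in> carrier_mat n n" "Q \<in> carrier_mat n n" "P * Q = 1\<^sub>m n" "Q * P = 1\<^sub>m n"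
    "\<And>f. Q * mat_poly n f X * P = mat_diag n (\<lambda>i. poly f (x i))"
    "Q * Y * P = cm_matrix n x y"
proof -
  have "\<exists>p. \<forall>j<n. poly p (x j) = (if j = i then 1 else 0)" if "i < n" for i
  proof -
    obtain p where p: "\<And>s. s \<in> x ` {..<n} \<Longrightarrow> poly p s = (if s = x i then 1 else 0)"
      using interpolation_exists[of "x ` {..<n}" "\<lambda>s. if s = x i then 1 else 0"] by blast
    show ?thesis by (rule exI[of _ p]) (use p inj that in \<open>auto simp: inj_on_def\<close>)
  qed
  then obtain l where l: "\<And>i j. i < n \<Longrightarrow> j < n \<Longrightarrow> poly (l i) (x j) = (if j = i then 1 else 0)" by metis
  define E where "E i = mat_poly n (l i) X" for i
  have E: "E i \<in> carrier_mat n n" for i by (simp add: E_def)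
  define P where "P = mat n n (\<lambda>(a, i). (E i *\<^sub>v v) $ a)"
  define Q where "Q = mat n n (\<lambda>(i, a). (transpose_mat (E i) *\<^sub>v w) $ a)"
  have PQ: "P \<in> carrier_mat n n" "Q \<in> carrier_mat n n" by (simp_all add: P_def Q_def)
  have entry: "(Q * A * P) $$ (i, j) = w \<bullet> (E i *\<^sub>v (A *\<^sub>v (E j *\<^sub>v v)))"
    if A: "A \<in> carrier_mat n n" and ij: "i < n" "j < n" for A i j
  proof -
    have r: "row Q i = transpose_mat (E i) *\<^sub>v w"
      using ij E[of i] by (intro eq_vecI) (auto simp: Q_def)
    have c: "col P j = E j *\<^sub>v v"
      using ij E[of j] by (intro eq_vecI) (auto simp: P_def)
    have "Q * A * P = Q * (A * P)" using PQ A by (simp add: assoc_mult_mat[of _ n n _ n _ n])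
    then have "(Q * A * P) $$ (i, j) = row Q i \<bullet> (A *\<^sub>v col P j)"
      using PQ A ij by (simp add: col_mult2[of _ n n] mult_mat_vec_def)
    also have "\<dots> = w \<bullet> (E i *\<^sub>v (A *\<^sub>v (E j *\<^sub>v v)))"
      unfolding r c by (rule pairing_transpose) (use A E w in \<open>auto intro!: mult_mat_vec_closed\<close>)
    finally show ?thesis .
  qed
  have poly_entry: "Q * mat_poly n f X * P = mat_diag n (\<lambda>i. poly f (x i))" for f
  proof (rule eq_matI)
    fix i j assume "i < dim_row (mat_diag n (\<lambda>i. poly f (x i)))" "j < dim_col (mat_diag n (\<lambda>i. poly f (x i)))"
    then have ij: "i < n" "j < n" by (auto simp: mat_diag_def)
    have "(Q * mat_poly n f X * P) $$ (i, j) = w \<bullet> (mat_poly n (l i * (f * l j)) X *\<^sub>v v)"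
      unfolding entry[OF mat_poly_carrier ij] E_def using v by (simp add: mat_poly_mult_vec[OF X])
    also have "\<dots> = (\<Sum>a<n. poly (l i * (f * l j)) (x a))" by (rule functional_of_poly[OF x])
    also have "\<dots> = (\<Sum>a<n. if a = i then (if i = j then poly f (x i) else 0) else 0)"
      by (rule sum.cong) (use ij l in auto)
    also have "\<dots> = mat_diag n (\<lambda>i. poly f (x i)) $$ (i, j)" using ij by (simp add: mat_diag_def)
    finally show "(Q * mat_poly n f X * P) $$ (i, j) = mat_diag n (\<lambda>i. poly f (x i)) $$ (i, j)" .
  qed (use PQ in \<open>auto simp: mat_diag_def\<close>)
  have "Q * P = Q * 1\<^sub>m n * P" using PQ by simp
  also have "\<dots> = mat_diag n (\<lambda>i. 1)" using poly_entry[of 1] X by simp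
  also have "\<dots> = 1\<^sub>m n" by (simp add: mat_diag_def one_mat_def)
  finally have QP: "Q * P = 1\<^sub>m n" .
  then have PQ1: "P * Q = 1\<^sub>m n" by (rule mat_mult_left_right_inverse[OF PQ(2,1)])
  have D: "Q * X * P = mat_diag n x" using poly_entry[of "[:0, 1:]"] X by (simp add: mat_poly_X)
  define y where "y i = (Q * Y * P) $$ (i, i)" for i
  have "Q * Y * P = cm_matrix n x y"
  proof (rule eq_matI)
    fix i j assume "i < dim_row (cm_matrix n x y)" "j < dim_col (cm_matrix n x y)"
    then have ij: "i < n" "j < n" by (auto simp: cm_matrix_def)
    let ?Y = "Q * Y * P"
    have split: "Q * (A * B) * P = (Q * A * P) * (Q * B * P)"
      if A: "A \<in> carrier_mat n n" and B: "B \<in> carrier_mat n n" for A B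
    proof -
      have "(Q * A * P) * (Q * B * P) = Q * A * (P * Q) * (B * P)"
        using A B PQ by (simp add: assoc_mult_mat[of _ n n _ n _ n])
      then show ?thesis using A B PQ PQ1 by (simp add: assoc_mult_mat[of _ n n _ n _ n])
    qed
    have YP: "?Y \<in> carrier_mat n n" using PQ Y by simp
    have one: "w \<bullet> (E a *\<^sub>v v) = 1" if "a < n" for a
    proof -
      have "w \<bullet> (E a *\<^sub>v v) = (\<Sum>b<n. poly (l a) (x b))" unfolding E_def by (rule functional_of_poly[OF x])
      also have "\<dots> = (\<Sum>b<n. if b = a then 1 else 0)" by (rule sum.cong) (use l that in auto)
      finally show ?thesis using that by simp
    qed
    have "(Q * (X * Y) * P) $$ (i, j) = (Q * (Y * X) * P) $$ (i, j) - (Q * 1\<^sub>m n * P) $$ (i, j) + 1"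
      using relation_under[OF E w, of "E j *\<^sub>v v" i] E[of i] E[of j] X Y v one ij
      by (simp add: entry[of _ i j] mult_mat_vec_closed assoc_mult_mat_vec[of _ n n _ n] del: right_mult_one_mat index_mult_mat(1))
    then have "x i * ?Y $$ (i, j) = ?Y $$ (i, j) * x j - (if i = j then 1 else 0) + 1"
      using QP PQ YP ij unfolding split[OF X Y] split[OF Y X] D
      by (simp add: mat_diag_mult_left[of _ n n] mat_diag_mult_right[of _ n n])
    then have "(x i - x j) * ?Y $$ (i, j) = (if i = j then 0 else 1)" by (simp add: algebra_simps split: if_splits)
    moreover have "x i \<noteq> x j" if "i \<noteq> j" using inj ij that by (auto simp: inj_on_def)
    ultimately show "?Y $$ (i, j) = cm_matrix n x y $$ (i, j)"
      using ij by (auto simp: cm_matrix_def y_def field_simps)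
  qed (use PQ Y in \<open>auto simp: cm_matrix_def\<close>)
  then show ?thesis using that[OF PQ PQ1 QP poly_entry] by blast
qed

section \<open>Singularity determines the diagonal\<close>

lemma det_scale_rows:
  fixes A :: "complex mat"
  assumes A: "A \<in> carrier_mat n n" and c: "\<And>i. i < n \<Longrightarrow> c i \<noteq> 0"
  shows "det (mat n n (\<lambda>(i, j). c i * A $$ (i, j))) = 0 \<longleftrightarrow> det A = 0"
proof -
  have "mat n n (\<lambda>(i, j). c i * A $$ (i, j)) = mat_diag n c * A"
    using A by (simp add: mat_diag_mult_left[of _ n n])
  moreover have "det (mat_diag n c) \<noteq> 0"
    by (rule det_upper_triangular_nonzero[of _ n]) (auto simp: mat_diag_def c)
  ultimately show ?thesis using A by (simp add: det_mult[of _ n])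
qed

lemma det_nonzero_if_trivial_kernel:
  fixes A :: "complex mat"
  assumes A: "A \<in> carrier_mat n n"
    and ker: "\<And>z. (\<And>i. i < n \<Longrightarrow> (\<Sum>j<n. A $$ (i, j) * z j) = 0) \<Longrightarrow> (\<And>i. i < n \<Longrightarrow> z i = 0)"
  shows "det A \<noteq> 0"
proof
  assume "det A = 0"
  then obtain z where z: "z \<in> carrier_vec n" "z \<noteq> 0\<^sub>v n" "A *\<^sub>v z = 0\<^sub>v n"
    using det_0_iff_vec_prod_zero_field[OF A] by blast
  have "(\<Sum>j<n. A $$ (i, j) * z $ j) = 0" if "i < n" for i
    using arg_cong[OF z(3), of "\<lambda>u. u $ i"] that A z(1) by (simp add: scalar_prod_def atLeast0LessThan)
  then have "z $ i = 0" if "i < n" for i using ker[of "\<lambda>i. z $ i"] that by blast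
  then show False using z by (auto intro!: eq_vecI)
qed

text \<open>
  Put \<open>\<eta>\<^sub>j\<close> near \<open>1 / s\<close> for \<open>j \<noteq> a\<close> (with the exception of \<open>j = m\<close> if \<open>m < n\<close>), choose \<open>\<eta>\<^sub>a\<close>
  so that the \<open>m\<close>-dimensional matrix is singular, and let \<open>s\<close> tend to zero. After multiplying the
  rows \<open>j \<noteq> a\<close> by \<open>s\<close>, this matrix tends to one that differs from the identity in row \<open>a\<close> only,
  which forces \<open>\<eta>\<^sub>a + \<delta>\<^sub>a \<longlongrightarrow> 0\<close>. The
  scaled \<open>n\<close>-dimensional matrix is then singular in the limit too. For \<open>m = n\<close> its limit has
  determinant \<open>- \<delta>\<^sub>a\<close>. For \<open>m < n\<close> keep \<open>\<eta>\<^sub>m = 0\<close> and row \<open>m\<close> unscaled; the limit then has the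
  nonzero determinant \<open>1 / (x\<^sub>a - x\<^sub>m)\<^sup>2\<close>.
\<close>

lemma singular_cm_matrices_determine:
  fixes x \<delta> :: "nat \<Rightarrow> complex"
  assumes inj: "inj_on x {..<n}" and mn: "m \<le> n"
    and sing: "\<And>\<eta>. det (cm_matrix m x (\<lambda>i. \<eta> i + \<delta> i)) = 0 \<Longrightarrow> det (cm_matrix n x \<eta>) = 0"
    and a: "a < m"
  shows "m = n \<and> \<delta> a = 0"
proof (rule ccontr)
  assume neg: "\<not> (m = n \<and> \<delta> a = 0)"
  define A where "A s e = mat m m (\<lambda>(i, j). if i = a then (if j = a then e else 1 / (x i - x j))
      else if i = j then 1 else s / (x i - x j))" for s e :: complex
  have Ac: "A s e \<in> carrier_mat m m" for s e by (simp add: A_def)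
  define c0 where "c0 s = det (A s 0)" for s
  define c1 where "c1 s = det (A s 1) - c0 s" for s
  have affine: "det (A s e) = c0 s + e * c1 s" for s e
  proof -
    have cof: "cofactor (A s e) a j = cofactor (A s 0) a j" if "j < m" for e j
    proof -
      have "mat_delete (A s e) a j = mat_delete (A s 0) a j"
        by (rule eq_matI) (auto simp: mat_delete_def A_def)
      then show ?thesis by (simp add: cofactor_def)
    qed
    have "det (A s e) = (\<Sum>j<m. A s e $$ (a, j) * cofactor (A s 0) a j)" for e
      unfolding laplace_expansion_row[OF Ac a] by (intro sum.cong refl) (simp add: cof[where e = e])
    also have "\<dots> e = (\<Sum>j<m. A s 0 $$ (a, j) * cofactor (A s 0) a j + (if j = a then e * cofactor (A s 0) a a else 0))" for e
      by (intro sum.cong refl) (use a in \<open>auto simp: A_def\<close>)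
    finally have "det (A s e) = (\<Sum>j<m. A s 0 $$ (a, j) * cofactor (A s 0) a j) + e * cofactor (A s 0) a a" for e
      using a by (simp add: sum.distrib)
    from this[of e] this[of 0] this[of 1] show ?thesis by (simp add: c0_def c1_def)
  qed
  have limA: "((\<lambda>s. det (A s e)) \<longlongrightarrow> det (A 0 e)) (at 0)" for e
  proof (rule tendsto_det[OF Ac Ac])
    fix i j assume ij: "i < m" "j < m"
    have "((\<lambda>s. s / (x i - x j)) \<longlongrightarrow> 0 / (x i - x j)) (at 0)"
      unfolding divide_inverse by (intro tendsto_intros)
    then show "((\<lambda>s. A s e $$ (i, j)) \<longlongrightarrow> A 0 e $$ (i, j)) (at 0)" using ij by (auto simp: A_def)
  qed
  have A00: "det (A 0 0) = 0"
  proof -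
    have "A 0 0 *\<^sub>v unit_vec m a = 0\<^sub>v m" using a by (intro eq_vecI) (auto simp: A_def)
    then show ?thesis using det_0_iff_vec_prod_zero_field[OF Ac] a
      by (metis unit_vec_carrier unit_vec_nonzero)
  qed
  have A01: "det (A 0 1) \<noteq> 0"
  proof (rule det_nonzero_if_trivial_kernel[OF Ac])
    fix z i assume ker: "\<And>i. i < m \<Longrightarrow> (\<Sum>j<m. A 0 1 $$ (i, j) * z j) = 0" and i: "i < m"
    have other: "z i = 0" if "i < m" "i \<noteq> a" for i
    proof -
      have "(\<Sum>j<m. A 0 1 $$ (i, j) * z j) = (\<Sum>j<m. if j = i then z i else 0)"
        by (intro sum.cong) (use that in \<open>auto simp: A_def\<close>)
      then show ?thesis using ker[of i] that by simp
    qed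
    have "(\<Sum>j<m. A 0 1 $$ (a, j) * z j) = (\<Sum>j<m. if j = a then z a else 0)"
      by (intro sum.cong) (use a other in \<open>auto simp: A_def\<close>)
    then have "z a = 0" using ker[OF a] a by simp
    then show "z i = 0" using other i by (cases "i = a") auto
  qed
  have c0: "(c0 \<longlongrightarrow> 0) (at 0)" using limA[of 0] A00 by (simp add: c0_def[abs_def])
  have c1: "(c1 \<longlongrightarrow> det (A 0 1)) (at 0)"
    using tendsto_diff[OF limA[of 1] c0] by (simp add: c1_def[abs_def])
  define e where "e s = - c0 s / c1 s" for s
  have e: "(e \<longlongrightarrow> 0) (at 0)"
    using tendsto_divide[OF tendsto_minus[OF c0] c1 A01] by (simp add: e_def[abs_def])
  \<comment> \<open>The value \<open>e s\<close> is the diagonal entry in row \<open>a\<close> that makes the \<open>m\<close>-dimensional matrix singular.\<close>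
  define \<eta> where "\<eta> s i = (if i = a then e s - \<delta> a else if i < m then 1 / s - \<delta> i
      else if i = m then 0 else 1 / s)" for s i
  define c where "c s i = (if i = a \<or> i = m then 1 else s)" for s :: complex and i
  define B where "B s = mat n n (\<lambda>(i, j). c s i * cm_matrix n x (\<eta> s) $$ (i, j))" for s
  define B0 where "B0 = mat n n (\<lambda>(i, j). if i = a then (if j = a then - \<delta> a else 1 / (x i - x j))
      else if i = m then (if j = m then 0 else 1 / (x i - x j)) else if i = j then 1 else 0)"
  have "\<forall>\<^sub>F s in at 0. c1 s \<noteq> 0" using c1 A01 by (rule tendsto_imp_eventually_ne)
  moreover have "\<forall>\<^sub>F s::complex in at 0. s \<noteq> 0" by (simp add: eventually_at_filter)
  ultimately have "\<forall>\<^sub>F s in at 0. det (B s) = 0"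
  proof eventually_elim
    case (elim s)
    have "det (A s (e s)) = 0" using elim by (simp add: affine e_def)
    also have "A s (e s) = mat m m (\<lambda>(i, j). (if i = a then 1 else s) * cm_matrix m x (\<lambda>i. \<eta> s i + \<delta> i) $$ (i, j))"
      using elim by (intro eq_matI) (auto simp: A_def cm_matrix_def \<eta>_def)
    finally have "det (cm_matrix m x (\<lambda>i. \<eta> s i + \<delta> i)) = 0"
      using elim by (subst (asm) det_scale_rows) (auto simp: cm_matrix_def)
    then have "det (cm_matrix n x (\<eta> s)) = 0" by (rule sing)
    then show "det (B s) = 0"
      unfolding B_def using elim by (subst det_scale_rows) (auto simp: cm_matrix_def c_def)
  qed
  then have "((\<lambda>s. det (B s)) \<longlongrightarrow> 0) (at 0)" by (simp add: tendsto_eventually)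
  moreover have "((\<lambda>s. det (B s)) \<longlongrightarrow> det B0) (at 0)"
  proof (rule tendsto_det[of _ n])
    fix i j assume ij: "i < n" "j < n"
    have off: "((\<lambda>s. s / (x i - x j)) \<longlongrightarrow> 0) (at 0)"
      using tendsto_mult_left_zero[OF tendsto_ident_at, of "1 / (x i - x j)"] by simp
    have diag: "((\<lambda>s. s * (1 / s - \<delta> i)) \<longlongrightarrow> 1) (at 0)"
    proof (rule Lim_transform_eventually)
      show "((\<lambda>s. 1 - s * \<delta> i) \<longlongrightarrow> 1) (at 0)" by (rule tendsto_eq_intros | simp)+
      show "\<forall>\<^sub>F s in at 0. 1 - s * \<delta> i = s * (1 / s - \<delta> i)"
        by (auto simp: eventually_at_filter field_simps)
    qed
    have diag': "((\<lambda>s::complex. s * (1 / s)) \<longlongrightarrow> 1) (at 0)"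
      by (rule Lim_transform_eventually[of "\<lambda>_. 1"]) (auto simp: eventually_at_filter)
    have ea: "((\<lambda>s. e s - \<delta> a) \<longlongrightarrow> - \<delta> a) (at 0)"
      using tendsto_diff[OF e tendsto_const[of "\<delta> a"]] by simp
    show "((\<lambda>s. B s $$ (i, j)) \<longlongrightarrow> B0 $$ (i, j)) (at 0)"
    proof (cases "i = j")
      case True
      then show ?thesis using ij ea diag diag' a
        by (cases "i = a"; cases "i = m"; cases "i < m") (auto simp: B_def B0_def cm_matrix_def \<eta>_def c_def)
    next
      case False
      then show ?thesis using ij off a
        by (cases "i = a"; cases "i = m") (auto simp: B_def B0_def cm_matrix_def c_def)
    qed
  qed (auto simp: B_def B0_def)
  ultimately have "det B0 = 0" by (metis tendsto_unique at_neq_bot)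
  moreover have "det B0 \<noteq> 0"
  proof (rule det_nonzero_if_trivial_kernel[of _ n])
    show "B0 \<in> carrier_mat n n" by (simp add: B0_def)
    fix z i assume ker: "\<And>i. i < n \<Longrightarrow> (\<Sum>j<n. B0 $$ (i, j) * z j) = 0" and i: "i < n"
    have an: "a < n" using a mn by simp
    have other: "z i = 0" if "i < n" "i \<noteq> a" "i \<noteq> m" for i
    proof -
      have "(\<Sum>j<n. B0 $$ (i, j) * z j) = (\<Sum>j<n. if j = i then z i else 0)"
        by (intro sum.cong) (use that in \<open>auto simp: B0_def\<close>)
      then show ?thesis using ker[of i] that by simp
    qed
    have "z a = 0 \<and> (m < n \<longrightarrow> z m = 0)"
    proof (cases "m < n")
      case True
      have ne: "x m \<noteq> x a" using inj_onD[OF inj, of m a] True an a by auto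
      have "(\<Sum>j<n. B0 $$ (m, j) * z j) = (\<Sum>j<n. if j = a then z a / (x m - x a) else 0)"
        by (intro sum.cong) (use True a other in \<open>auto simp: B0_def\<close>)
      then have za: "z a = 0" using ker[OF True] an ne by simp
      have "(\<Sum>j<n. B0 $$ (a, j) * z j) = (\<Sum>j<n. if j = m then z m / (x a - x m) else 0)"
        by (intro sum.cong) (use True an a za other in \<open>auto simp: B0_def\<close>)
      then have "z m = 0" using ker[OF an] True ne by simp
      then show ?thesis using za by simp
    next
      case False
      then have "m = n" "\<delta> a \<noteq> 0" using neg mn by auto
      have "(\<Sum>j<n. B0 $$ (a, j) * z j) = (\<Sum>j<n. if j = a then - \<delta> a * z a else 0)"
        by (intro sum.cong) (use an \<open>m = n\<close> other in \<open>auto simp: B0_def\<close>)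
      then have "z a = 0" using ker[OF an] an \<open>\<delta> a \<noteq> 0\<close> by simp
      then show ?thesis using False by simp
    qed
    then show "z i = 0" using other i by (cases "i = a"; cases "i = m") auto
  qed
  ultimately show False by simp
qed

section \<open>Equivariant maps\<close>

lemma CM_pairs_calogero_moser:
  assumes "(X, Y) \<in> CM_pairs n"
  obtains v w where "calogero_moser n X Y v w"
proof -
  have XY: "X \<in> carrier_mat n n" "Y \<in> carrier_mat n n"
    and rk: "vec_space.rank n (X * Y - Y * X + 1\<^sub>m n) = 1"
    using assms by (auto simp: CM_pairs_def)
  have "X * Y - Y * X + 1\<^sub>m n \<in> carrier_mat n n" using XY by auto
  from rank_one_factorisation[OF this rk] obtain v w where vw: "v \<in> carrier_vec n" "w \<in> carrier_vec n"
    and act: "\<And>z. z \<in> carrier_vec n \<Longrightarrow> (X * Y - Y * X + 1\<^sub>m n) *\<^sub>v z = (w \<bullet> z) \<cdot>\<^sub>v v" by blast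
  have "calogero_moser n X Y v w"
  proof
    fix y z :: "complex vec" assume y: "y \<in> carrier_vec n" and z: "z \<in> carrier_vec n"
    have c: "A *\<^sub>v z \<in> carrier_vec n" if "A \<in> carrier_mat n n" for A and z :: "complex vec"
      by (rule mult_mat_vec_closed[OF that])
    have "(X * Y - Y * X + 1\<^sub>m n) *\<^sub>v z = X *\<^sub>v (Y *\<^sub>v z) - Y *\<^sub>v (X *\<^sub>v z) + z"
      by (subst add_mult_distrib_mat_vec[of _ n n], (use XY z in \<open>auto intro!: minus_carrier_mat\<close>)[3],
          subst minus_mult_distrib_mat_vec[of _ n n], (use XY z in auto)[3])
        (use XY z in \<open>simp add: assoc_mult_mat_vec[of _ n n _ n]\<close>)
    then have "y \<bullet> (X *\<^sub>v (Y *\<^sub>v z) - Y *\<^sub>v (X *\<^sub>v z) + z) = y \<bullet> ((w \<bullet> z) \<cdot>\<^sub>v v)"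
      using act[OF z] by simp
    then have "y \<bullet> (X *\<^sub>v (Y *\<^sub>v z)) - y \<bullet> (Y *\<^sub>v (X *\<^sub>v z)) + y \<bullet> z = (w \<bullet> z) * (y \<bullet> v)"
      using y z vw c[OF XY(1)] c[OF XY(2)]
      by (simp add: scalar_prod_add_distrib[of _ n] scalar_prod_minus_distrib[of _ n] minus_carrier_vec[of _ n])
    then show "y \<bullet> (X *\<^sub>v (Y *\<^sub>v z)) = y \<bullet> (Y *\<^sub>v (X *\<^sub>v z)) - y \<bullet> z + (w \<bullet> z) * (y \<bullet> v)"
      by (simp add: algebra_simps)
  qed (use XY vw in auto)
  then show ?thesis by (rule that)
qed

lemma CM_pairs_shear:
  assumes "(X, Y) \<in> CM_pairs n"
  shows "(X + mat_poly n p Y, Y) \<in> CM_pairs n" "(X, Y + mat_poly n p X) \<in> CM_pairs n"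
proof -
  have XY: "X \<in> carrier_mat n n" "Y \<in> carrier_mat n n" using assms by (auto simp: CM_pairs_def)
  have "(X + mat_poly n p Y) * Y - Y * (X + mat_poly n p Y) = X * Y - Y * X"
    using XY mat_poly_commute[OF XY(2), of p]
    by (simp add: add_mult_distrib_mat[of _ n n _ _ n] mult_add_distrib_mat[of _ n n _ n])
      (intro eq_matI; auto simp del: index_mult_mat(1))
  moreover have "X * (Y + mat_poly n p X) - (Y + mat_poly n p X) * X = X * Y - Y * X"
    using XY mat_poly_commute[OF XY(1), of p]
    by (simp add: add_mult_distrib_mat[of _ n n _ _ n] mult_add_distrib_mat[of _ n n _ n])
      (intro eq_matI; auto simp del: index_mult_mat(1))
  ultimately show "(X + mat_poly n p Y, Y) \<in> CM_pairs n" "(X, Y + mat_poly n p X) \<in> CM_pairs n"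
    using assms by (auto simp: CM_pairs_def)
qed

lemma CM_class_eq_iff:
  assumes "(X, Y) \<in> CM_pairs n" "(X', Y') \<in> CM_pairs n"
  shows "CM_class n X Y = CM_class n X' Y' \<longleftrightarrow>
    (\<exists>P Q. similar_mat_wit X X' P Q \<and> similar_mat_wit Y Y' P Q)"
  unfolding CM_class_def eq_equiv_class_iff[OF equiv_CM_conj assms]
  using assms by (auto simp: CM_conj_def)

lemma CM_class_in_space: "(X, Y) \<in> CM_pairs n \<Longrightarrow> CM_class n X Y \<in> CM_space n"
  by (simp add: CM_class_def CM_space_def quotientI)

lemma CM_spaceE:
  assumes "c \<in> CM_space n"
  obtains X Y where "(X, Y) \<in> CM_pairs n" "c = CM_class n X Y"
  using assms unfolding CM_space_def CM_class_def by (elim quotientE) auto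

lemma similar_mat_wit_add:
  assumes "similar_mat_wit A A' P Q" "similar_mat_wit B B' P Q" "A \<in> carrier_mat n n" "B \<in> carrier_mat n n"
  shows "similar_mat_wit (A + B) (A' + B') P Q"
proof -
  note D = similar_mat_witD2[OF assms(3,1)] similar_mat_witD2[OF assms(4,2)]
  have "P * (A' + B') * Q = P * A' * Q + P * B' * Q"
    using D by (simp add: mult_add_distrib_mat[of _ n n _ n] add_mult_distrib_mat[of _ n n _ _ n])
  then show ?thesis using D by (intro similar_mat_witI[of _ _ n]) auto
qed

lemma CM_class_unshear:
  assumes XY: "(X, Y) \<in> CM_pairs n" "(X', Y') \<in> CM_pairs n"
    and eq: "CM_class n (X + mat_poly n p Y) Y = CM_class n (X' + mat_poly n p Y') Y'"
  shows "CM_class n X Y = CM_class n X' Y'"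
proof -
  have c: "X \<in> carrier_mat n n" "Y \<in> carrier_mat n n" "X' \<in> carrier_mat n n" "Y' \<in> carrier_mat n n"
    using XY by (auto simp: CM_pairs_def)
  obtain P Q where P: "similar_mat_wit (X + mat_poly n p Y) (X' + mat_poly n p Y') P Q"
    and Q: "similar_mat_wit Y Y' P Q"
    using eq CM_class_eq_iff[OF CM_pairs_shear(1)[OF XY(1)] CM_pairs_shear(1)[OF XY(2)], of p p] by blast
  have "similar_mat_wit (mat_poly n (- p) Y) (mat_poly n (- p) Y') P Q"
    using similar_mat_witD2[OF c(2) Q] similar_mat_wit_mat_poly[OF Q c(2), of "- p"]
    by (intro similar_mat_witI[of _ _ n]) auto
  from similar_mat_wit_add[OF P this, of n]
  have "similar_mat_wit (X + mat_poly n p Y + mat_poly n (- p) Y) (X' + mat_poly n p Y' + mat_poly n (- p) Y') P Q"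
    using c by auto
  moreover have "A + mat_poly n p B + mat_poly n (- p) B = A" if "A \<in> carrier_mat n n" for A B
  proof -
    have "A + mat_poly n p B + mat_poly n (- p) B = A + mat_poly n (p + - p) B"
      unfolding mat_poly_add by (rule assoc_add_mat) (use that in auto)
    then show ?thesis using that by simp
  qed
  ultimately have "similar_mat_wit X X' P Q" using c by simp
  then show ?thesis using Q CM_class_eq_iff[OF XY] by blast
qed

lemma eigenvalue_seq_reorder:
  assumes \<mu>: "eigenvalue_seq n X \<mu>" "inj_on \<mu> {..<n}" and x: "inj_on x {..<n}" "x ` {..<n} = \<mu> ` {..<n}"
  shows "eigenvalue_seq n X x"
proof -
  have sum: "(\<Sum>i<n. F (x i)) = (\<Sum>i<n. F (\<mu> i))" for F :: "complex \<Rightarrow> complex"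
    using sum.reindex[OF x(1), of F] sum.reindex[OF \<mu>(2), of F] x(2) by (simp add: comp_def)
  have prod: "(\<Prod>i<n. F (x i)) = (\<Prod>i<n. F (\<mu> i))" for F :: "complex \<Rightarrow> complex poly"
    using prod.reindex[OF x(1), of F] prod.reindex[OF \<mu>(2), of F] x(2) by (simp add: comp_def)
  show ?thesis
    using \<mu>(1) x(2) sum[of "poly _"] prod[of "\<lambda>s. [:- s, 1:]"] by (simp add: eigenvalue_seq_def)
qed

lemma det_eq_0_iff_spectrum:
  assumes A: "(A :: complex mat) \<in> carrier_mat n n"
  shows "det A = 0 \<longleftrightarrow> 0 \<in> spectrum A"
proof -
  have "(\<exists>v. v \<in> carrier_vec n \<and> v \<noteq> 0\<^sub>v n \<and> A *\<^sub>v v = 0\<^sub>v n) \<longleftrightarrow> eigenvalue A 0"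
  proof -
    have "0 \<cdot>\<^sub>v v = 0\<^sub>v n" if "v \<in> carrier_vec n" for v :: "complex vec"
      using that by (intro eq_vecI) auto
    then show ?thesis using A by (fastforce simp: eigenvalue_def eigenvector_def)
  qed
  then show ?thesis
    unfolding det_0_iff_vec_prod_zero_field[OF A] by (simp add: spectrum_def)
qed

text \<open>
  The dimensions \<open>n\<close> and \<open>m\<close> may coincide, so that both parts of the theorem are statements about
  the same situation.
\<close>

locale equivariant_CM_map =
  fixes n m :: nat
    and \<phi> \<psi> :: "(free_alg set \<Rightarrow> free_alg set) \<Rightarrow>
      (complex mat \<times> complex mat) set \<Rightarrow> (complex mat \<times> complex mat) set"
    and f :: "(complex mat \<times> complex mat) set \<Rightarrow> (complex mat \<times> complex mat) set"
  assumes \<phi>: "is_CM_action n \<phi>" and \<psi>: "is_CM_action m \<psi>" and m: "m \<ge> 1"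
    and equivariant: "equivariant_map weyl_aut_group (CM_space n) \<phi> (CM_space m) \<psi> f"
begin

definition related :: "complex mat \<Rightarrow> complex mat \<Rightarrow> complex mat \<Rightarrow> complex mat \<Rightarrow> bool" where
  "related X Y X' Y' \<longleftrightarrow> (X, Y) \<in> CM_pairs n \<and> (X', Y') \<in> CM_pairs m \<and>
     f (CM_class n X Y) = CM_class m X' Y'"

lemma related_closed:
  assumes "related X Y X' Y'"
  shows "X \<in> carrier_mat n n" "Y \<in> carrier_mat n n" "X' \<in> carrier_mat m m" "Y' \<in> carrier_mat m m"
  using assms by (auto simp: related_def CM_pairs_def)

lemma related_exists:
  assumes "(X, Y) \<in> CM_pairs n"
  obtains X' Y' where "related X Y X' Y'"
proof -
  have "f (CM_class n X Y) \<in> CM_space m"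
    using equivariant CM_class_in_space[OF assms] by (auto simp: equivariant_map_def)
  then show ?thesis using that assms by (auto simp: related_def elim!: CM_spaceE)
qed

lemma related_shear:
  assumes r: "related X Y X' Y'"
  shows "related (X + mat_poly n p Y) Y (X' + mat_poly m p Y') Y'"
    and "related X (Y + mat_poly n p X) X' (Y' + mat_poly m p X')"
proof -
  have P: "(X, Y) \<in> CM_pairs n" "(X', Y') \<in> CM_pairs m" and e: "f (CM_class n X Y) = CM_class m X' Y'"
    using r by (auto simp: related_def)
  have eq: "f (\<phi> g (CM_class n X Y)) = \<psi> g (CM_class m X' Y')" if "g \<in> carrier weyl_aut_group" for g
    using equivariant that CM_class_in_space[OF P(1)] e by (simp add: equivariant_map_def)
  show "related (X + mat_poly n p Y) Y (X' + mat_poly m p Y') Y'"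
    using eq[OF weyl_Phi(1), of p] \<phi> \<psi> P by (simp add: related_def is_CM_action_def CM_pairs_shear)
  show "related X (Y + mat_poly n p X) X' (Y' + mat_poly m p X')"
    using eq[OF weyl_Psi(1), of p] \<phi> \<psi> P by (simp add: related_def is_CM_action_def CM_pairs_shear)
qed

text \<open>
  The automorphism given by \<open>p\<close> fixes the class of \<open>(X, Y)\<close>, so it fixes the image; comparing the
  traces of the component that it changes gives the claim.
\<close>

lemma annihilator_traceless:
  assumes r: "related X Y X' Y'"
  shows "mat_poly n p Y = 0\<^sub>m n n \<Longrightarrow> mtrace (mat_poly m p Y') = 0"
    and "mat_poly n p X = 0\<^sub>m n n \<Longrightarrow> mtrace (mat_poly m p X') = 0"
proof -
  note c = related_closed[OF r]
  have same: "CM_class m A B = CM_class m X' Y'" if "related X Y A B" for A B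
    using that r by (simp add: related_def)
  have tr: "mtrace A = mtrace X'" "mtrace B = mtrace Y'" if AB: "related X Y A B" for A B
  proof -
    obtain P Q where "similar_mat_wit A X' P Q" "similar_mat_wit B Y' P Q"
      using same[OF AB] AB r CM_class_eq_iff[of A B m X' Y'] by (auto simp: related_def)
    then show "mtrace A = mtrace X'" "mtrace B = mtrace Y'"
      using similar_mat_wit_mtrace related_closed(3,4)[OF AB] by blast+
  qed
  show "mtrace (mat_poly m p Y') = 0" if "mat_poly n p Y = 0\<^sub>m n n"
  proof -
    have "mtrace (X' + mat_poly m p Y') = mtrace X'"
      using related_shear(1)[OF r, of p] that c by (intro tr(1)[of _ Y']) simp
    then show ?thesis using c by (simp add: mtrace_add[of _ m])
  qed
  show "mtrace (mat_poly m p X') = 0" if "mat_poly n p X = 0\<^sub>m n n"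
  proof -
    have "mtrace (Y' + mat_poly m p X') = mtrace Y'"
      using related_shear(2)[OF r, of p] that c by (intro tr(2)[of X']) simp
    then show ?thesis using c by (simp add: mtrace_add[of _ m])
  qed
qed

text \<open>
  For an eigenvalue \<open>s\<close> of \<open>A'\<close> that is not one of \<open>A\<close>, some multiple of the characteristic
  polynomial of \<open>A\<close> is the indicator of \<open>s\<close> on the spectrum of \<open>A'\<close>, and its trace at \<open>A'\<close> is
  the multiplicity of \<open>s\<close>.
\<close>

lemma spectrum_subset_of_traceless:
  assumes A: "A \<in> carrier_mat n n" and A': "A' \<in> carrier_mat m m"
    and tr: "\<And>p. mat_poly n p A = 0\<^sub>m n n \<Longrightarrow> mtrace (mat_poly m p A') = 0"
  shows "spectrum A' \<subseteq> spectrum A"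
proof (rule ccontr)
  assume "\<not> spectrum A' \<subseteq> spectrum A"
  then obtain s where s: "s \<in> spectrum A'" "s \<notin> spectrum A" by blast
  obtain \<mu> where \<mu>: "eigenvalue_seq n A \<mu>" using eigenvalue_seq_exists[OF A] .
  obtain \<mu>' where \<mu>': "eigenvalue_seq m A' \<mu>'" using eigenvalue_seq_exists[OF A'] .
  let ?q = "\<Prod>i<n. [:- \<mu> i, 1:]"
  have q: "poly ?q s \<noteq> 0" using s \<mu> by (auto simp: poly_prod eigenvalue_seq_def)
  obtain r where r: "\<And>t. t \<in> spectrum A' \<Longrightarrow> poly r t = (if t = s then 1 / poly ?q s else 0)"
    using interpolation_exists[OF card_finite_spectrum(1)[OF A'], of "\<lambda>t. if t = s then 1 / poly ?q s else 0"] by blast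
  have "mat_poly n (?q * r) A = 0\<^sub>m n n"
    using \<mu> by (simp add: mat_poly_mult[OF A] eigenvalue_seq_def left_mult_zero_mat[of _ n n])
  then have "0 = (\<Sum>i<m. poly (?q * r) (\<mu>' i))" using tr[of "?q * r"] \<mu>' by (simp add: eigenvalue_seq_def del: poly_mult)
  also have "\<dots> = (\<Sum>i<m. if \<mu>' i = s then 1 else 0)"
    by (intro sum.cong) (use r q \<mu>' in \<open>auto simp: eigenvalue_seq_def\<close>)
  also have "\<dots> = of_nat (card {i. i < m \<and> \<mu>' i = s})" by (simp add: sum.If_cases Int_def)
  finally have "card {i. i < m \<and> \<mu>' i = s} = 0" by simp
  moreover have "{i. i < m \<and> \<mu>' i = s} \<noteq> {}" using s \<mu>' by (auto simp: eigenvalue_seq_def)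
  ultimately show False by simp
qed

lemma related_spectrum:
  assumes r: "related X Y X' Y'"
  shows "spectrum X' \<subseteq> spectrum X" "spectrum Y' \<subseteq> spectrum Y"
  using spectrum_subset_of_traceless related_closed[OF r] annihilator_traceless[OF r] by blast+

text \<open>
  Order the eigenvalues of \<open>X\<close> such that the first \<open>m\<close> are those of \<open>X'\<close>, and bring both points to
  normal form. At every pair reached by some \<open>\<Psi>\<^sub>q\<close>, a singular second component of the image forces
  a singular second component of the point, by the inclusion of spectra.
\<close>

lemma related_simple_spectrum:
  assumes r: "related X Y X' Y'" and simple: "card (spectrum X) = n" "card (spectrum X') = m"
  shows "n = m \<and> CM_class n X Y = CM_class m X' Y'"
proof -
  note c = related_closed[OF r]
  have pairs: "(X, Y) \<in> CM_pairs n" "(X', Y') \<in> CM_pairs m" using r by (auto simp: related_def)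
  have sub: "spectrum X' \<subseteq> spectrum X" by (rule related_spectrum(1)[OF r])
  have fin: "finite (spectrum X)" by (rule card_finite_spectrum(1)[OF c(1)])
  have mn: "m \<le> n" using card_mono[OF fin sub] simple by simp
  obtain \<mu> where \<mu>: "eigenvalue_seq n X \<mu>" using eigenvalue_seq_exists[OF c(1)] .
  obtain \<mu>' where \<mu>': "eigenvalue_seq m X' \<mu>'" using eigenvalue_seq_exists[OF c(3)] .
  have sp: "spectrum X = \<mu> ` {..<n}" "spectrum X' = \<mu>' ` {..<m}" using \<mu> \<mu>' by (auto simp: eigenvalue_seq_def)
  have inj: "inj_on \<mu> {..<n}" "inj_on \<mu>' {..<m}" using simple sp by (auto intro: eq_card_imp_inj_on)
  have "card (spectrum X - spectrum X') = card {m..<n}"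
    using sub simple by (simp add: card_Diff_subset finite_subset[OF _ fin])
  then obtain e where e: "bij_betw e {m..<n} (spectrum X - spectrum X')"
    using finite_same_card_bij[of "{m..<n}" "spectrum X - spectrum X'"] fin by auto
  define x where "x i = (if i < m then \<mu>' i else e i)" for i
  have xm: "x ` {..<m} = spectrum X'" "inj_on x {..<m}"
    using sp inj by (auto simp: x_def inj_on_def)
  have xe: "x ` {m..<n} = spectrum X - spectrum X'" "inj_on x {m..<n}"
    using e by (auto simp: x_def bij_betw_def inj_on_def)
  have un: "{..<n} = {..<m} \<union> {m..<n}" using mn by auto
  have xim: "x ` {..<n} = spectrum X" unfolding un image_Un xm xe using sub by auto
  have xinj: "inj_on x {..<n}" using simple xim by (auto intro: eq_card_imp_inj_on)
  have xs: "eigenvalue_seq n X x" by (rule eigenvalue_seq_reorder[OF \<mu> inj(1) xinj]) (simp add: xim sp)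
  have xs': "eigenvalue_seq m X' x" by (rule eigenvalue_seq_reorder[OF \<mu>' inj(2) xm(2)]) (simp add: xm sp)
  obtain v w where "calogero_moser n X Y v w" using CM_pairs_calogero_moser[OF pairs(1)] .
  from calogero_moser.normal_form[OF this xs xinj] obtain P Q y
    where P: "P \<in> carrier_mat n n" "Q \<in> carrier_mat n n" "P * Q = 1\<^sub>m n" "Q * P = 1\<^sub>m n"
      and DX: "\<And>g. Q * mat_poly n g X * P = mat_diag n (\<lambda>i. poly g (x i))"
      and DY: "Q * Y * P = cm_matrix n x y" by blast
  obtain v' w' where "calogero_moser m X' Y' v' w'" using CM_pairs_calogero_moser[OF pairs(2)] .
  from calogero_moser.normal_form[OF this xs' xm(2)] obtain P' Q' y'
    where P': "P' \<in> carrier_mat m m" "Q' \<in> carrier_mat m m" "P' * Q' = 1\<^sub>m m" "Q' * P' = 1\<^sub>m m"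
      and DX': "\<And>g. Q' * mat_poly m g X' * P' = mat_diag m (\<lambda>i. poly g (x i))"
      and DY': "Q' * Y' * P' = cm_matrix m x y'" by blast
  define \<delta> where "\<delta> i = y' i - y i" for i
  have det_sum: "det (B + C) = det (Q0 * B * P0 + Q0 * C * P0)"
    if "B \<in> carrier_mat k k" "C \<in> carrier_mat k k" "P0 \<in> carrier_mat k k" "Q0 \<in> carrier_mat k k"
      "P0 * Q0 = 1\<^sub>m k" "Q0 * P0 = 1\<^sub>m k" for k and B C P0 Q0 :: "complex mat"
  proof -
    have "Q0 * B * P0 + Q0 * C * P0 = Q0 * (B + C) * P0"
      using that by (simp add: mult_add_distrib_mat[of _ k k _ k] add_mult_distrib_mat[of _ k k _ _ k])
    moreover have "similar_mat (Q0 * (B + C) * P0) (B + C)"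
      by (rule similar_matI[of _ _ Q0 P0 k]) (use that in auto)
    ultimately show ?thesis using det_similar by metis
  qed
  have sing: "det (cm_matrix n x \<eta>) = 0" if \<eta>: "det (cm_matrix m x (\<lambda>i. \<eta> i + \<delta> i)) = 0" for \<eta>
  proof -
    obtain q where q: "\<And>s. s \<in> x ` {..<n} \<Longrightarrow> poly q s = \<eta> (the_inv_into {..<n} x s) - y (the_inv_into {..<n} x s)"
      using interpolation_exists[of "x ` {..<n}" "\<lambda>s. \<eta> (the_inv_into {..<n} x s) - y (the_inv_into {..<n} x s)"] by blast
    have q: "poly q (x i) = \<eta> i - y i" if "i < n" for i
      using q[of "x i"] that by (simp add: the_inv_into_f_f[OF xinj])
    have rel: "related X (Y + mat_poly n q X) X' (Y' + mat_poly m q X')" by (rule related_shear(2)[OF r])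
    have "det (Y' + mat_poly m q X') = det (cm_matrix m x y' + mat_diag m (\<lambda>i. poly q (x i)))"
      using det_sum[of Y' m "mat_poly m q X'" P' Q'] P' c DX' DY' by simp
    also have "cm_matrix m x y' + mat_diag m (\<lambda>i. poly q (x i)) = cm_matrix m x (\<lambda>i. \<eta> i + \<delta> i)"
      using q mn by (intro eq_matI) (auto simp: cm_matrix_def mat_diag_def \<delta>_def)
    finally have "det (Y' + mat_poly m q X') = 0" using \<eta> by simp
    then have "0 \<in> spectrum (Y' + mat_poly m q X')" using det_eq_0_iff_spectrum[of "Y' + mat_poly m q X'" m] c by simp
    then have "0 \<in> spectrum (Y + mat_poly n q X)" using related_spectrum(2)[OF rel] by blast
    then have "det (Y + mat_poly n q X) = 0" using det_eq_0_iff_spectrum[of "Y + mat_poly n q X" n] c by simp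
    moreover have "det (Y + mat_poly n q X) = det (cm_matrix n x y + mat_diag n (\<lambda>i. poly q (x i)))"
      using det_sum[of Y n "mat_poly n q X" P Q] P c DX DY by simp
    moreover have "cm_matrix n x y + mat_diag n (\<lambda>i. poly q (x i)) = cm_matrix n x \<eta>"
      using q by (intro eq_matI) (auto simp: cm_matrix_def mat_diag_def)
    ultimately show ?thesis by simp
  qed
  have eq: "m = n \<and> \<delta> a = 0" if "a < m" for a
    by (rule singular_cm_matrices_determine[OF xinj mn sing that])
  then have nm: "m = n" using m by force
  have "y i = y' i" if "i < n" for i using eq[of i] nm that by (simp add: \<delta>_def)
  then have cm: "cm_matrix n x y = cm_matrix n x y'"
    by (intro eq_matI) (auto simp: cm_matrix_def)
  have unconjugate: "similar_mat_wit A D P0 Q0"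
    if "Q0 * A * P0 = D" "A \<in> carrier_mat n n" "P0 \<in> carrier_mat n n" "Q0 \<in> carrier_mat n n"
      "P0 * Q0 = 1\<^sub>m n" "Q0 * P0 = 1\<^sub>m n" for A D P0 Q0 :: "complex mat"
  proof -
    have "P0 * D * Q0 = (P0 * Q0) * A * (P0 * Q0)"
      unfolding that(1)[symmetric] using that(2-4) by (simp add: assoc_mult_mat[of _ n n _ n _ n])
    also have "\<dots> = A" using that(2,5) by simp
    finally have A: "A = P0 * D * Q0" by (rule sym)
    have "D \<in> carrier_mat n n" unfolding that(1)[symmetric] using that(2-4) by simp
    then show ?thesis by (rule similar_mat_witI[OF that(5,6) A that(2) _ that(3,4)])
  qed
  have DX1: "Q * X * P = mat_diag n x" using DX[of "[:0, 1:]"] c by (simp add: mat_poly_X)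
  have DX1': "Q' * X' * P' = mat_diag n x" using DX'[of "[:0, 1:]"] c(3) by (simp add: mat_poly_X nm)
  have sX: "similar_mat_wit X (mat_diag n x) P Q" and sY: "similar_mat_wit Y (cm_matrix n x y) P Q"
    by (rule unconjugate[OF DX1 c(1) P]) (rule unconjugate[OF DY c(2) P])
  have sX': "similar_mat_wit X' (mat_diag n x) P' Q'" and sY': "similar_mat_wit Y' (cm_matrix n x y) P' Q'"
    unfolding cm
    by (rule unconjugate[OF DX1' c(3)[unfolded nm] P'[unfolded nm]])
      (rule unconjugate[OF DY'[unfolded nm] c(4)[unfolded nm] P'[unfolded nm]])
  have "similar_mat_wit X X' (P * Q') (P' * Q)"
    by (rule similar_mat_wit_trans[OF sX similar_mat_wit_sym[OF sX']])
  moreover have "similar_mat_wit Y Y' (P * Q') (P' * Q)"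
    by (rule similar_mat_wit_trans[OF sY similar_mat_wit_sym[OF sY']])
  ultimately have "\<exists>P Q. similar_mat_wit X X' P Q \<and> similar_mat_wit Y Y' P Q" by blast
  then have "CM_class n X Y = CM_class n X' Y'"
    unfolding CM_class_eq_iff[OF pairs(1) pairs(2)[unfolded nm]] .
  then show ?thesis by (simp add: nm)
qed

text \<open>
  Induction on the number of eigenvalues lost to multiplicities, at both points together. The
  parameter \<open>t\<close> can be chosen for both points at once because the estimates hold for all small
  \<open>t \<noteq> 0\<close>; afterwards the automorphism is undone.
\<close>

lemma related_equal:
  assumes "related X Y X' Y'"
  shows "n = m \<and> CM_class n X Y = CM_class m X' Y'"
  using assms
proof (induction "(n - card (spectrum X)) + (m - card (spectrum X'))" arbitrary: X X' rule: less_induct)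
  case less
  note r = less.prems
  note c = related_closed[OF r]
  have pairs: "(X, Y) \<in> CM_pairs n" "(X', Y') \<in> CM_pairs m" using r by (auto simp: related_def)
  have le: "card (spectrum A) \<le> k" if "A \<in> carrier_mat k k" for k and A :: "complex mat"
    by (rule card_finite_spectrum(2)[OF that])
  show ?case
  proof (cases "card (spectrum X) = n \<and> card (spectrum X') = m")
    case True
    then show ?thesis using related_simple_spectrum[OF r] by blast
  next
    case False
    have keep: "\<forall>\<^sub>F t in at 0. card (spectrum X) \<le> card (spectrum (X + t \<cdot>\<^sub>m Y ^\<^sub>m d))"
      "\<forall>\<^sub>F t in at 0. card (spectrum X') \<le> card (spectrum (X' + t \<cdot>\<^sub>m Y' ^\<^sub>m d))" for d
      using c by (auto intro!: card_spectrum_persists)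
    have "\<exists>d. (\<forall>\<^sub>F t in at 0. card (spectrum X) < card (spectrum (X + t \<cdot>\<^sub>m Y ^\<^sub>m d))) \<or>
      (\<forall>\<^sub>F t in at 0. card (spectrum X') < card (spectrum (X' + t \<cdot>\<^sub>m Y' ^\<^sub>m d)))"
    proof -
      obtain v w where "calogero_moser n X Y v w" using CM_pairs_calogero_moser[OF pairs(1)] .
      note 1 = calogero_moser.shear_splits_eigenvalues[OF this]
      obtain v' w' where "calogero_moser m X' Y' v' w'" using CM_pairs_calogero_moser[OF pairs(2)] .
      note 2 = calogero_moser.shear_splits_eigenvalues[OF this]
      show ?thesis using False 1 2 by blast
    qed
    then obtain d where "\<forall>\<^sub>F t in at (0 :: complex). card (spectrum X) + card (spectrum X') <
        card (spectrum (X + t \<cdot>\<^sub>m Y ^\<^sub>m d)) + card (spectrum (X' + t \<cdot>\<^sub>m Y' ^\<^sub>m d))"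
    proof (elim exE disjE)
      fix d assume *: "\<forall>\<^sub>F t in at 0. card (spectrum X) < card (spectrum (X + t \<cdot>\<^sub>m Y ^\<^sub>m d))"
      show ?thesis by (rule that[of d]) (use * keep(2)[of d] in \<open>eventually_elim, simp\<close>)
    next
      fix d assume *: "\<forall>\<^sub>F t in at 0. card (spectrum X') < card (spectrum (X' + t \<cdot>\<^sub>m Y' ^\<^sub>m d))"
      show ?thesis by (rule that[of d]) (use * keep(1)[of d] in \<open>eventually_elim, simp\<close>)
    qed
    from eventually_happens'[OF at_neq_bot this] obtain t where t: "card (spectrum X) + card (spectrum X') <
        card (spectrum (X + t \<cdot>\<^sub>m Y ^\<^sub>m d)) + card (spectrum (X' + t \<cdot>\<^sub>m Y' ^\<^sub>m d))" ..
    define p where "p = monom t d"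
    have p: "t \<cdot>\<^sub>m Y ^\<^sub>m d = mat_poly n p Y" "t \<cdot>\<^sub>m Y' ^\<^sub>m d = mat_poly m p Y'"
      using c by (simp_all add: p_def mat_poly_monom)
    have r': "related (X + mat_poly n p Y) Y (X' + mat_poly m p Y') Y'" by (rule related_shear(1)[OF r])
    note c' = related_closed[OF r']
    have ih: "n = m \<and> CM_class n (X + mat_poly n p Y) Y = CM_class m (X' + mat_poly m p Y') Y'"
    proof (rule less.hyps[OF _ r'])
      show "n - card (spectrum (X + mat_poly n p Y)) + (m - card (spectrum (X' + mat_poly m p Y')))
          < n - card (spectrum X) + (m - card (spectrum X'))"
        using t le[OF c(1)] le[OF c(3)] le[OF c'(1)] le[OF c'(3)] unfolding p by linarith
    qed
    have nm: "m = n" using ih by simp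
    have "CM_class n X Y = CM_class n X' Y'"
      by (rule CM_class_unshear[OF pairs(1) pairs(2)[unfolded nm] conjunct2[OF ih, unfolded nm]])
    then show ?thesis by (simp add: nm)
  qed
qed

lemma fixes_every_point:
  assumes "c \<in> CM_space n"
  shows "n = m \<and> f c = c"
proof -
  obtain X Y where XY: "(X, Y) \<in> CM_pairs n" "c = CM_class n X Y" using CM_spaceE[OF assms] .
  obtain X' Y' where r: "related X Y X' Y'" using related_exists[OF XY(1)] .
  have "f c = CM_class m X' Y'" using r unfolding related_def XY(2) by blast
  also have "\<dots> = CM_class n X Y" by (rule conjunct2[OF related_equal[OF r], symmetric])
  also have "\<dots> = c" by (rule XY(2)[symmetric])
  finally have "f c = c" .
  with conjunct1[OF related_equal[OF r]] show ?thesis by (rule conjI)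
qed

end

text \<open>
  The matrices of the normal form with \<open>x\<^sub>i = i\<close> and zero diagonal in \<open>Y\<close> have
  \<open>[X, Y] + 1\<close> equal to the matrix of ones.
\<close>

lemma CM_space_nonempty:
  assumes n: "n \<ge> 1"
  shows "CM_space n \<noteq> {}"
proof -
  interpret vec_space "TYPE(complex)" n .
  let ?X = "mat_diag n of_nat :: complex mat"
  let ?Y = "cm_matrix n of_nat (\<lambda>_. 0)"
  let ?J = "mat n n (\<lambda>(i, j). 1) :: complex mat"
  have c: "?Y \<in> carrier_mat n n" "?J \<in> carrier_mat n n" by (simp_all add: cm_matrix_def)
  have "?X * ?Y - ?Y * ?X + 1\<^sub>m n = ?J"
  proof (rule eq_matI)
    fix i j assume "i < dim_row ?J" "j < dim_col ?J"
    then have ij: "i < n" "j < n" by auto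
    have "(of_nat i - of_nat j) * (1 / (of_nat i - of_nat j)) = (1 :: complex)" if "i \<noteq> j"
      using that by simp
    then show "(?X * ?Y - ?Y * ?X + 1\<^sub>m n) $$ (i, j) = ?J $$ (i, j)"
      unfolding mat_diag_mult_left[OF c(1)] mat_diag_mult_right[OF c(1)] using ij
      by (cases "i = j") (auto simp: cm_matrix_def simp flip: diff_divide_distrib)
  qed (auto simp: cm_matrix_def mat_diag_def)
  moreover have "rank ?J = 1"
  proof (rule antisym)
    show "rank ?J \<le> 1"
      by (rule rank_le_1_product_entries[of ?J n "\<lambda>_. 1" "\<lambda>_. 1"]) auto
    let ?b = "col ?J 0"
    have b: "?b \<in> set (cols ?J)"
      using nth_mem[of 0 "cols ?J"] cols_nth[of 0 ?J] n by simp
    have bc: "?b \<in> carrier_vec n" by (rule carrier_vecI) simp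
    have "lin_indpt {?b}"
    proof
      assume "lin_dep {?b}"
      then obtain a where a: "lincomb a {?b} = 0\<^sub>v n" "a ?b \<noteq> 0"
        using finite_lin_dep[of "{?b}"] bc by auto
      have "lincomb a {?b} = a ?b \<cdot>\<^sub>v ?b" using bc by (simp add: lincomb_def)
      then have "(a ?b \<cdot>\<^sub>v ?b) $ 0 = 0" using a n by simp
      then show False using a n by simp
    qed
    from rank_ge_card_indpt[OF c(2) _ this] b show "1 \<le> rank ?J" by simp
  qed
  ultimately have "(?X, ?Y) \<in> CM_pairs n" using c by (auto simp: CM_pairs_def)
  then show ?thesis using CM_class_in_space by blast
qed

theorem theorem1p3:
  fixes act :: "nat \<Rightarrow> (free_alg set \<Rightarrow> free_alg set) \<Rightarrow>
    (complex mat \<times> complex mat) set \<Rightarrow> (complex mat \<times> complex mat) set"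
  assumes "\<And>n. n \<ge> 1 \<Longrightarrow> is_CM_action n (act n)"
  shows "(\<forall>n\<ge>1. \<forall>f.
            equivariant_map weyl_aut_group (CM_space n) (act n) (CM_space n) (act n) f \<longrightarrow>
            (\<forall>c\<in>CM_space n. f c = c)) \<and>
         (\<forall>n\<ge>1. \<forall>m\<ge>1. n \<noteq> m \<longrightarrow>
            \<not> (\<exists>f. equivariant_map weyl_aut_group (CM_space n) (act n) (CM_space m) (act m) f))"
proof (intro conjI allI impI ballI notI)
  fix n f c
  assume "n \<ge> 1" "equivariant_map weyl_aut_group (CM_space n) (act n) (CM_space n) (act n) f"
  then interpret equivariant_CM_map n n "act n" "act n" f by unfold_locales (auto intro: assms)
  show "f c = c" if "c \<in> CM_space n" using fixes_every_point[OF that] by blast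
next
  fix n m :: nat
  assume nm: "n \<ge> 1" "m \<ge> 1" "n \<noteq> m"
    and "\<exists>f. equivariant_map weyl_aut_group (CM_space n) (act n) (CM_space m) (act m) f"
  then obtain f where "equivariant_map weyl_aut_group (CM_space n) (act n) (CM_space m) (act m) f" by blast
  with nm interpret equivariant_CM_map n m "act n" "act m" f by unfold_locales (auto intro: assms)
  obtain c where "c \<in> CM_space n" using CM_space_nonempty[OF nm(1)] by blast
  then show False using fixes_every_point nm(3) by blast
qed

end
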